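(* Let $G$ be adjoint of type $\mathbf{B}_n$, $n\ge 6$. (1) There are two order profiles of sections, given as follows. Any section $\mathcal S$ given by $\mathcal S(s_i)=t_i\sigma_i$ with $$a_{1,1}a_{1,2}^2=a_{2,2}a_{2,3}^2=\cdots=a_{n-2,n-2}a_{n-2,n-1}^2=a_{n-1,n-1}a_{n-1,n-2}^2=-1,$$ $a_{n-1,n}^4a_{n-1,n-1}^2=1$, $a_{n,n-1}^2a_{n,n}^2=1$, and $a_{1,n}^2=a_{2,n}^2=\cdots=a_{n-2,n}^2=1$, is an optimal section, in fact a homomorphic section, whereas the Tits section $\mathcal N_\circ$ is not. Moreover $\mathcal N_\circ(s_i)^2\ne1$ for all $i=1,\dots,n-1$, whereas $\mathcal N_\circ(s_n)^2=1$; and any section evaluated on $s_n$ has order $2$. (2) Two sections are $T$-conjugate if and only if they have the same values of $a_{1,n}$, of $a_{1,1}a_{1,2}^2$, and of $a_{n,n-1}a_{n,n}$.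
   Context: $F$ is an algebraically closed field, $G$ an almost-simple connected reductive group over $F$, $T$ a maximal torus, $N=N_G(T)$, $W=N/T$, $\pi:N\to W$ the projection. Let $\alpha_1,\dots,\alpha_n$ be the simple roots in Bourbaki numbering ($\alpha_i=e_i-e_{i+1}$ for $i<n$, $\alpha_n=e_n$), $s_i$ the corresponding reflections, $\alpha_i^\vee$ the simple coroots, $\omega_i$ the fundamental coweights. Fix a realization of the root system: isomorphisms $u_\alpha:\mathbf G_a\to U_\alpha$ onto the root subgroups with $tu_\alpha(x)t^{-1}=u_\alpha(\alpha(t)x)$, such that $\sigma_\alpha=u_\alpha(1)u_{-\alpha}(-1)u_\alpha(1)\in N$ maps to $s_\alpha$ and $u_\alpha(x)u_{-\alpha}(-x^{-1})u_\alpha(x)=\alpha^\vee(x)\sigma_\alpha$ for $x\in F^\times$; put $\sigma_i=\sigma_{\alpha_i}$. A section is a map $\mathcal S:W\to N$ with $\pi\circ\mathcal S=\mathrm{id}$ satisfying the braid relations (equivalently $\mathcal S$ is multiplicative along reduced expressions). It is determined by $\mathcal S(s_i)=t_i\sigma_i$, $t_i\in T$. The Tits section $\mathcal N_\circ$ is the one with all $t_i=1$. A section is homomorphic if it is a group homomorphism. The order profile of $\mathcal S$ is the Dynkin diagram with the node of each $\alpha_i$ labeled by the order of $\mathcal S(s_i)$. For two sections write $\mathcal S'<\mathcal S$ if the order of $\mathcal S'(s_i)$ is greater than the order of $\mathcal S(s_i)$ for all $i$; this translates to a partial order on order profiles, and a section is called optimal if it has the unique maximal order profile with respect to this partial order.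 Two sections $\mathcal S,\mathcal S'$ are $T$-conjugate if there is $t\in T$ with $t\mathcal S(w)t^{-1}=\mathcal S'(w)$ for all $w\in W$. Coordinates: $(x_1,\dots,x_n)$ denotes $\omega_1(x_1)\cdots\omega_n(x_n)\in T$. The sections are exactly those given by $t_i$ of the following form, with all $a_{i,j}\in F^\times$: $t_1=(a_{1,1},a_{1,2},1,\dots,1,a_{1,n})$; for $2\le i\le n-2$, $t_i$ has coordinates $a_{i,i}^{-1}a_{i,i+1}^{-1},a_{i,i},a_{i,i+1}$ in positions $i-1,i,i+1$, $n$-th coordinate $a_{i,n}$, and $1$ elsewhere, where $a_{n-2,n}=a_{n-1,n-2}a_{n-1,n-1}a_{n-1,n}$; $t_{n-1}=(1,\dots,1,a_{n-1,n-2},a_{n-1,n-1},a_{n-1,n})$; $t_n=(1,\dots,1,a_{n,n-1},a_{n,n})$; subject to $a_{1,n}=a_{2,n}=\cdots=a_{n-2,n}$, $a_{1,n}^2=1$, $a_{1,1}a_{1,2}^2=a_{2,2}a_{2,3}^2=\cdots=a_{n-2,n-2}a_{n-2,n-1}^2=a_{n-1,n-1}^{-1}a_{n-1,n-2}^{-2}$, $a_{n-1,n}^4a_{n-1,n-1}^2=1$, and $a_{n,n-1}^2a_{n,n}^2=1$.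
   Formalization: Assumes char F ≠ 2 (in char 2 the Tits section is homomorphic, so part (1) fails), and S' < S means orders at least as large at all i with different profiles (with strict inequality at all i no two profiles compare, since s_n always gives order 2). *)

theory Defs
  imports
    "HOL-Algebra.Coset"
    "HOL-Algebra.Multiplicative_Group"
    "HOL-Algebra.Group_Action"
    "HOL-Library.Extended_Nat"
    "Jordan_Normal_Form.Determinant"
begin

section \<open>Linear algebraic groups over an algebraically closed field\<close>

text \<open>
  A linear algebraic group is identified with its group of rational points, a Zariski closed
  subgroup of some \<open>GL\<^sub>m\<close>.
\<close>

abbreviation GL :: "nat \<Rightarrow> 'a::field mat monoid" where
  "GL m \<equiv> units_of (ring_mat TYPE('a) m ())"

abbreviation subgrp :: "nat \<Rightarrow> 'a::field mat set \<Rightarrow> 'a mat monoid" where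
  "subgrp m H \<equiv> (GL m)\<lparr>carrier := H\<rparr>"

inductive_set regular :: "nat \<Rightarrow> ('a::field mat \<Rightarrow> 'a) set" for m :: nat where
  const: "(\<lambda>A. c) \<in> regular m"
| entry: "i < m \<Longrightarrow> j < m \<Longrightarrow> (\<lambda>A. A $$ (i, j)) \<in> regular m"
| inv_det: "(\<lambda>A. inverse (det A)) \<in> regular m"
| add: "f \<in> regular m \<Longrightarrow> g \<in> regular m \<Longrightarrow> (\<lambda>A. f A + g A) \<in> regular m"
| mult: "f \<in> regular m \<Longrightarrow> g \<in> regular m \<Longrightarrow> (\<lambda>A. f A * g A) \<in> regular m"

definition zclosed :: "nat \<Rightarrow> 'a::field mat set \<Rightarrow> bool" where
  "zclosed m X \<longleftrightarrow> (\<exists>E \<subseteq> regular m. X = {A \<in> carrier (GL m). \<forall>f\<in>E. f A = 0})"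

definition zconnected :: "nat \<Rightarrow> 'a::field mat set \<Rightarrow> bool" where
  "zconnected m X \<longleftrightarrow>
     (\<forall>A B. zclosed m A \<longrightarrow> zclosed m B \<longrightarrow> A \<union> B = X \<longrightarrow> A \<inter> B = {} \<longrightarrow> A = {} \<or> B = {})"

definition alg_group :: "nat \<Rightarrow> 'a::field mat set \<Rightarrow> bool" where
  "alg_group m H \<longleftrightarrow> subgroup H (GL m) \<and> zclosed m H"

definition alg_morphism ::
  "nat \<Rightarrow> nat \<Rightarrow> 'a::field mat set \<Rightarrow> 'a mat set \<Rightarrow> ('a mat \<Rightarrow> 'a mat) \<Rightarrow> bool" where
  "alg_morphism m k X Y f \<longleftrightarrow>
     f \<in> X \<rightarrow> Y \<and> (\<forall>i<k. \<forall>j<k. \<exists>h\<in>regular m. \<forall>A\<in>X. f A $$ (i, j) = h A)"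

definition diag_group :: "nat \<Rightarrow> 'a::field mat set" where
  "diag_group r = {A \<in> carrier (GL r). diagonal_mat A}"

definition torus :: "nat \<Rightarrow> 'a::field mat set \<Rightarrow> bool" where
  "torus m T \<longleftrightarrow> alg_group m T \<and>
     (\<exists>r f g. alg_morphism r m (diag_group r) T f \<and> alg_morphism m r T (diag_group r) g \<and>
        (\<forall>A\<in>diag_group r. \<forall>B\<in>diag_group r. f (A * B) = f A * f B) \<and>
        (\<forall>A\<in>diag_group r. g (f A) = A) \<and> (\<forall>t\<in>T. f (g t) = t))"

definition maximal_torus :: "nat \<Rightarrow> 'a::field mat set \<Rightarrow> 'a mat set \<Rightarrow> bool" where
  "maximal_torus m G T \<longleftrightarrow>
     torus m T \<and> T \<subseteq> G \<and> (\<forall>T'. torus m T' \<longrightarrow> T \<subseteq> T' \<longrightarrow> T' \<subseteq> G \<longrightarrow> T' = T)"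

definition unipotent :: "nat \<Rightarrow> 'a::field mat set \<Rightarrow> bool" where
  "unipotent m U \<longleftrightarrow> (\<forall>A\<in>U. \<exists>k. (A - 1\<^sub>m m) ^\<^sub>m k = 0\<^sub>m m m)"

definition connected_reductive :: "nat \<Rightarrow> 'a::field mat set \<Rightarrow> bool" where
  "connected_reductive m G \<longleftrightarrow> alg_group m G \<and> zconnected m G \<and>
     (\<forall>U. alg_group m U \<and> zconnected m U \<and> U \<lhd> subgrp m G \<and> unipotent m U \<longrightarrow> U = {1\<^sub>m m})"

definition almost_simple :: "nat \<Rightarrow> 'a::field mat set \<Rightarrow> bool" where
  "almost_simple m G \<longleftrightarrow> (\<exists>g\<in>G. \<exists>h\<in>G. g * h \<noteq> h * g) \<and>
     (\<forall>H. alg_group m H \<and> zconnected m H \<and> H \<lhd> subgrp m G \<longrightarrow> H = {1\<^sub>m m} \<or> H = G)"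

definition centralizer :: "'a::field mat set \<Rightarrow> 'a mat set \<Rightarrow> 'a mat set" where
  "centralizer G T = {g \<in> G. \<forall>t\<in>T. g * t = t * g}"


section \<open>Characters, cocharacters, roots\<close>

text \<open>Characters are functions on all matrices of which only the values on \<open>T\<close> matter;
  likewise a cocharacter matters only on nonzero arguments.\<close>

definition is_character :: "nat \<Rightarrow> 'a::field mat set \<Rightarrow> ('a mat \<Rightarrow> 'a) \<Rightarrow> bool" where
  "is_character m T \<chi> \<longleftrightarrow> (\<exists>f\<in>regular m. \<forall>t\<in>T. \<chi> t = f t) \<and>
     (\<forall>t\<in>T. \<chi> t \<noteq> 0) \<and> (\<forall>t\<in>T. \<forall>t'\<in>T. \<chi> (t * t') = \<chi> t * \<chi> t')"

text \<open>The matrix entries of a cocharacter are Laurent polynomials.\<close>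

definition is_cocharacter :: "nat \<Rightarrow> 'a::field mat set \<Rightarrow> ('a \<Rightarrow> 'a mat) \<Rightarrow> bool" where
  "is_cocharacter m T c \<longleftrightarrow> (\<forall>x. x \<noteq> 0 \<longrightarrow> c x \<in> T) \<and>
     (\<forall>x y. x \<noteq> 0 \<longrightarrow> y \<noteq> 0 \<longrightarrow> c (x * y) = c x * c y) \<and>
     (\<forall>i<m. \<forall>j<m. \<exists>(p::'a poly) (k::nat). \<forall>x. x \<noteq> 0 \<longrightarrow> c x $$ (i, j) = poly p x / x ^ k)"

text \<open>
  \<open>u\<close> is an isomorphism of algebraic groups from the additive group onto a closed subgroup of
  \<open>G\<close>, on which \<open>T\<close> acts through \<open>\<chi>\<close>.  A regular left inverse makes the image closed and
  the bijection onto it an isomorphism of varieties.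
\<close>

definition root_hom ::
  "nat \<Rightarrow> 'a::field mat set \<Rightarrow> 'a mat set \<Rightarrow> ('a mat \<Rightarrow> 'a) \<Rightarrow> ('a \<Rightarrow> 'a mat) \<Rightarrow> bool" where
  "root_hom m G T \<chi> u \<longleftrightarrow> range u \<subseteq> G \<and> (\<forall>x y. u (x + y) = u x * u y) \<and>
     (\<forall>i<m. \<forall>j<m. \<exists>p::'a poly. \<forall>x. u x $$ (i, j) = poly p x) \<and>
     (\<exists>f\<in>regular m. \<forall>x. f (u x) = x) \<and>
     (\<forall>t\<in>T. \<forall>x. t * u x * inv\<^bsub>GL m\<^esub> t = u (\<chi> t * x))"

text \<open>For reductive \<open>G\<close>, the characters singled out here are the nonzero weights of \<open>T\<close> on
  the Lie algebra of \<open>G\<close>.\<close>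

definition is_root :: "nat \<Rightarrow> 'a::field mat set \<Rightarrow> 'a mat set \<Rightarrow> ('a mat \<Rightarrow> 'a) \<Rightarrow> bool" where
  "is_root m G T \<chi> \<longleftrightarrow> is_character m T \<chi> \<and> (\<exists>t\<in>T. \<chi> t \<noteq> 1) \<and> (\<exists>u. root_hom m G T \<chi> u)"

text \<open>The root subgroup of a root is the unique closed subgroup that admits such an isomorphism.\<close>

definition root_subgroup ::
  "nat \<Rightarrow> 'a::field mat set \<Rightarrow> 'a mat set \<Rightarrow> ('a mat \<Rightarrow> 'a) \<Rightarrow> 'a mat set \<Rightarrow> bool" where
  "root_subgroup m G T \<chi> U \<longleftrightarrow>
     (\<exists>u. root_hom m G T \<chi> u \<and> range u = U) \<and> (\<forall>u. root_hom m G T \<chi> u \<longrightarrow> range u = U)"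


section \<open>Combinatorics of the root system of type \<open>B\<^sub>n\<close>\<close>

text \<open>Vectors of \<open>\<int>\<^sup>n\<close> are functions \<open>nat \<Rightarrow> int\<close> vanishing outside \<open>{1..n}\<close>.\<close>

definition lattice_vecs :: "nat \<Rightarrow> (nat \<Rightarrow> int) set" where
  "lattice_vecs n = {v. \<forall>k. k \<notin> {1..n} \<longrightarrow> v k = 0}"

definition dotp :: "nat \<Rightarrow> (nat \<Rightarrow> int) \<Rightarrow> (nat \<Rightarrow> int) \<Rightarrow> int" where
  "dotp n v w = (\<Sum>k=1..n. v k * w k)"

text \<open>The vectors \<open>\<plusminus>e\<^sub>i\<close> and \<open>\<plusminus>e\<^sub>i \<plusminus> e\<^sub>j\<close>: the integral vectors of squared length 1 or 2.\<close>

definition B_roots :: "nat \<Rightarrow> (nat \<Rightarrow> int) set" where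
  "B_roots n = {v \<in> lattice_vecs n. dotp n v v \<in> {1, 2}}"

definition simple_root :: "nat \<Rightarrow> nat \<Rightarrow> nat \<Rightarrow> int" where
  "simple_root n i = (\<lambda>k. (if k = i then 1 else 0) - (if i < n \<and> k = i + 1 then 1 else 0))"

text \<open>\<open>\<langle>w, v\<^sup>\<or>\<rangle> = 2(w, v)/(v, v)\<close>; the division is exact for roots \<open>v\<close>.\<close>

definition coroot_pairing :: "nat \<Rightarrow> (nat \<Rightarrow> int) \<Rightarrow> (nat \<Rightarrow> int) \<Rightarrow> int" where
  "coroot_pairing n w v = 2 * dotp n w v div dotp n v v"


section \<open>Adjoint groups of type \<open>B\<^sub>n\<close> with a realization\<close>

text \<open>
  \<open>group_of \<subseteq> GL\<^sub>msize\<close> with torus \<open>torus_of\<close>; \<open>eps i\<close> is the character \<open>e\<^sub>i\<close>,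
  \<open>coweight i\<close> the fundamental coweight \<open>\<omega>\<^sub>i\<close>, and \<open>rootmap v\<close> the map \<open>u\<^sub>\<alpha>\<close>
  of the root \<open>\<alpha>\<close> with coordinate vector \<open>v\<close>.
\<close>

record 'a realized_group =
  msize :: nat
  rnk :: nat
  group_of :: "'a mat set"
  torus_of :: "'a mat set"
  eps :: "nat \<Rightarrow> 'a mat \<Rightarrow> 'a"
  coweight :: "nat \<Rightarrow> 'a \<Rightarrow> 'a mat"
  rootmap :: "(nat \<Rightarrow> int) \<Rightarrow> 'a \<Rightarrow> 'a mat"

definition chi :: "'a::field realized_group \<Rightarrow> (nat \<Rightarrow> int) \<Rightarrow> 'a mat \<Rightarrow> 'a" where
  "chi D v t = (\<Prod>i=1..rnk D. eps D i t powi v i)"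

definition alpha :: "'a::field realized_group \<Rightarrow> nat \<Rightarrow> 'a mat \<Rightarrow> 'a" where
  "alpha D i = chi D (simple_root (rnk D) i)"

text \<open>
  Type \<open>B\<^sub>n\<close>: \<open>v \<mapsto> chi D v\<close> embeds \<open>\<int>\<^sup>n\<close> into the character lattice of \<open>T\<close> and maps the
  standard root system onto the roots of \<open>G\<close>.  Adjoint: the character lattice is the root
  lattice, i.e. it is generated by the simple roots.
\<close>

definition adjoint_type_B :: "'a::alg_closed_field realized_group \<Rightarrow> bool" where
  "adjoint_type_B D \<longleftrightarrow>
     (let m = msize D; n = rnk D; G = group_of D; T = torus_of D in
       connected_reductive m G \<and> almost_simple m G \<and> maximal_torus m G T \<and>
       (\<forall>i\<in>{1..n}. is_character m T (eps D i)) \<and>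
       (\<forall>v\<in>lattice_vecs n. (\<forall>t\<in>T. chi D v t = 1) \<longrightarrow> v = (\<lambda>k. 0)) \<and>
       (\<forall>v\<in>B_roots n. is_root m G T (chi D v)) \<and>
       (\<forall>\<chi>. is_root m G T \<chi> \<longrightarrow> (\<exists>v\<in>B_roots n. \<forall>t\<in>T. \<chi> t = chi D v t)) \<and>
       (\<forall>\<chi>. is_character m T \<chi> \<longrightarrow>
          (\<exists>c::nat \<Rightarrow> int. \<forall>t\<in>T. \<chi> t = (\<Prod>i=1..n. alpha D i t powi c i))))"

definition fundamental_coweights :: "'a::field realized_group \<Rightarrow> bool" where
  "fundamental_coweights D \<longleftrightarrow>
     (\<forall>j\<in>{1..rnk D}. is_cocharacter (msize D) (torus_of D) (coweight D j) \<and>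
        (\<forall>i\<in>{1..rnk D}. \<forall>x. x \<noteq> 0 \<longrightarrow> alpha D i (coweight D j x) = (if i = j then x else 1)))"

text \<open>The element \<open>(x\<^sub>1, \<dots>, x\<^sub>n) = \<omega>\<^sub>1(x\<^sub>1) \<cdots> \<omega>\<^sub>n(x\<^sub>n)\<close> of the torus.\<close>

definition torus_pt :: "'a::field realized_group \<Rightarrow> (nat \<Rightarrow> 'a) \<Rightarrow> 'a mat" where
  "torus_pt D x = foldr (\<lambda>j A. coweight D j (x j) * A) [1..<Suc (rnk D)] (1\<^sub>m (msize D))"

text \<open>Expansion of a coroot in the basis of fundamental coweights:
  \<open>\<alpha>\<^sup>\<or> = \<Sum>\<^sub>j \<langle>\<alpha>\<^sub>j, \<alpha>\<^sup>\<or>\<rangle> \<omega>\<^sub>j\<close>.\<close>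

definition coroot :: "'a::field realized_group \<Rightarrow> (nat \<Rightarrow> int) \<Rightarrow> 'a \<Rightarrow> 'a mat" where
  "coroot D v x = torus_pt D (\<lambda>j. x powi coroot_pairing (rnk D) (simple_root (rnk D) j) v)"

definition normalizer_of :: "'a::field realized_group \<Rightarrow> 'a mat set" where
  "normalizer_of D = normalizer (subgrp (msize D) (group_of D)) (torus_of D)"

definition normalizer_grp :: "'a::field realized_group \<Rightarrow> 'a mat monoid" where
  "normalizer_grp D = subgrp (msize D) (normalizer_of D)"

definition weyl :: "'a::field realized_group \<Rightarrow> 'a mat set monoid" where
  "weyl D = normalizer_grp D Mod torus_of D"

definition proj :: "'a::field realized_group \<Rightarrow> 'a mat \<Rightarrow> 'a mat set" where
  "proj D g = torus_of D #>\<^bsub>normalizer_grp D\<^esub> g"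

text \<open>
  The reflection \<open>s\<^sub>\<alpha>\<close> as an element of \<open>W = N/T\<close>: the set of all elements of \<open>N\<close> that act on
  \<open>T\<close> by \<open>t \<mapsto> t \<alpha>\<^sup>\<or>(\<alpha>(t))\<^sup>-\<^sup>1\<close>.  As \<open>T\<close> is its own centralizer, this is one coset of \<open>T\<close>.
\<close>

definition refl :: "'a::field realized_group \<Rightarrow> (nat \<Rightarrow> int) \<Rightarrow> 'a mat set" where
  "refl D v = {g \<in> normalizer_of D. \<forall>t\<in>torus_of D.
     g * t * inv\<^bsub>GL (msize D)\<^esub> g = t * inv\<^bsub>GL (msize D)\<^esub> (coroot D v (chi D v t))}"

definition simple_refl :: "'a::field realized_group \<Rightarrow> nat \<Rightarrow> 'a mat set" where
  "simple_refl D i = refl D (simple_root (rnk D) i)"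

definition sigma :: "'a::field realized_group \<Rightarrow> (nat \<Rightarrow> int) \<Rightarrow> 'a mat" where
  "sigma D v = rootmap D v 1 * rootmap D (\<lambda>k. - v k) (- 1) * rootmap D v 1"

definition sigma_simple :: "'a::field realized_group \<Rightarrow> nat \<Rightarrow> 'a mat" where
  "sigma_simple D i = sigma D (simple_root (rnk D) i)"

definition realization :: "'a::field realized_group \<Rightarrow> bool" where
  "realization D \<longleftrightarrow> (\<forall>v\<in>B_roots (rnk D).
     root_hom (msize D) (group_of D) (torus_of D) (chi D v) (rootmap D v) \<and>
     root_subgroup (msize D) (group_of D) (torus_of D) (chi D v) (range (rootmap D v)) \<and>
     sigma D v \<in> normalizer_of D \<and> proj D (sigma D v) = refl D v \<and>
     (\<forall>x. x \<noteq> 0 \<longrightarrow>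
        rootmap D v x * rootmap D (\<lambda>k. - v k) (- inverse x) * rootmap D v x
          = coroot D v x * sigma D v))"


section \<open>Sections of \<open>N \<rightarrow> W\<close>\<close>

definition weyl_word :: "'a::field realized_group \<Rightarrow> nat list \<Rightarrow> 'a mat set" where
  "weyl_word D ws = foldr (\<lambda>i w. simple_refl D i \<otimes>\<^bsub>weyl D\<^esub> w) ws \<one>\<^bsub>weyl D\<^esub>"

definition reduced_word :: "'a::field realized_group \<Rightarrow> nat list \<Rightarrow> bool" where
  "reduced_word D ws \<longleftrightarrow> set ws \<subseteq> {1..rnk D} \<and>
     (\<forall>js. set js \<subseteq> {1..rnk D} \<longrightarrow> weyl_word D js = weyl_word D ws \<longrightarrow> length ws \<le> length js)"

text \<open>
  The braid relations between the \<open>S s\<^sub>i\<close> express that \<open>S\<close> is multiplicative along reduced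
  expressions; in this form the condition also determines \<open>S\<close> on the rest of \<open>W\<close>.
  Sections are extensional, so that they are equal as soon as they agree on \<open>W\<close>.
\<close>

definition is_section :: "'a::field realized_group \<Rightarrow> ('a mat set \<Rightarrow> 'a mat) \<Rightarrow> bool" where
  "is_section D S \<longleftrightarrow> S \<in> carrier (weyl D) \<rightarrow>\<^sub>E normalizer_of D \<and>
     (\<forall>w\<in>carrier (weyl D). proj D (S w) = w) \<and>
     (\<forall>ws. reduced_word D ws \<longrightarrow>
        S (weyl_word D ws) = foldr (\<lambda>i A. S (simple_refl D i) * A) ws (1\<^sub>m (msize D)))"

definition tits_section :: "'a::field realized_group \<Rightarrow> ('a mat set \<Rightarrow> 'a mat) \<Rightarrow> bool" where
  "tits_section D S \<longleftrightarrow>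
     is_section D S \<and> (\<forall>i\<in>{1..rnk D}. S (simple_refl D i) = sigma_simple D i)"

definition homomorphic :: "'a::field realized_group \<Rightarrow> ('a mat set \<Rightarrow> 'a mat) \<Rightarrow> bool" where
  "homomorphic D S \<longleftrightarrow> is_section D S \<and> S \<in> hom (weyl D) (normalizer_grp D)"

text \<open>\<open>a i j\<close> is the \<open>j\<close>-th coordinate of \<open>t\<^sub>i\<close>, where \<open>S s\<^sub>i = t\<^sub>i \<sigma>\<^sub>i\<close>.\<close>

definition section_coords ::
  "'a::field realized_group \<Rightarrow> ('a mat set \<Rightarrow> 'a mat) \<Rightarrow> (nat \<Rightarrow> nat \<Rightarrow> 'a) \<Rightarrow> bool" where
  "section_coords D S a \<longleftrightarrow> (\<forall>i\<in>{1..rnk D}.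
     (\<forall>j\<in>{1..rnk D}. a i j \<noteq> 0) \<and> S (simple_refl D i) = torus_pt D (a i) * sigma_simple D i)"

definition T_conjugate ::
  "'a::field realized_group \<Rightarrow> ('a mat set \<Rightarrow> 'a mat) \<Rightarrow> ('a mat set \<Rightarrow> 'a mat) \<Rightarrow> bool" where
  "T_conjugate D S S' \<longleftrightarrow>
     (\<exists>t\<in>torus_of D. \<forall>w\<in>carrier (weyl D). t * S w * inv\<^bsub>GL (msize D)\<^esub> t = S' w)"

text \<open>\<^const>\<open>group.ord\<close> is 0 on elements of infinite order.\<close>

definition elt_order :: "'a::field realized_group \<Rightarrow> 'a mat \<Rightarrow> enat" where
  "elt_order D g =
     (let d = group.ord (GL (msize D)) g in if d = 0 then \<infinity> else enat d)"

text \<open>A labelling of the nodes \<open>1, \<dots>, n\<close> of the Dynkin diagram.\<close>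

definition order_profile ::
  "'a::field realized_group \<Rightarrow> ('a mat set \<Rightarrow> 'a mat) \<Rightarrow> nat \<Rightarrow> enat" where
  "order_profile D S = (\<lambda>i\<in>{1..rnk D}. elt_order D (S (simple_refl D i)))"

definition order_profiles :: "'a::field realized_group \<Rightarrow> (nat \<Rightarrow> enat) set" where
  "order_profiles D = {order_profile D S | S. is_section D S}"

text \<open>
  Smaller profiles have larger labels.  The comparison of labels is weak: elements over the
  short simple root always have order 2, so under a strict comparison at every node no two
  profiles would be comparable and there would be no unique maximal profile.
\<close>

definition profile_less :: "'a::field realized_group \<Rightarrow> (nat \<Rightarrow> enat) \<Rightarrow> (nat \<Rightarrow> enat) \<Rightarrow> bool" where
  "profile_less D p q \<longleftrightarrow> p \<noteq> q \<and> (\<forall>i\<in>{1..rnk D}. q i \<le> p i)"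

definition maximal_profile :: "'a::field realized_group \<Rightarrow> (nat \<Rightarrow> enat) \<Rightarrow> bool" where
  "maximal_profile D p \<longleftrightarrow>
     p \<in> order_profiles D \<and> \<not> (\<exists>q\<in>order_profiles D. profile_less D p q)"

definition optimal :: "'a::field realized_group \<Rightarrow> ('a mat set \<Rightarrow> 'a mat) \<Rightarrow> bool" where
  "optimal D S \<longleftrightarrow> is_section D S \<and> (\<forall>p. maximal_profile D p \<longleftrightarrow> p = order_profile D S)"

definition optimal_coords :: "nat \<Rightarrow> (nat \<Rightarrow> nat \<Rightarrow> 'a::field) \<Rightarrow> bool" where
  "optimal_coords n a \<longleftrightarrow>
     (\<forall>i\<in>{1..n-2}. a i i * a i (i+1) ^ 2 = - 1) \<and>
     a (n-1) (n-1) * a (n-1) (n-2) ^ 2 = - 1 \<and>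
     a (n-1) n ^ 4 * a (n-1) (n-1) ^ 2 = 1 \<and>
     a n (n-1) ^ 2 * a n n ^ 2 = 1 \<and>
     (\<forall>i\<in>{1..n-2}. a i n ^ 2 = 1)"

end

theory Submission
  imports Defs "HOL-Algebra.Zassenhaus"
begin

text \<open>
  The characters \<open>e\<^sub>i\<close> identify the torus with \<open>(F\<^sup>\<times>)\<^sup>n\<close>; there \<open>s\<^sub>i\<close> swaps two neighbouring
  coordinates for \<open>i < n\<close>, and \<open>s\<^sub>n\<close> inverts the last one. Since \<open>T\<close> is its own centralizer,
  \<open>N/T\<close> is the group of signed permutations, and Matsumoto's theorem reduces sections to families
  \<open>t\<^sub>i \<sigma>\<^sub>i\<close> that satisfy the braid relations. The \<open>\<sigma>\<^sub>i\<close> themselves do: the two sides of a relation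
  differ by an element of \<open>\<alpha>\<^sub>i\<^sup>\<or>(F\<^sup>\<times>) \<inter> \<alpha>\<^sub>j\<^sup>\<or>(F\<^sup>\<times>)\<close>, which is trivial.

  In the coordinates \<open>Y\<^sub>i\<^sub>k = e\<^sub>k(t\<^sub>i)\<close> the braid relations say that, for signs \<open>\<epsilon>\<close>, \<open>\<mu>\<close>, \<open>p\<close>, one has
  \<open>Y\<^sub>i\<^sub>k = \<epsilon>\<close> for \<open>i < n\<close> and \<open>k \<notin> {i, i + 1}\<close>, the product of the two remaining coordinates of \<open>t\<^sub>i\<close>
  is \<open>\<mu>\<close>, and \<open>Y\<^sub>n\<^sub>k = p\<close> for \<open>k < n\<close>. For \<open>i < n\<close> the square of \<open>t\<^sub>i \<sigma>\<^sub>i\<close> has the coordinates \<open>-\<mu>\<close> at \<open>i\<close>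
  and \<open>i + 1\<close> and \<open>1\<close> elsewhere, and for \<open>i = n\<close> it is trivial, so \<open>\<mu>\<close> determines the order profile.
  Conjugation by \<open>T\<close> preserves the three signs and moves the other coordinates transitively.
  In the coordinates of the statement, \<open>\<epsilon> = a\<^sub>1\<^sub>,\<^sub>n\<close>, \<open>\<mu> = a\<^sub>1\<^sub>,\<^sub>1 a\<^sub>1\<^sub>,\<^sub>2\<^sup>2\<close> and
  \<open>p = a\<^sub>n\<^sub>,\<^sub>n\<^sub>-\<^sub>1 a\<^sub>n\<^sub>,\<^sub>n\<close>.
\<close>

section \<open>Signed permutations\<close>

text \<open>\<open>reflect f\<close> encodes the signed permutations once: with inversion for
  \<open>f\<close> it acts on torus coordinates, with negation on characters, so facts about words
  are shared. W is handled through the orbit of \<open>rho n\<close>, where stabilizers are trivial: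
  equality in W, length and reducedness become statements about integer vectors. The obstacle lies
  between root subgroups and the elements \<sigma>. Conjugation by N scales a root map by some c and
  the opposite one by some c', and c' = 1/c is needed before the conjugate of one \<sigma> is a
  coroot value times another. This is usually read off from the open cell; here it comes from
  conjugating an equation between opposite root subgroups by T, which uses that 2 is not 0. The same
  assumption keeps the signs 1 and -1, and hence the two order profiles, apart. The coroot of the
  short simple root has twice the unit vector as exponents. Its evenness makes the square of
  \<sigma> trivial at node n, and it is the reason why conjugacy under T calls for a square
  root.\<close>

definition reflect :: "('b \<Rightarrow> 'b) \<Rightarrow> nat \<Rightarrow> nat \<Rightarrow> (nat \<Rightarrow> 'b) \<Rightarrow> nat \<Rightarrow> 'b" where
  "reflect f n i y =
     (\<lambda>k. if i < n then y (transpose i (Suc i) k) else if k = n then f (y n) else y k)"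

text \<open>The Coxeter relations of type B, each kept in one orientation, with the smaller letter
  leading on the left. The other orientation is treated by symmetry where two first letters are
  compared.\<close>

inductive braid :: "nat \<Rightarrow> nat list \<Rightarrow> nat list \<Rightarrow> bool" for n where
  far: "1 \<le> i \<Longrightarrow> Suc i < j \<Longrightarrow> j \<le> n \<Longrightarrow> braid n [i, j] [j, i]"
| long: "1 \<le> i \<Longrightarrow> Suc i < n \<Longrightarrow> braid n [i, Suc i, i] [Suc i, i, Suc i]"
| short: "1 \<le> i \<Longrightarrow> Suc i = n \<Longrightarrow> braid n [i, n, i, n] [n, i, n, i]"

abbreviation reflects :: "('b \<Rightarrow> 'b) \<Rightarrow> nat \<Rightarrow> nat list \<Rightarrow> (nat \<Rightarrow> 'b) \<Rightarrow> nat \<Rightarrow> 'b" where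
  "reflects f n ws y \<equiv> foldr (reflect f n) ws y"

lemma reflect_apply:
  "reflect f n i y k =
     (if i < n then y (transpose i (Suc i) k) else if k = n then f (y n) else y k)"
  by (simp add: reflect_def)

lemma reflect_reflect:
  assumes "\<And>x. f (f x) = x"
  shows "reflect f n i (reflect f n i y) = y"
  by (auto simp: reflect_def assms)

lemma reflects_rev:
  assumes "\<And>x. f (f x) = x"
  shows "reflects f n ws (reflects f n (rev ws) y) = y"
  by (induction ws arbitrary: y) (simp_all add: reflect_reflect[OF assms])

lemma braid_reflects:
  assumes "\<And>x. f (f x) = x" "braid n c c'"
  shows "reflects f n c y = reflects f n c' y"
  using assms(2) by cases (auto simp: reflect_def transpose_def assms(1) fun_eq_iff)

lemma braid_length: "braid n c c' \<Longrightarrow> length c' = length c"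
  by (auto elim: braid.cases)

lemma braid_set: "braid n c c' \<Longrightarrow> set c \<subseteq> {1..n}" "braid n c c' \<Longrightarrow> set c' \<subseteq> {1..n}"
  by (auto elim!: braid.cases)

lemma braid_exists:
  assumes "i \<in> {1..n}" "j \<in> {1..n}" "i < j"
  shows "\<exists>u v. braid n (i # u) (j # v)"
proof -
  consider "Suc i < j" | "j = Suc i" "j < n" | "j = Suc i" "j = n" using assms by force
  thus ?thesis by cases (use assms in \<open>auto intro: braid.intros simp del: One_nat_def; metis braid.intros One_nat_def Suc_leI\<close>)+
qed


subsection \<open>Roots and the length function\<close>

abbreviation move :: "nat \<Rightarrow> nat \<Rightarrow> (nat \<Rightarrow> int) \<Rightarrow> nat \<Rightarrow> int" where
  "move \<equiv> reflect uminus"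

lemma move_move [simp]: "move n i (move n i v) = v"
  by (simp add: reflect_reflect)

lemma transpose_permutes_Suc:
  "1 \<le> i \<Longrightarrow> i < n \<Longrightarrow> transpose i (Suc i) permutes {1..n}"
  by (rule permutes_swap_id) auto

lemma dotp_move_move:
  assumes "i \<in> {1..n}"
  shows "dotp n (move n i v) (move n i w) = dotp n v w"
proof (cases "i < n")
  case True
  have "dotp n v w = (\<Sum>k=1..n. v (transpose i (Suc i) k) * w (transpose i (Suc i) k))"
    unfolding dotp_def
    using sum.permute[OF transpose_permutes_Suc, of i n "\<lambda>k. v k * w k"] assms True
    by (simp add: o_def)
  thus ?thesis using True by (simp add: dotp_def reflect_def)
qed (auto simp: dotp_def reflect_def intro!: sum.cong)

lemma dotp_move: "i \<in> {1..n} \<Longrightarrow> dotp n (move n i v) w = dotp n v (move n i w)"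
  using dotp_move_move[of i n v "move n i w"] by simp

lemma move_lattice: "i \<in> {1..n} \<Longrightarrow> v \<in> lattice_vecs n \<Longrightarrow> move n i v \<in> lattice_vecs n"
  by (auto simp: lattice_vecs_def reflect_def transpose_def)

lemma move_roots: "i \<in> {1..n} \<Longrightarrow> v \<in> B_roots n \<Longrightarrow> move n i v \<in> B_roots n"
  by (simp add: B_roots_def move_lattice dotp_move_move)

lemma dotp_simple_root:
  assumes "i \<in> {1..n}"
  shows "dotp n x (simple_root n i) = (if i < n then x i - x (Suc i) else x n)"
proof -
  have "dotp n x (simple_root n i) =
      (\<Sum>k=1..n. (if k = i then x i else 0) - (if k = Suc i then if i < n then x (Suc i) else 0 else 0))"
    unfolding dotp_def by (intro sum.cong) (auto simp: simple_root_def)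
  thus ?thesis using assms by (auto simp: sum_subtractf)
qed

lemma dotp_commute: "dotp n v w = dotp n w v"
  by (simp add: dotp_def mult.commute)

lemma dotp_add: "dotp n (\<lambda>k. v k + w k) x = dotp n v x + dotp n w x"
  by (simp add: dotp_def algebra_simps sum.distrib)

lemma dotp_uminus [simp]: "dotp n (\<lambda>k. - v k) x = - dotp n v x" "dotp n x (\<lambda>k. - v k) = - dotp n x v"
  by (simp_all add: dotp_def sum_negf)

lemma simple_root_in_roots: "i \<in> {1..n} \<Longrightarrow> simple_root n i \<in> B_roots n"
  by (auto simp: B_roots_def dotp_simple_root) (auto simp: simple_root_def lattice_vecs_def)

lemma uminus_roots: "v \<in> B_roots n \<Longrightarrow> (\<lambda>k. - v k) \<in> B_roots n"
  by (auto simp: B_roots_def lattice_vecs_def)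

lemma move_simple_root: "i \<in> {1..n} \<Longrightarrow> move n i (simple_root n i) = (\<lambda>k. - simple_root n i k)"
  by (auto simp: reflect_def simple_root_def transpose_def fun_eq_iff)

lemma roots_abs_le_1:
  assumes "v \<in> B_roots n"
  shows "v k \<in> {-1, 0, 1}"
proof (cases "k \<in> {1..n}")
  case True
  have "v k * v k \<le> (\<Sum>k=1..n. v k * v k)"
    using member_le_sum[of k "{1..n}" "\<lambda>k. v k * v k"] True by simp
  also have "\<dots> \<le> 2" using assms by (auto simp: B_roots_def dotp_def)
  finally have le: "v k * v k \<le> 2" .
  have "\<bar>v k\<bar> < 2"
  proof (rule ccontr)
    assume "\<not> \<bar>v k\<bar> < 2"
    hence "2 * 2 \<le> \<bar>v k\<bar> * \<bar>v k\<bar>" by (intro mult_mono) auto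
    thus False using le by (simp add: abs_mult_self_eq)
  qed
  thus ?thesis by auto
next
  case False
  thus ?thesis using assms by (auto simp: B_roots_def lattice_vecs_def)
qed

lemma root_support:
  assumes "v \<in> B_roots n"
  shows "int (card {k\<in>{1..n}. v k \<noteq> 0}) = dotp n v v"
proof -
  have "dotp n v v = (\<Sum>k\<in>{1..n}. if v k \<noteq> 0 then 1 else 0)"
    unfolding dotp_def
  proof (intro sum.cong refl)
    fix k
    show "v k * v k = (if v k \<noteq> 0 then 1 else 0)" using roots_abs_le_1[OF assms, of k] by auto
  qed
  thus ?thesis by (simp add: sum.If_cases Int_def)
qed

lemma dotp_support:
  assumes "finite A" "A = {k\<in>{1..n}. v k \<noteq> 0}"
  shows "dotp n x v = (\<Sum>k\<in>A. x k * v k)"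
  unfolding dotp_def assms(2) by (rule sum.mono_neutral_right) auto

text \<open>Entries are 0 or a sign, so the squared length is the size of the support: one position
  for a short root, two for a long one.\<close>

lemma root_cases:
  assumes "v \<in> B_roots n"
  obtains (one) i where "i \<in> {1..n}" "v i \<in> {-1, 1}" "\<And>k. k \<noteq> i \<Longrightarrow> v k = 0"
      "\<And>x. dotp n x v = x i * v i" "dotp n v v = 1"
    | (two) i j where "i \<in> {1..n}" "j \<in> {1..n}" "i < j" "v i \<in> {-1, 1}" "v j \<in> {-1, 1}"
      "\<And>k. k \<noteq> i \<Longrightarrow> k \<noteq> j \<Longrightarrow> v k = 0"
      "\<And>x. dotp n x v = x i * v i + x j * v j" "dotp n v v = 2"
proof -
  define A where "A = {k\<in>{1..n}. v k \<noteq> 0}"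
  have A: "k \<in> A \<longleftrightarrow> v k \<noteq> 0" for k
    using assms by (auto simp: A_def B_roots_def lattice_vecs_def)
  have vals: "v k \<in> {-1, 1}" if "k \<in> A" for k
    using roots_abs_le_1[OF assms, of k] that by (auto simp: A)
  have fin: "finite A" and in_univ: "A \<subseteq> {1..n}" by (auto simp: A_def)
  have card: "int (card A) = dotp n v v" using root_support[OF assms] by (simp add: A_def)
  have dot: "dotp n x v = (\<Sum>k\<in>A. x k * v k)" for x by (rule dotp_support[OF fin A_def])
  have "dotp n v v = 1 \<or> dotp n v v = 2" using assms by (auto simp: B_roots_def)
  thus thesis
  proof
    assume d: "dotp n v v = 1"
    hence "card A = 1" using card by simp
    then obtain i where i: "A = {i}" by (auto simp: card_1_singleton_iff)
    have "v k = 0" if "k \<noteq> i" for k using A[of k] i that by simp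
    moreover have "dotp n x v = x i * v i" for x using dot[of x] i by simp
    ultimately show thesis
      using one[of i] vals[of i] d i in_univ by simp
  next
    assume d: "dotp n v v = 2"
    hence "card A = 2" using card by simp
    then obtain i' j' where ij': "A = {i', j'}" "i' \<noteq> j'" by (auto simp: card_2_iff)
    obtain i j where ij: "A = {i, j}" "i < j"
      using ij' by (metis insert_commute linorder_neqE_nat)
    have "v k = 0" if "k \<noteq> i" "k \<noteq> j" for k using A[of k] ij(1) that by simp
    moreover have "dotp n x v = x i * v i + x j * v j" for x using dot[of x] ij by simp
    ultimately show thesis
      using two[of i j] vals[of i] vals[of j] d ij in_univ by simp
  qed
qed

lemma finite_roots: "finite (B_roots n)"
proof (rule finite_subset)
  show "B_roots n \<subseteq> {v. \<forall>k. (k \<in> {1..n} \<longrightarrow> v k \<in> {-1, 0, 1}) \<and> (k \<notin> {1..n} \<longrightarrow> v k = 0)}"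
    using roots_abs_le_1 unfolding B_roots_def lattice_vecs_def by blast
  show "finite {v. \<forall>k. (k \<in> {1..n} \<longrightarrow> v k \<in> {-1, 0, 1 :: int}) \<and> (k \<notin> {1..n} \<longrightarrow> v k = 0)}"
    by (rule finite_set_of_finite_funs) auto
qed

text \<open>The orbit of \<open>\<rho> = (n, n - 1, \<dots>, 1)\<close> under signed permutations.\<close>

definition states :: "nat \<Rightarrow> (nat \<Rightarrow> int) set" where
  "states n = {x \<in> lattice_vecs n. (\<forall>k\<in>{1..n}. \<bar>x k\<bar> \<in> {1..int n}) \<and> inj_on (\<lambda>k. \<bar>x k\<bar>) {1..n}}"

definition rho :: "nat \<Rightarrow> nat \<Rightarrow> int" where
  "rho n = (\<lambda>k. if k \<in> {1..n} then int n + 1 - int k else 0)"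

lemma rho_state: "rho n \<in> states n"
proof -
  have "\<bar>rho n k\<bar> = int n + 1 - int k" if "k \<in> {1..n}" for k
    using that by (simp add: rho_def)
  moreover have "rho n \<in> lattice_vecs n" by (simp add: rho_def lattice_vecs_def)
  ultimately show ?thesis by (simp add: states_def inj_on_def)
qed

lemma rho_simple_root: "i \<in> {1..n} \<Longrightarrow> dotp n (rho n) (simple_root n i) = 1"
  by (auto simp: dotp_simple_root) (auto simp: rho_def)

lemma move_state:
  assumes "i \<in> {1..n}" "x \<in> states n"
  shows "move n i x \<in> states n"
proof -
  have x: "x \<in> lattice_vecs n" "\<And>k. k \<in> {1..n} \<Longrightarrow> \<bar>x k\<bar> \<in> {1..int n}" "inj_on (\<lambda>k. \<bar>x k\<bar>) {1..n}"
    using assms(2) unfolding states_def by blast+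
  define p where "p = (if i < n then transpose i (Suc i) else id)"
  have p: "p permutes {1..n}"
    using assms(1) transpose_permutes_Suc by (auto simp: p_def permutes_id)
  have abs: "\<bar>move n i x k\<bar> = \<bar>x (p k)\<bar>" for k
    using assms(1) by (auto simp: reflect_def p_def)
  have "inj_on ((\<lambda>k. \<bar>x k\<bar>) \<circ> p) {1..n}"
    using x(3) p by (intro comp_inj_on) (auto simp: permutes_inj_on permutes_image)
  moreover have "\<bar>x (p k)\<bar> \<in> {1..int n}" if "k \<in> {1..n}" for k
    using x(2) permutes_in_image[OF p] that by blast
  ultimately show ?thesis
    using move_lattice[OF assms(1) x(1)] unfolding states_def mem_Collect_eq abs o_def by blast
qed

lemma moves_state: "set ws \<subseteq> {1..n} \<Longrightarrow> x \<in> states n \<Longrightarrow> reflects uminus n ws x \<in> states n"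
  by (induction ws) (auto intro!: move_state)

text \<open>Distinct nonzero absolute values keep single entries and sums or differences of two
  entries away from 0. States thus lie off all reflecting hyperplanes, and every root has a sign at
  a state.\<close>

lemma state_root_nonzero:
  assumes "x \<in> states n" "v \<in> B_roots n"
  shows "dotp n x v \<noteq> 0"
proof -
  have x: "inj_on (\<lambda>k. \<bar>x k\<bar>) {1..n}" "\<forall>k\<in>{1..n}. \<bar>x k\<bar> \<in> {1..int n}"
    using assms(1) by (simp_all add: states_def)
  show ?thesis
    using assms(2)
  proof (cases rule: root_cases)
    case (one i)
    moreover have "x i \<noteq> 0" "v i \<noteq> 0" using bspec[OF x(2) one(1)] one(2) by auto
    ultimately show ?thesis by simp
  next
    case (two i j)
    hence ne: "\<bar>x i\<bar> \<noteq> \<bar>x j\<bar>" using inj_onD[OF x(1), of i j] by auto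
    have "v i = 1 \<or> v i = -1" "v j = 1 \<or> v j = -1" using two(4,5) by auto
    thus ?thesis using two(7)[of x] ne by (elim disjE) simp_all
  qed
qed

text \<open>If x is the image of rho under w, the product of x with v is that of rho with the
  preimage of v. So these are the positive roots that the inverse of w makes negative; positive
  means positive on rho.\<close>

definition inversions :: "nat \<Rightarrow> (nat \<Rightarrow> int) \<Rightarrow> (nat \<Rightarrow> int) set" where
  "inversions n x = {v \<in> B_roots n. dotp n (rho n) v > 0 \<and> dotp n x v < 0}"

definition len :: "nat \<Rightarrow> (nat \<Rightarrow> int) \<Rightarrow> nat" where
  "len n x = card (inversions n x)"

lemma len_rho [simp]: "len n (rho n) = 0"
proof -
  have "inversions n (rho n) = {}" by (auto simp: inversions_def)
  thus ?thesis by (simp add: len_def)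
qed

text \<open>The coefficient is the pairing of \<open>v\<close> with the simple coroot; the short
  root contributes the factor 2.\<close>

lemma move_as_reflection:
  assumes "i \<in> {1..n}"
  shows "dotp n y (move n i v) = dotp n y v -
    (if i < n then v i - v (Suc i) else 2 * v n) * dotp n y (simple_root n i)"
proof -
  have "move n i v = (\<lambda>k. v k + - ((if i < n then v i - v (Suc i) else 2 * v n) * simple_root n i k))"
    using assms by (auto simp: reflect_def simple_root_def transpose_def fun_eq_iff)
  thus ?thesis
    by (simp add: dotp_def algebra_simps sum.distrib sum_subtractf sum_distrib_left sum_negf)
qed

text \<open>For \<open>i < n\<close> a pairing of 2 forces the entries 1 and -1, which determine the
  root. For \<open>i = n\<close> it only forces the last entry to be 1, and the other roots with
  this entry are excluded by their height, the product with rho.\<close>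

lemma root_eq_simple:
  assumes "i \<in> {1..n}" "v \<in> B_roots n" "dotp n (rho n) v > 0"
    "(if i < n then v i - v (Suc i) else 2 * v n) \<ge> 2" "dotp n (rho n) (move n i v) < 0"
  shows "v = simple_root n i"
proof (cases "i < n")
  case True
  hence 1: "v i = 1" "v (Suc i) = -1"
    using assms(4) roots_abs_le_1[OF assms(2), of i] roots_abs_le_1[OF assms(2), of "Suc i"] by auto
  show ?thesis
    using assms(2)
  proof (cases rule: root_cases)
    case (one k)
    have "i = k" "Suc i = k" using one(3)[of i] one(3)[of "Suc i"] 1 by auto
    thus ?thesis by simp
  next
    case (two k l)
    have "i = k \<or> i = l" "Suc i = k \<or> Suc i = l" using two(6)[of i] two(6)[of "Suc i"] 1 by auto
    hence kl: "i = k" "Suc i = l" using two(3) by auto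
    show ?thesis
    proof
      fix m
      show "v m = simple_root n i m"
        using two(6)[of m] 1 True kl by (auto simp: simple_root_def)
    qed
  qed
next
  case False
  hence i: "i = n" and 1: "v n = 1"
    using assms(1,4) roots_abs_le_1[OF assms(2), of n] by auto
  \<comment> \<open>The height falls by exactly 2 and changes sign, so it was 1. A second unit
    vector, added or subtracted, would make it at least 3 or negative.\<close>
  have "dotp n (rho n) (move n i v) = dotp n (rho n) v - 2"
    using move_as_reflection[OF assms(1)] rho_simple_root[OF assms(1)] i 1 by simp
  hence h: "dotp n (rho n) v = 1" using assms(3,5) by simp
  show ?thesis
    using assms(2)
  proof (cases rule: root_cases)
    case (one k)
    have k: "k = n" using one(3)[of n] 1 by auto
    show ?thesis
    proof
      fix m
      show "v m = simple_root n i m" using one(3)[of m] 1 i k by (auto simp: simple_root_def)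
    qed
  next
    case (two k l)
    have "l = n" using two(1-3) two(6)[of n] 1 by force
    moreover have "rho n k \<ge> 2" "rho n n = 1" using two(1-3) by (auto simp: rho_def)
    ultimately show ?thesis using two(4) two(7)[of "rho n"] 1 h by auto
  qed
qed

text \<open>The reflection lowers the height by the coroot pairing, so a positive root can become
  negative only with a pairing of at least 2, and then it is the simple root itself.\<close>

lemma move_positive:
  assumes "i \<in> {1..n}" "v \<in> B_roots n" "dotp n (rho n) v > 0" "v \<noteq> simple_root n i"
  shows "dotp n (rho n) (move n i v) > 0"
proof (rule ccontr)
  assume "\<not> ?thesis"
  moreover have "dotp n (rho n) (move n i v) \<noteq> 0"
    using state_root_nonzero[OF rho_state move_roots[OF assms(1,2)]] .
  ultimately have neg: "dotp n (rho n) (move n i v) < 0" by simp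
  hence "(if i < n then v i - v (Suc i) else 2 * v n) \<ge> 2"
    using move_as_reflection[OF assms(1), of "rho n" v] rho_simple_root[OF assms(1)] assms(3) by simp
  thus False using root_eq_simple[OF assms(1-3) _ neg] assms(4) by blast
qed

text \<open>The reflection permutes the positive roots other than its own simple root. It therefore
  maps the inversions of \<open>x\<close> onto those of \<open>move n i x\<close> apart from that
  root, the single new inversion.\<close>

lemma len_move_up:
  assumes "i \<in> {1..n}" "x \<in> states n" "dotp n x (simple_root n i) > 0"
  shows "len n (move n i x) = Suc (len n x)"
proof -
  let ?a = "simple_root n i"
  have a: "?a \<in> inversions n (move n i x)"
    using assms by (simp add: inversions_def simple_root_in_roots rho_simple_root dotp_move move_simple_root)
  have "bij_betw (move n i) (inversions n x) (inversions n (move n i x) - {?a})"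
  proof (rule bij_betwI[where g = "move n i"])
    show "move n i \<in> inversions n x \<rightarrow> inversions n (move n i x) - {?a}"
    proof
      fix v assume v: "v \<in> inversions n x"
      hence "v \<noteq> ?a" using assms(3) by (auto simp: inversions_def)
      moreover have "move n i v \<noteq> ?a"
      proof
        assume "move n i v = ?a"
        hence "v = (\<lambda>k. - ?a k)"
          using move_simple_root[OF assms(1)] move_move[of n i v] by simp
        thus False using v rho_simple_root[OF assms(1)] by (simp add: inversions_def)
      qed
      ultimately show "move n i v \<in> inversions n (move n i x) - {?a}"
        using v assms(1) by (auto simp: inversions_def move_roots move_positive dotp_move_move)
    qed
    show "move n i \<in> inversions n (move n i x) - {?a} \<rightarrow> inversions n x"
      using assms(1) by (auto simp: inversions_def move_roots move_positive dotp_move)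
  qed auto
  hence "card (inversions n x) = card (inversions n (move n i x) - {?a})"
    by (rule bij_betw_same_card)
  moreover have "finite (inversions n (move n i x))"
    using finite_roots by (simp add: inversions_def)
  ultimately show ?thesis
    using card.remove[OF _ a] by (simp add: len_def)
qed

lemma len_move_down:
  assumes "i \<in> {1..n}" "x \<in> states n" "dotp n x (simple_root n i) < 0"
  shows "len n x = Suc (len n (move n i x))"
  using len_move_up[of i n "move n i x"] assms
  by (simp add: move_state dotp_move move_simple_root)

lemma len_move_cases:
  assumes "i \<in> {1..n}" "x \<in> states n"
  shows "len n (move n i x) = Suc (len n x) \<or> len n x = Suc (len n (move n i x))"
  using len_move_up[OF assms] len_move_down[OF assms]
    state_root_nonzero[OF assms(2) simple_root_in_roots[OF assms(1)]] by linarith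

text \<open>The entries decrease strictly, end positive and are at most \<open>n\<close>: counting
  up from the last and down from the first leaves no slack.\<close>

lemma dominant_state:
  assumes x: "x \<in> states n" and pos: "\<And>i. i \<in> {1..n} \<Longrightarrow> dotp n x (simple_root n i) > 0"
  shows "x = rho n"
proof -
  have step: "x (Suc i) < x i" if "1 \<le> i" "i < n" for i
    using pos[of i] that by (simp add: dotp_simple_root)
  have lower: "x k \<ge> int n + 1 - int k" if "k \<in> {1..n}" for k
    using that
  proof (induction "n - k" arbitrary: k)
    case 0
    thus ?case using pos[of n] by (simp add: dotp_simple_root)
  next
    case (Suc d)
    hence "x (Suc k) \<ge> int n + 1 - int (Suc k)" by (intro Suc.hyps(1)) auto
    moreover have "k < n" using Suc.hyps(2) by simp
    ultimately show ?case using step[of k] Suc.prems by simp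
  qed
  have bound: "x k \<le> int n" if "k \<in> {1..n}" for k
    using x that by (force simp: states_def)
  have upper: "x k \<le> int n + 1 - int k" if "k \<in> {1..n}" for k
    using that
  proof (induction k)
    case (Suc k)
    show ?case
      using Suc bound[of "Suc k"] step[of k] by (cases "k = 0") fastforce+
  qed simp
  show ?thesis
  proof
    fix k
    show "x k = rho n k"
      using lower[of k] upper[of k] x by (cases "k \<in> {1..n}") (auto simp: rho_def states_def lattice_vecs_def)
  qed
qed

text \<open>Sorting: as long as some simple root is negative at \<open>x\<close>, its reflection
  removes one inversion, and the only state without such a root is \<open>rho n\<close>.\<close>

lemma state_word:
  assumes "x \<in> states n"
  shows "\<exists>ws. set ws \<subseteq> {1..n} \<and> reflects uminus n ws (rho n) = x \<and> length ws = len n x"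
  using assms
proof (induction "len n x" arbitrary: x rule: less_induct)
  case less
  show ?case
  proof (cases "\<exists>i\<in>{1..n}. dotp n x (simple_root n i) < 0")
    case True
    then obtain i where i: "i \<in> {1..n}" "dotp n x (simple_root n i) < 0" by blast
    hence l: "len n x = Suc (len n (move n i x))" using len_move_down less.prems by blast
    then obtain ws where "set ws \<subseteq> {1..n}" "reflects uminus n ws (rho n) = move n i x"
        "length ws = len n (move n i x)"
      using less.hyps[of "move n i x"] move_state[OF i(1) less.prems] by auto
    thus ?thesis using i l by (intro exI[of _ "i # ws"]) simp
  next
    case False
    hence "x = rho n"
      using dominant_state[OF less.prems] state_root_nonzero[OF less.prems simple_root_in_roots]
      by (metis linorder_neqE_linordered_idom)
    thus ?thesis by (intro exI[of _ "[]"]) simp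
  qed
qed

lemma len_moves_le:
  assumes "set ws \<subseteq> {1..n}" "x \<in> states n"
  shows "len n (reflects uminus n ws x) \<le> length ws + len n x"
  using assms
proof (induction ws)
  case (Cons i ws)
  thus ?case using len_move_cases[of i n "reflects uminus n ws x"] moves_state[of ws n x] by auto
qed simp


text \<open>Each letter changes the length by one, so a word as short as its length permits climbs
  at every letter, in particular at the outermost one.\<close>

lemma reduced_Cons:
  assumes "set (i # ws) \<subseteq> {1..n}" "length (i # ws) = len n (reflects uminus n (i # ws) (rho n))"
  shows "length ws = len n (reflects uminus n ws (rho n))"
    and "dotp n (reflects uminus n (i # ws) (rho n)) (simple_root n i) < 0"
proof -
  let ?y = "reflects uminus n ws (rho n)"
  have y: "?y \<in> states n" and i: "i \<in> {1..n}" using assms(1) moves_state rho_state by auto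
  have "len n ?y \<le> length ws" using len_moves_le[of ws n "rho n"] rho_state assms(1) by simp
  thus 1: "length ws = len n ?y" using len_move_cases[OF i y] assms(2) by auto
  have "\<not> dotp n (move n i ?y) (simple_root n i) > 0"
    using len_move_up[OF i move_state[OF i y]] 1 assms(2) by auto
  thus "dotp n (reflects uminus n (i # ws) (rho n)) (simple_root n i) < 0"
    using state_root_nonzero[OF move_state[OF i y] simple_root_in_roots[OF i]] by auto
qed

text \<open>Either side of a relation is the longest element of the dihedral group of its letters.
  From a state that is positive on both simple roots, every letter adds an inversion.\<close>

lemma len_braid:
  assumes "braid n c c'" "x \<in> states n" "\<And>i. i \<in> set c \<Longrightarrow> dotp n x (simple_root n i) > 0"
  shows "len n (reflects uminus n c x) = length c + len n x"
  using assms(1)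
proof cases
  case (far i j)
  moreover from far have "x (Suc i) < x i" "j < n \<Longrightarrow> x (Suc j) < x j" "j = n \<Longrightarrow> 0 < x n"
    using assms(3)[of i] assms(3)[of j] by (simp_all add: dotp_simple_root)
  ultimately show ?thesis using assms(2)
    by (simp add: len_move_up move_state dotp_simple_root reflect_apply transpose_def)
next
  case (long i)
  moreover from long have "x (Suc i) < x i" "x (Suc (Suc i)) < x (Suc i)"
    using assms(3)[of i] assms(3)[of "Suc i"] by (simp_all add: dotp_simple_root)
  ultimately show ?thesis using assms(2)
    by (simp add: len_move_up move_state dotp_simple_root reflect_apply transpose_def)
next
  case (short i)
  moreover from short have "x (Suc i) < x i" "0 < x (Suc i)"
    using assms(3)[of i] assms(3)[of n] by (simp_all add: dotp_simple_root)
  ultimately show ?thesis using assms(2)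
    by (auto simp add: len_move_up move_state dotp_simple_root reflect_apply transpose_def)
qed

text \<open>Two descents put \<open>x\<close> at the top of its orbit under the dihedral group of
  \<open>i\<close> and \<open>j\<close>. The bottom of that orbit is \<open>y\<close>, reached by
  undoing either side of the relation.\<close>

lemma braid_descents:
  assumes "braid n (i # p) (j # q)" "x \<in> states n"
    and "dotp n x (simple_root n i) < 0" "dotp n x (simple_root n j) < 0"
  obtains y where "y \<in> states n" "reflects uminus n (i # p) y = x" "reflects uminus n (j # q) y = x"
    "len n x = length (i # p) + len n y"
proof -
  let ?c = "i # p"
  define y where "y = reflects uminus n (rev ?c) x"
  have y: "y \<in> states n" using moves_state[of "rev ?c" n x] assms(2) braid_set(1)[OF assms(1)] unfolding y_def by simp
  have x: "reflects uminus n ?c y = x" unfolding y_def by (rule reflects_rev) simp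
  have "dotp n y (simple_root n k) > 0" if "k \<in> set ?c" for k
    using assms(1,3,4) that unfolding y_def
    by cases (auto simp: dotp_simple_root reflect_def transpose_def)
  hence "len n x = length ?c + len n y" using len_braid[OF assms(1) y] x by simp
  thus thesis using that[OF y x] braid_reflects[OF _ assms(1), of uminus y] x by simp
qed

section \<open>Words in a monoid and Matsumoto's theorem\<close>

context monoid
begin

abbreviation word :: "('i \<Rightarrow> 'a) \<Rightarrow> 'i list \<Rightarrow> 'a" where
  "word f ws \<equiv> foldr (\<lambda>i A. f i \<otimes> A) ws \<one>"

lemma word_closed [intro]: "(\<And>i. i \<in> set ws \<Longrightarrow> f i \<in> carrier G) \<Longrightarrow> word f ws \<in> carrier G"
  by (induction ws) auto

lemma word_append:
  assumes "\<And>i. i \<in> set us \<union> set ws \<Longrightarrow> f i \<in> carrier G"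
  shows "word f (us @ ws) = word f us \<otimes> word f ws"
  using assms by (induction us) (auto simp: m_assoc word_closed)

text \<open>Matsumoto's theorem: if a reduced word can start both with \<open>i\<close> and with \<open>j\<close>, then it can
  start with either side of the braid relation between \<open>i\<close> and \<open>j\<close>.\<close>

theorem matsumoto:
  assumes f: "\<And>i. i \<in> {1..n} \<Longrightarrow> f i \<in> carrier G"
    and braid: "\<And>c c'. braid n c c' \<Longrightarrow> word f c = word f c'"
    and "set u \<subseteq> {1..n}" "set v \<subseteq> {1..n}"
    and "reflects uminus n u (rho n) = reflects uminus n v (rho n)"
    and "length u = len n (reflects uminus n u (rho n))"
    and "length v = len n (reflects uminus n v (rho n))"
  shows "word f u = word f v"
  using assms(3-)
proof (induction "length u" arbitrary: u v rule: less_induct)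
  case less
  let ?s = "\<lambda>ws. reflects uminus n ws (rho n)"
  show ?case
  proof (cases u)
    case Nil
    thus ?thesis using less.prems by simp
  next
    case (Cons i u')
    then obtain j v' where v: "v = j # v'" using less.prems by (cases v) auto
    note u = Cons
    have ij: "i \<in> {1..n}" "j \<in> {1..n}" "set u' \<subseteq> {1..n}" "set v' \<subseteq> {1..n}"
      using less.prems u v by auto
    define x where "x = ?s u"
    have x: "x \<in> states n" using moves_state[OF less.prems(1) rho_state] by (simp add: x_def)
    have i: "length u' = len n (?s u')" "dotp n x (simple_root n i) < 0"
      using reduced_Cons[of i u' n] less.prems(1,4) unfolding x_def u by simp_all
    have xv: "x = ?s v" using less.prems(3) by (simp add: x_def)
    have j: "length v' = len n (?s v')" "dotp n x (simple_root n j) < 0"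
      using reduced_Cons[of j v' n] less.prems(2,5) unfolding xv v by simp_all
    have su': "?s u' = move n i x" by (simp add: x_def u)
    have sv': "?s v' = move n j x" by (simp add: xv v)
    have lx: "len n x = Suc (length u')" "len n x = Suc (length v')"
      using less.prems(4,5) unfolding x_def[symmetric] xv[symmetric] by (simp_all add: u v)
    have IH: "word f w = word f w'" if "set w \<subseteq> {1..n}" "set w' \<subseteq> {1..n}" "?s w = ?s w'"
      "length w = len n (?s w)" "length w' = len n (?s w')" "length w = length u'" for w w'
      using less.hyps[OF _ that(1-5)] that(6) u by simp
    show ?thesis
    proof (cases "i = j")
      case True
      have "?s u' = ?s v'" unfolding su' sv' True ..
      hence "word f u' = word f v'" using IH[OF ij(3,4)] i(1) j(1) by simp
      thus ?thesis using u v True by simp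
    next
      case False
      then obtain p q where pq: "braid n (i # p) (j # q) \<or> braid n (j # q) (i # p)"
        using braid_exists ij(1,2) by (meson linorder_neqE_nat)
      hence "\<exists>y\<in>states n. reflects uminus n (i # p) y = x \<and> reflects uminus n (j # q) y = x \<and>
          len n x = length (i # p) + len n y"
      proof
        assume b: "braid n (i # p) (j # q)"
        show ?thesis using braid_descents[OF b x i(2) j(2)] by blast
      next
        assume b: "braid n (j # q) (i # p)"
        show ?thesis using braid_descents[OF b x j(2) i(2)] braid_length[OF b] by metis
      qed
      then obtain y where y: "y \<in> states n" "reflects uminus n (i # p) y = x"
          "reflects uminus n (j # q) y = x" "len n x = length (i # p) + len n y"
        by blast
      have len: "length q = length p" using pq braid_length by fastforce
      have set: "set (i # p) \<subseteq> {1..n}" "set (j # q) \<subseteq> {1..n}" using pq braid_set by blast+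
      \<comment> \<open>A reduced word of \<open>y\<close> completes both sides of the relation to
        reduced words of \<open>x\<close> that begin with \<open>i\<close> and \<open>j\<close>.
        Without these letters the induction hypothesis compares them with \<open>u'\<close> and
        \<open>v'\<close>.\<close>
      obtain z where z: "set z \<subseteq> {1..n}" "?s z = y" "length z = len n y"
        using state_word[OF y(1)] by blast
      have "reflects uminus n p y = ?s u'" unfolding su' using y(2) by auto
      hence pz: "?s (p @ z) = ?s u'" using z(2) by simp
      have "reflects uminus n q y = ?s v'" unfolding sv' using y(3) by auto
      hence qz: "?s (q @ z) = ?s v'" using z(2) by simp
      have "word f u' = word f (p @ z)"
        by (rule IH) (use set z(1,3) ij i(1) y(4) lx pz in auto)
      moreover have "word f v' = word f (q @ z)"
        by (rule IH) (use set z(1,3) ij j(1) y(4) lx qz len in auto)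
      ultimately have "word f u = word f ((i # p) @ z)" "word f v = word f ((j # q) @ z)"
        using u v by simp_all
      moreover have "word f (w @ z) = word f w \<otimes> word f z" if "set w \<subseteq> {1..n}" for w
        using that z(1) f by (intro word_append) auto
      moreover have "word f (i # p) = word f (j # q)" using pq braid by metis
      ultimately show ?thesis using set by metis
    qed
  qed
qed

end


section \<open>Regular functions and conjugation\<close>

lemma group_GL: "group (GL m :: 'a::field mat monoid)"
proof -
  interpret semiring "ring_mat TYPE('a) m ()" by (rule semiring_mat)
  show ?thesis by (rule units_group)
qed

lemma GL_mult [simp]: "monoid.mult (GL m) = (*)"
  by (simp add: units_of_mult ring_mat_simps)

lemma GL_one [simp]: "one (GL m) = 1\<^sub>m m"
  by (simp add: units_of_one ring_mat_simps)

lemma GL_carrier_mat: "A \<in> carrier (GL m) \<Longrightarrow> A \<in> carrier_mat m m"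
  by (simp add: units_of_carrier Units_def ring_mat_simps)

lemma GL_det_nonzero: "A \<in> carrier (GL m) \<Longrightarrow> det (A :: 'a::field mat) \<noteq> 0"
  using unit_imp_det_non_zero by (simp add: units_of_carrier)

lemma regular_sum:
  assumes "finite I" "\<And>i. i \<in> I \<Longrightarrow> f i \<in> regular m"
  shows "(\<lambda>A. \<Sum>i\<in>I. f i A) \<in> regular m"
  using assms by (induction I) (auto intro: regular.intros)

lemma conj_entry:
  assumes "P \<in> carrier_mat m m" "A \<in> carrier_mat m m" "Q \<in> carrier_mat m m" "i < m" "j < m"
  shows "(P * A * Q) $$ (i, j) = (\<Sum>k<m. \<Sum>l<m. P $$ (i, k) * A $$ (k, l) * Q $$ (l, j))"
  using assms by (simp add: scalar_prod_def sum_distrib_left lessThan_atLeast0 mult.assoc)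

text \<open>Entries of the conjugate are linear in those of \<open>A\<close>, and
  \<open>det P * det Q = 1\<close> leaves the determinant unchanged. This makes conjugates of
  characters and of root homomorphisms regular again.\<close>

lemma regular_conj:
  assumes PQ: "P \<in> carrier_mat m m" "Q \<in> carrier_mat m m" "P * Q = 1\<^sub>m m" and "f \<in> regular m"
  shows "\<exists>f'\<in>regular m. \<forall>A\<in>carrier_mat m m. f' A = f (P * A * Q)"
  using assms(4)
proof induction
  case (const c)
  show ?case by (intro bexI[of _ "\<lambda>A. c"] regular.const) simp
next
  case (entry i j)
  let ?f = "\<lambda>A. \<Sum>k<m. \<Sum>l<m. P $$ (i, k) * A $$ (k, l) * Q $$ (l, j)"
  have "?f \<in> regular m" by (intro regular_sum regular.intros) auto
  thus ?case using conj_entry[OF PQ(1) _ PQ(2) entry] by (intro bexI[of _ ?f]) auto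
next
  case inv_det
  have "det P * det Q = 1" using PQ det_mult[OF PQ(1,2)] by simp
  hence "det (P * A * Q) = det A" if "A \<in> carrier_mat m m" for A
    using that PQ by (simp add: det_mult[of _ m])
  thus ?case by (intro bexI[OF _ regular.inv_det]) simp
next
  case (add f g)
  then obtain f' g' where "f' \<in> regular m" "g' \<in> regular m"
    "\<forall>A\<in>carrier_mat m m. f' A = f (P * A * Q)" "\<forall>A\<in>carrier_mat m m. g' A = g (P * A * Q)"
    by blast
  thus ?case by (intro bexI[of _ "\<lambda>A. f' A + g' A"] regular.add) auto
next
  case (mult f g)
  then obtain f' g' where "f' \<in> regular m" "g' \<in> regular m"
    "\<forall>A\<in>carrier_mat m m. f' A = f (P * A * Q)" "\<forall>A\<in>carrier_mat m m. g' A = g (P * A * Q)"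
    by blast
  thus ?case by (intro bexI[of _ "\<lambda>A. f' A * g' A"] regular.mult) auto
qed

lemma polynomial_conj:
  fixes u :: "'a::field \<Rightarrow> 'a mat"
  assumes "P \<in> carrier_mat m m" "Q \<in> carrier_mat m m" "\<And>x. u x \<in> carrier_mat m m"
    and "\<forall>i<m. \<forall>j<m. \<exists>p. \<forall>x. u x $$ (i, j) = poly p x" and "i < m" "j < m"
  shows "\<exists>p. \<forall>x. (P * u x * Q) $$ (i, j) = poly p x"
proof -
  obtain p where p: "\<And>k l x. k < m \<Longrightarrow> l < m \<Longrightarrow> u x $$ (k, l) = poly (p k l) x"
    using assms(4) by metis
  have "(P * u x * Q) $$ (i, j) =
      poly (\<Sum>k<m. \<Sum>l<m. [:P $$ (i, k):] * p k l * [:Q $$ (l, j):]) x" for x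
    using assms conj_entry[OF assms(1) assms(3) assms(2) assms(5,6), of x]
    by (simp add: poly_sum p algebra_simps)
  thus ?thesis by blast
qed


section \<open>The torus and its normalizer\<close>

locale realized_B =
  fixes D :: "'a::alg_closed_field realized_group" and n :: nat
  assumes two_nonzero: "(2::'a) \<noteq> 0"
    and rank: "rnk D = n" "n \<ge> 6"
    and adjoint: "adjoint_type_B D"
    and self_centralizing: "centralizer (group_of D) (torus_of D) = torus_of D"
    and coweights: "fundamental_coweights D"
    and realization: "realization D"
begin

abbreviation "m \<equiv> msize D"
abbreviation "T \<equiv> torus_of D"
abbreviation "N \<equiv> normalizer_of D"
abbreviation inverse_GL :: "'a mat \<Rightarrow> 'a mat" (\<open>iv\<close>) where "iv g \<equiv> inv\<^bsub>GL m\<^esub> g"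
abbreviation "E \<equiv> eps D"
abbreviation "sr \<equiv> simple_root n"
abbreviation "\<sigma> \<equiv> sigma_simple D"

sublocale GL: group "GL m :: 'a mat monoid"
  rewrites "monoid.mult (GL m) = (*)" and "one (GL m) = 1\<^sub>m m"
  by (rule group_GL) simp_all

lemmas adj = adjoint[unfolded adjoint_type_B_def Let_def rank(1)]

lemma subgroup_G: "subgroup (group_of D) (GL m)"
  using adj by (simp add: connected_reductive_def alg_group_def)

lemma torus_T: "torus m T" and T_subset_G: "T \<subseteq> group_of D"
  using adj by (simp_all add: maximal_torus_def)

lemma subgroup_T: "subgroup T (GL m)"
  using torus_T by (simp add: torus_def alg_group_def)

interpretation G: group "subgrp m (group_of D)"
  by (rule GL.subgroup_imp_group[OF subgroup_G])

lemma subgroup_T_G: "subgroup T (subgrp m (group_of D))"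
  by (rule GL.subgroup_incl[OF subgroup_T subgroup_G T_subset_G])

lemma subgroup_N: "subgroup N (GL m)" and N_subset_G: "N \<subseteq> group_of D"
proof -
  have *: "subgroup N (subgrp m (group_of D))"
    unfolding normalizer_of_def using G.normalizer_imp_subgroup T_subset_G by simp
  show "subgroup N (GL m)" by (rule GL.incl_subgroup[OF subgroup_G *])
  show "N \<subseteq> group_of D" using subgroup.subset[OF *] by simp
qed

sublocale TN: normal T "normalizer_grp D"
  using G.subgroup_in_normalizer[OF subgroup_T_G]
  by (simp add: normalizer_grp_def normalizer_of_def)

lemma N_GL [simp]: "g \<in> N \<Longrightarrow> g \<in> carrier (GL m)"
  using subgroup.subset[OF subgroup_N] by blast

lemma carrier_normalizer_grp [simp]: "carrier (normalizer_grp D) = N"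
  and mult_normalizer_grp [simp]: "monoid.mult (normalizer_grp D) = (*)"
  and one_normalizer_grp [simp]: "one (normalizer_grp D) = 1\<^sub>m m"
  by (simp_all add: normalizer_grp_def)

lemma inv_normalizer_grp [simp]: "g \<in> N \<Longrightarrow> inv\<^bsub>normalizer_grp D\<^esub> g = iv g"
  unfolding normalizer_grp_def by (rule GL.m_inv_consistent[OF subgroup_N])

lemma T_N [simp]: "t \<in> T \<Longrightarrow> t \<in> N"
  using TN.subset by auto

lemma N_mult [simp]: "g \<in> N \<Longrightarrow> h \<in> N \<Longrightarrow> g * h \<in> N"
  and N_inv [simp]: "g \<in> N \<Longrightarrow> iv g \<in> N"
  and N_one [simp]: "1\<^sub>m m \<in> N"
  using subgroup.m_closed[OF subgroup_N] subgroup.m_inv_closed[OF subgroup_N]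
    subgroup.one_closed[OF subgroup_N] by simp_all

lemma T_mult [simp]: "g \<in> T \<Longrightarrow> h \<in> T \<Longrightarrow> g * h \<in> T"
  and T_inv [simp]: "g \<in> T \<Longrightarrow> iv g \<in> T"
  and T_one [simp]: "1\<^sub>m m \<in> T"
  using subgroup.m_closed[OF subgroup_T] subgroup.m_inv_closed[OF subgroup_T]
    subgroup.one_closed[OF subgroup_T] by simp_all

lemma conj_T [simp]: "g \<in> N \<Longrightarrow> t \<in> T \<Longrightarrow> g * t * iv g \<in> T"
  using TN.inv_op_closed2[of g t] by simp

lemma conj_T' [simp]: "g \<in> N \<Longrightarrow> t \<in> T \<Longrightarrow> iv g * t * g \<in> T"
  using TN.inv_op_closed1[of g t] by simp

lemma diag_group_comm:
  assumes "A \<in> diag_group r" "B \<in> diag_group r"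
  shows "A * B = B * (A :: 'a mat)"
proof (rule eq_matI)
  have AB: "A \<in> carrier_mat r r" "B \<in> carrier_mat r r" "diagonal_mat A" "diagonal_mat B"
    using assms by (simp_all add: diag_group_def GL_carrier_mat)
  fix i j assume "i < dim_row (B * A)" "j < dim_col (B * A)"
  hence ij: "i < r" "j < r" using AB by auto
  have "(X * Y) $$ (i, j) = (if i = j then X $$ (i, i) * Y $$ (i, i) else 0)"
    if "X \<in> carrier_mat r r" "Y \<in> carrier_mat r r" "diagonal_mat X" "diagonal_mat Y" for X Y :: "'a mat"
  proof -
    have "(X * Y) $$ (i, j) = (\<Sum>k<r. X $$ (i, k) * Y $$ (k, j))"
      using that(1,2) ij by (simp add: scalar_prod_def lessThan_atLeast0)
    also have "\<dots> = (\<Sum>k<r. if k = i then if i = j then X $$ (i, i) * Y $$ (i, i) else 0 else 0)"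
      using that ij by (intro sum.cong) (auto simp: diagonal_mat_def)
    finally show ?thesis using ij by simp
  qed
  thus "(A * B) $$ (i, j) = (B * A) $$ (i, j)" using AB by (simp add: mult.commute)
qed (use assms in \<open>auto simp: diag_group_def dest!: GL_carrier_mat\<close>)

lemma T_comm: "s \<in> T \<Longrightarrow> t \<in> T \<Longrightarrow> s * t = t * s"
proof -
  obtain r f g where "alg_morphism m r T (diag_group r) g"
      and f: "\<forall>A\<in>diag_group r. \<forall>B\<in>diag_group r. f (A * B) = f A * f B" "\<forall>t\<in>T. f (g t) = t"
    using torus_T unfolding torus_def by blast
  hence "g t \<in> diag_group r" if "t \<in> T" for t using that by (auto simp: alg_morphism_def)
  thus "s * t = t * s" if "s \<in> T" "t \<in> T"
    using f diag_group_comm that by metis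
qed

lemma E_character: "i \<in> {1..n} \<Longrightarrow> is_character m T (E i)"
  using adj by blast

lemma E_nonzero [simp]: "i \<in> {1..n} \<Longrightarrow> t \<in> T \<Longrightarrow> E i t \<noteq> 0"
  and E_mult: "i \<in> {1..n} \<Longrightarrow> s \<in> T \<Longrightarrow> t \<in> T \<Longrightarrow> E i (s * t) = E i s * E i t"
  using E_character by (auto simp: is_character_def)

lemma E_one [simp]: "i \<in> {1..n} \<Longrightarrow> E i (1\<^sub>m m) = 1"
  using E_mult[of i "1\<^sub>m m" "1\<^sub>m m"] E_nonzero[of i "1\<^sub>m m"] by auto

lemma E_inv: "i \<in> {1..n} \<Longrightarrow> t \<in> T \<Longrightarrow> E i (iv t) = inverse (E i t)"
  using E_mult[of i t "iv t"] by (simp add: inverse_unique)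

lemma chi_nonzero [simp]: "t \<in> T \<Longrightarrow> chi D v t \<noteq> 0"
  by (auto simp: chi_def rank)

lemma chi_mult: "s \<in> T \<Longrightarrow> t \<in> T \<Longrightarrow> chi D v (s * t) = chi D v s * chi D v t"
  by (simp add: chi_def rank E_mult power_int_mult_distrib prod.distrib)

lemma chi_add: "t \<in> T \<Longrightarrow> chi D (\<lambda>k. v k + w k) t = chi D v t * chi D w t"
  by (simp add: chi_def rank power_int_add prod.distrib[symmetric])

lemma chi_uminus: "t \<in> T \<Longrightarrow> chi D (\<lambda>k. - v k) t = inverse (chi D v t)"
  by (simp add: chi_def rank power_int_minus prod_inversef[symmetric])

lemma alpha_E:
  assumes "i \<in> {1..n}" "t \<in> T"
  shows "alpha D i t = (if i < n then E i t / E (Suc i) t else E n t)"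
proof -
  have "alpha D i t = (\<Prod>k=1..n. (if k = i then E i t else 1) *
      (if k = Suc i then if i < n then inverse (E (Suc i) t) else 1 else 1))"
    unfolding alpha_def chi_def rank
    by (intro prod.cong) (auto simp: simple_root_def power_int_minus)
  thus ?thesis using assms by (auto simp: prod.distrib divide_inverse)
qed

text \<open>The matrix entries of an isomorphism of \<open>T\<close> with a diagonal group are characters.\<close>

lemma T_eqI:
  assumes "s \<in> T" "t \<in> T" "\<And>k. k \<in> {1..n} \<Longrightarrow> E k s = E k t"
  shows "s = t"
proof -
  obtain r f g where g: "alg_morphism m r T (diag_group r) g"
      and f: "alg_morphism r m (diag_group r) T f"
        "\<forall>A\<in>diag_group r. \<forall>B\<in>diag_group r. f (A * B) = f A * f B" "\<forall>t\<in>T. f (g t) = t"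
      and gf: "\<forall>A\<in>diag_group r. g (f A) = A"
    using torus_T unfolding torus_def by blast
  have gT: "g t \<in> diag_group r" if "t \<in> T" for t using that g by (auto simp: alg_morphism_def)
  hence gC: "g t \<in> carrier_mat r r" "diagonal_mat (g t)" if "t \<in> T" for t
    using that by (auto simp: diag_group_def GL_carrier_mat)
  have diag_mult: "A * B \<in> diag_group r" if "A \<in> diag_group r" "B \<in> diag_group r" for A B :: "'a mat"
  proof -
    interpret r: group "GL r :: 'a mat monoid" by (rule group_GL)
    have AB: "A \<in> carrier (GL r)" "B \<in> carrier (GL r)" "diagonal_mat A" "diagonal_mat B"
      using that by (auto simp: diag_group_def)
    hence C: "A \<in> carrier_mat r r" "B \<in> carrier_mat r r" by (auto intro: GL_carrier_mat)
    have "A * B \<in> carrier (GL r)" using r.m_closed[OF AB(1,2)] by simp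
    moreover have "diagonal_mat (A * B)"
      unfolding diagonal_mat_def using C AB(3,4)
      by (auto simp: scalar_prod_def diagonal_mat_def intro!: sum.neutral) metis
    ultimately show ?thesis by (simp add: diag_group_def)
  qed
  \<comment> \<open>Only \<open>f\<close> is known to be multiplicative; its inverse inherits this
    because the diagonal group is closed under products.\<close>
  have g_mult: "g (a * b) = g a * g b" if "a \<in> T" "b \<in> T" for a b
    using gf f(2,3) gT[OF that(1)] gT[OF that(2)] diag_mult that by metis
  have alphas: "alpha D i s = alpha D i t" if "i \<in> {1..n}" for i
    using that assms by (simp add: alpha_E)
  have "g s $$ (i, i) = g t $$ (i, i)" if i: "i < r" for i
  proof -
    let ?c = "\<lambda>t. g t $$ (i, i)"
    have "?c a \<noteq> 0" if a: "a \<in> T" for a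
    proof
      assume 0: "?c a = 0"
      have "det (g a) = prod_list (diag_mat (g a))"
        using gC[OF a] by (intro det_upper_triangular[of _ r]) (auto simp: upper_triangular_def diagonal_mat_def)
      also have "\<dots> = 0" using 0 i gC[OF a] by (auto simp: diag_mat_def prod_list_zero_iff)
      finally show False using gT[OF a] GL_det_nonzero by (auto simp: diag_group_def)
    qed
    moreover have "?c (a * b) = ?c a * ?c b" if "a \<in> T" "b \<in> T" for a b
    proof -
      have "?c (a * b) = (\<Sum>k<r. g a $$ (i, k) * g b $$ (k, i))"
        using gC(1)[OF that(1)] gC(1)[OF that(2)] that i
        by (simp add: g_mult scalar_prod_def lessThan_atLeast0)
      also have "\<dots> = (\<Sum>k<r. if k = i then ?c a * ?c b else 0)"
        using gC(1)[OF that(1)] gC(2)[OF that(1)] i by (intro sum.cong) (auto simp: diagonal_mat_def)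
      finally show ?thesis using i by simp
    qed
    moreover have "\<exists>h\<in>regular m. \<forall>t\<in>T. ?c t = h t"
      using g i by (auto simp: alg_morphism_def)
    ultimately have "is_character m T ?c" by (simp add: is_character_def)
    \<comment> \<open>Here adjointness enters: the character is a monomial in the simple roots, and
      these agree at \<open>s\<close> and \<open>t\<close>.\<close>
    then obtain c where "\<forall>t\<in>T. ?c t = (\<Prod>i=1..n. alpha D i t powi c i)"
      using adj by blast
    thus ?thesis using assms(1,2) alphas by simp
  qed
  hence "g s = g t"
  proof (intro eq_matI)
    fix i j assume "i < dim_row (g t)" "j < dim_col (g t)"
    thus "g s $$ (i, j) = g t $$ (i, j)"
      using gC[OF assms(1)] gC[OF assms(2)] \<open>\<And>i. i < r \<Longrightarrow> g s $$ (i, i) = g t $$ (i, i)\<close>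
      by (cases "i = j") (auto simp: diagonal_mat_def)
  qed (use gC[OF assms(1)] gC[OF assms(2)] in auto)
  thus ?thesis using f(3) assms(1,2) by metis
qed


subsection \<open>Coordinates on the torus\<close>

text \<open>The value 1 outside the range is fixed by every reflection, so the laws below hold for
  all indices, and equality of torus elements is equality of functions.\<close>

definition coords :: "'a mat \<Rightarrow> nat \<Rightarrow> 'a" where
  "coords t = (\<lambda>k. if k \<in> {1..n} then E k t else 1)"

lemma coords_outside: "k \<notin> {1..n} \<Longrightarrow> coords t k = 1"
  by (auto simp: coords_def)

lemma coords_nonzero [simp]: "t \<in> T \<Longrightarrow> coords t k \<noteq> 0"
  by (simp add: coords_def)

lemma coords_mult: "s \<in> T \<Longrightarrow> t \<in> T \<Longrightarrow> coords (s * t) k = coords s k * coords t k"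
  by (simp add: coords_def E_mult)

lemma coords_one [simp]: "coords (1\<^sub>m m) k = 1"
  by (simp add: coords_def)

lemma coords_inv: "t \<in> T \<Longrightarrow> coords (iv t) k = inverse (coords t k)"
  by (simp add: coords_def E_inv)

lemma coords_inject: "s \<in> T \<Longrightarrow> t \<in> T \<Longrightarrow> coords s = coords t \<Longrightarrow> s = t"
  by (rule T_eqI) (auto simp: coords_def fun_eq_iff split: if_splits)

lemma chi_coords: "chi D v t = (\<Prod>k=1..n. coords t k powi v k)"
  unfolding chi_def rank by (intro prod.cong) (auto simp: coords_def)

lemma alpha_coords:
  assumes "i \<in> {1..n}" "t \<in> T"
  shows "alpha D i t = (if i < n then coords t i / coords t (Suc i) else coords t n)"
  using assms by (auto simp: alpha_E coords_def)

text \<open>The last simple root is the coordinate at \<open>n\<close> and the others are ratios of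
  neighbouring coordinates, so the coordinates are recovered from \<open>n\<close>
  downwards.\<close>

lemma coords_from_alpha:
  assumes t: "t \<in> T" and y: "\<And>k. k \<in> {1..n} \<Longrightarrow> y k \<noteq> 0" "\<And>k. k \<notin> {1..n} \<Longrightarrow> y k = 1"
    and alpha: "\<And>i. i \<in> {1..n} \<Longrightarrow> alpha D i t = (if i < n then y i / y (Suc i) else y n)"
  shows "coords t = y"
proof
  fix k
  have "coords t k = y k" if "k \<in> {1..n}"
    using that
  proof (induction "n - k" arbitrary: k)
    case 0
    thus ?case using alpha[of n] t by (simp add: alpha_coords)
  next
    case (Suc d)
    hence k: "k < n" "Suc k \<in> {1..n}" by auto
    hence "coords t (Suc k) = y (Suc k)" using Suc.hyps(2) by (intro Suc.hyps(1)) auto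
    thus ?case using alpha[OF Suc.prems] alpha_coords[OF Suc.prems t] k y(1)[OF k(2)] by simp
  qed
  thus "coords t k = y k" using y(2) coords_outside by metis
qed

lemma coweight_T [simp]: "j \<in> {1..n} \<Longrightarrow> x \<noteq> 0 \<Longrightarrow> coweight D j x \<in> T"
  and alpha_coweight:
    "i \<in> {1..n} \<Longrightarrow> j \<in> {1..n} \<Longrightarrow> x \<noteq> 0 \<Longrightarrow> alpha D i (coweight D j x) = (if i = j then x else 1)"
  using coweights by (auto simp: fundamental_coweights_def is_cocharacter_def rank)

lemma alpha_mult: "s \<in> T \<Longrightarrow> t \<in> T \<Longrightarrow> alpha D i (s * t) = alpha D i s * alpha D i t"
  by (simp add: alpha_def chi_mult)

lemma torus_pt:
  assumes "\<And>j. j \<in> {1..n} \<Longrightarrow> x j \<noteq> 0"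
  shows torus_pt_T: "torus_pt D x \<in> T"
    and alpha_torus_pt: "i \<in> {1..n} \<Longrightarrow> alpha D i (torus_pt D x) = x i"
proof -
  let ?p = "\<lambda>js. foldr (\<lambda>j A. coweight D j (x j) * A) js (1\<^sub>m m)"
  have p: "?p js \<in> T \<and> (i \<in> {1..n} \<longrightarrow> alpha D i (?p js) = (if i \<in> set js then x i else 1))"
    if "set js \<subseteq> {1..n}" "distinct js" for js i
    using that
  proof (induction js)
    case Nil
    show ?case by (auto simp: alpha_E)
  next
    case (Cons j js)
    thus ?case using assms by (auto simp: alpha_mult alpha_coweight)
  qed
  have js: "set [1..<Suc n] = {1..n}" by (auto simp del: upt_Suc)
  show "torus_pt D x \<in> T"
    using p[OF equalityD1[OF js] distinct_upt] unfolding torus_pt_def rank by blast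
  show "alpha D i (torus_pt D x) = x i" if "i \<in> {1..n}"
    using p[OF equalityD1[OF js] distinct_upt, of i] that unfolding torus_pt_def rank js by simp
qed

lemma coords_surj:
  assumes "\<And>k. k \<in> {1..n} \<Longrightarrow> y k \<noteq> 0" "\<And>k. k \<notin> {1..n} \<Longrightarrow> y k = 1"
  obtains t where "t \<in> T" "coords t = y"
proof
  let ?x = "\<lambda>i. if i < n then y i / y (Suc i) else y n"
  have x: "?x j \<noteq> 0" if "j \<in> {1..n}" for j using that assms(1) by auto
  show "torus_pt D ?x \<in> T" using torus_pt_T[of ?x] x by blast
  thus "coords (torus_pt D ?x) = y"
    using assms by (rule coords_from_alpha) (use alpha_torus_pt[of ?x] x in auto)
qed

text \<open>\<open>2 \<alpha> / (\<alpha>, \<alpha>)\<close> is \<open>\<alpha>\<close> for long roots and \<open>2 \<alpha>\<close> for short ones.\<close>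

lemma coords_coroot:
  assumes i: "i \<in> {1..n}" and x: "x \<noteq> 0"
  shows coroot_T: "coroot D (sr i) x \<in> T"
    and "coords (coroot D (sr i) x) = (\<lambda>k. x powi ((if i < n then 1 else 2) * sr i k))"
proof -
  have pairing: "coroot_pairing n (sr j) (sr i) =
      (if i < n then 1 else 2) * (if j < n then sr i j - sr i (Suc j) else sr i n)"
    if "j \<in> {1..n}" for j
  proof -
    have "dotp n (sr i) (sr i) = (if i < n then 2 else 1)"
      using i dotp_simple_root[of i n "sr i"] by (auto simp: simple_root_def)
    thus ?thesis
      using dotp_simple_root[OF that, of "sr i"] by (simp add: coroot_pairing_def dotp_commute)
  qed
  show T: "coroot D (sr i) x \<in> T"
    unfolding coroot_def by (rule torus_pt_T) (use x in auto)
  show "coords (coroot D (sr i) x) = (\<lambda>k. x powi ((if i < n then 1 else 2) * sr i k))"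
  proof (rule coords_from_alpha[OF T])
    fix j assume j: "j \<in> {1..n}"
    show "alpha D j (coroot D (sr i) x) =
        (if j < n then x powi ((if i < n then 1 else 2) * sr i j)
                     / x powi ((if i < n then 1 else 2) * sr i (Suc j))
         else x powi ((if i < n then 1 else 2) * sr i n))"
      unfolding coroot_def using j x
      by (simp add: alpha_torus_pt rank pairing power_int_diff[symmetric] right_diff_distrib)
  qed (use i x in \<open>auto simp: simple_root_def\<close>)
qed

text \<open>For \<open>i < n\<close>, dividing entry \<open>i\<close> and multiplying the next one
  by their ratio exchanges them. At the short root the doubled coroot divides the last entry by its
  square.\<close>

lemma reflect_inverse_coords:
  assumes i: "i \<in> {1..n}" and t: "t \<in> T"
  shows "coords (t * iv (coroot D (sr i) (alpha D i t))) = reflect inverse n i (coords t)"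
proof
  fix k
  have a: "alpha D i t \<noteq> 0" using t by (simp add: alpha_def)
  have "coords (t * iv (coroot D (sr i) (alpha D i t))) k =
      coords t k / alpha D i t powi ((if i < n then 1 else 2) * sr i k)"
    using t coords_coroot[OF i a] by (simp add: coords_mult coords_inv divide_inverse)
  also have "\<dots> = reflect inverse n i (coords t) k"
  proof -
    have "c k / (if i < n then c i / c (Suc i) else c n) powi ((if i < n then 1 else 2) * sr i k)
        = reflect inverse n i c k" if "\<And>k. c k \<noteq> 0" for c :: "nat \<Rightarrow> 'a"
      using that i by (auto simp: reflect_def transpose_def simple_root_def power_int_minus
          power2_eq_square inverse_eq_divide)
    thus ?thesis using alpha_coords[OF i t] t by simp
  qed
  finally show "coords (t * iv (coroot D (sr i) (alpha D i t))) k = \<dots>" .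
qed

section \<open>Conjugation on the torus and cosets of T\<close>

lemma cancel_inv [simp]:
  assumes "g \<in> carrier (GL m)" "h \<in> carrier (GL m)"
  shows "iv g * (g * h) = h" "g * (iv g * h) = h"
  using assms by (simp_all add: GL.m_assoc[symmetric])

lemma conj_conj:
  assumes "g \<in> carrier (GL m)" "h \<in> carrier (GL m)" "x \<in> carrier (GL m)"
  shows "(g * h) * x * iv (g * h) = g * (h * x * iv h) * iv g"
  using assms by (simp add: GL.inv_mult_group GL.m_assoc)

lemma conj_simple_refl:
  assumes "i \<in> {1..n}" "g \<in> simple_refl D i"
  shows simple_refl_N: "g \<in> N"
    and coords_conj: "t \<in> T \<Longrightarrow> coords (g * t * iv g) = reflect inverse n i (coords t)"
  using assms reflect_inverse_coords[OF assms(1)]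
  by (auto simp: simple_refl_def refl_def rank alpha_def)

lemma proj_eq: "proj D g = (\<lambda>t. t * g) ` T"
  by (auto simp: proj_def r_coset_def)

lemma proj_eq_iff:
  assumes "g \<in> N" "h \<in> N"
  shows "proj D g = proj D h \<longleftrightarrow> (\<exists>t\<in>T. g = t * h)"
proof
  assume "proj D g = proj D h"
  moreover have "g \<in> proj D g" using assms by (auto simp: proj_eq image_iff intro!: bexI[of _ "1\<^sub>m m"])
  ultimately show "\<exists>t\<in>T. g = t * h" by (auto simp: proj_eq)
next
  assume "\<exists>t\<in>T. g = t * h"
  then obtain t where t: "t \<in> T" "g = t * h" by blast
  show "proj D g = proj D h"
    unfolding proj_eq
  proof safe
    fix s assume "s \<in> T"
    thus "s * g \<in> (\<lambda>t. t * h) ` T"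
      using t assms by (intro image_eqI[of _ _ "s * t"]) (simp_all add: GL.m_assoc)
    show "s * h \<in> (\<lambda>t. t * g) ` T"
      using t assms \<open>s \<in> T\<close>
      by (intro image_eqI[of _ _ "s * iv t"]) (simp_all add: GL.m_assoc GL.inv_solve_left)
  qed
qed

lemma T_of_centralizing:
  assumes "g \<in> N" "\<And>t. t \<in> T \<Longrightarrow> g * t * iv g = t"
  shows "g \<in> T"
proof -
  have "g * t = t * g" if "t \<in> T" for t
    using assms(2)[OF that] assms(1) that by (simp add: GL.inv_solve_right')
  hence "g \<in> centralizer (group_of D) T"
    using assms(1) N_subset_G by (auto simp: centralizer_def)
  thus ?thesis using self_centralizing by simp
qed

text \<open>The quotient \<open>g * iv h\<close> centralizes T, hence lies in T: the action on the
  torus determines an element of N up to T.\<close>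

lemma same_action:
  assumes "g \<in> N" "h \<in> N" "\<And>t. t \<in> T \<Longrightarrow> g * t * iv g = h * t * iv h"
  shows "\<exists>s\<in>T. g = s * h"
proof
  show "g * iv h \<in> T"
  proof (rule T_of_centralizing)
    fix t assume t: "t \<in> T"
    have "(g * iv h) * t * iv (g * iv h) = g * (iv h * t * iv (iv h)) * iv g"
      using assms t by (intro conj_conj) simp_all
    also have "\<dots> = h * (iv h * t * h) * iv h" using assms t by simp
    also have "\<dots> = t" using assms t by (simp add: GL.m_assoc)
    finally show "(g * iv h) * t * iv (g * iv h) = t" .
  qed (use assms in simp)
  show "g = g * iv h * h" using assms by (simp add: GL.m_assoc)
qed


section \<open>The Weyl group\<close>

abbreviation wd :: "(nat \<Rightarrow> 'a mat) \<Rightarrow> nat list \<Rightarrow> 'a mat" where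
  "wd f ws \<equiv> foldr (\<lambda>i A. f i * A) ws (1\<^sub>m m)"

lemma wd_N:
  assumes "set ws \<subseteq> {1..n}" "\<And>i. i \<in> {1..n} \<Longrightarrow> f i \<in> N"
  shows "wd f ws \<in> N"
  using assms(1) by (induction ws) (auto simp: assms(2))

lemma wd_append:
  assumes "set us \<subseteq> {1..n}" "set ws \<subseteq> {1..n}" "\<And>i. i \<in> {1..n} \<Longrightarrow> f i \<in> N"
  shows "wd f (us @ ws) = wd f us * wd f ws"
  using assms(1)
proof (induction us)
  case (Cons i us)
  thus ?case using wd_N[OF _ assms(3)] assms(2,3) by (simp add: GL.m_assoc)
qed (use wd_N[OF assms(2,3)] in simp)

lemma coords_conj_wd:
  assumes "set ws \<subseteq> {1..n}" "\<And>i. i \<in> {1..n} \<Longrightarrow> f i \<in> simple_refl D i" "t \<in> T"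
  shows "coords (wd f ws * t * iv (wd f ws)) = reflects inverse n ws (coords t)"
  using assms(1)
proof (induction ws)
  case Nil
  thus ?case using assms(3) by simp
next
  case (Cons i ws)
  have f: "f i \<in> N" if "i \<in> {1..n}" for i using simple_refl_N assms(2) that by blast
  have W: "wd f ws \<in> N" using wd_N[of ws f] f Cons.prems by auto
  have "wd f (i # ws) * t * iv (wd f (i # ws)) = f i * (wd f ws * t * iv (wd f ws)) * iv (f i)"
    using conj_conj[of "f i" "wd f ws" t] f W assms(3) Cons.prems by simp
  moreover have "coords (f i * (wd f ws * t * iv (wd f ws)) * iv (f i)) =
      reflect inverse n i (coords (wd f ws * t * iv (wd f ws)))"
    using Cons.prems assms(2,3) W by (intro coords_conj) simp_all
  ultimately show ?case using Cons by simp
qed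

lemma chi_reflect:
  assumes "i \<in> {1..n}" "s \<in> T" "t \<in> T" "coords s = reflect inverse n i (coords t)"
  shows "chi D v s = chi D (move n i v) t"
proof (cases "i < n")
  case True
  have "(\<Prod>k=1..n. coords t (transpose i (Suc i) k) powi v k) =
      (\<Prod>k=1..n. coords t k powi v (transpose i (Suc i) k))"
    using prod.permute[OF transpose_permutes_Suc[of i n], of "\<lambda>k. coords t k powi v (transpose i (Suc i) k)"]
      assms(1) True by (simp add: o_def)
  thus ?thesis using True by (simp add: chi_coords assms(4) reflect_def)
next
  case False
  thus ?thesis using assms(1)
    by (auto simp: chi_coords assms(4) reflect_def power_int_minus power_int_inverse intro!: prod.cong)
qed

text \<open>A Weyl element acts on characters through its inverse on the torus; this is why the word
  is inverted on the left while its letters keep their order on the right.\<close>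

lemma chi_conj_wd:
  assumes ws: "set ws \<subseteq> {1..n}" and f: "\<And>i. i \<in> {1..n} \<Longrightarrow> f i \<in> simple_refl D i" and t: "t \<in> T"
  shows "chi D v (iv (wd f ws) * t * wd f ws) = chi D (reflects uminus n ws v) t"
  using ws t
proof (induction ws arbitrary: t)
  case (Cons i ws)
  have N: "f i \<in> N" if "i \<in> {1..n}" for i using simple_refl_N f that by blast
  have W: "wd f ws \<in> N" using wd_N[of ws f] N Cons.prems by auto
  have i: "i \<in> {1..n}" using Cons.prems by simp
  let ?s = "iv (f i) * t * f i"
  have s: "?s \<in> T" using N[OF i] Cons.prems by simp
  have "f i * ?s * iv (f i) = t"
    using N[OF i] Cons.prems by (simp add: GL.m_assoc)
  hence "coords t = reflect inverse n i (coords ?s)"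
    using coords_conj[OF i f[OF i] s] by simp
  moreover have "iv (wd f (i # ws)) * t * wd f (i # ws) = iv (wd f ws) * ?s * wd f ws"
    using N[OF i] W Cons.prems by (simp add: GL.inv_mult_group GL.m_assoc)
  ultimately show ?case
    using Cons chi_reflect[OF i Cons.prems(2) s] s by simp
qed simp

lemma chi_faithful:
  assumes "v \<in> lattice_vecs n" "w \<in> lattice_vecs n" "\<And>t. t \<in> T \<Longrightarrow> chi D v t = chi D w t"
  shows "v = w"
proof -
  have "(\<lambda>k. v k + - w k) \<in> lattice_vecs n" using assms by (auto simp: lattice_vecs_def)
  moreover have "chi D (\<lambda>k. v k + - w k) t = 1" if "t \<in> T" for t
    using that assms(3) chi_add[OF that, of v "\<lambda>k. - w k"] by (simp add: chi_uminus)
  ultimately have "(\<lambda>k. v k + - w k) = (\<lambda>k. 0)" using adj by blast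
  thus ?thesis by (auto simp: fun_eq_iff)
qed

lemma chi_surj:
  assumes "v \<in> B_roots n" "a \<noteq> 0"
  obtains t where "t \<in> T" "chi D v t = a"
proof -
  have "\<exists>i\<in>{1..n}. v i \<in> {-1, 1}"
    using assms(1) by (cases rule: root_cases) blast+
  then obtain i where i: "i \<in> {1..n}" "v i \<in> {-1, 1}" by blast
  \<comment> \<open>The exponent \<open>v i\<close> is a sign, so raising \<open>a\<close> to it
    twice returns \<open>a\<close>.\<close>
  obtain t where t: "t \<in> T" "coords t = (\<lambda>k. if k = i then a powi v i else 1)"
    by (rule coords_surj[of "\<lambda>k. if k = i then a powi v i else 1"]) (use i assms(2) in auto)
  have "chi D v t = (\<Prod>k=1..n. if k = i then (a powi v i) powi v i else 1)"
    unfolding chi_coords t(2) by (intro prod.cong) auto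
  also have "\<dots> = a" using i assms(2) by auto
  finally show thesis using that t(1) by blast
qed


subsection \<open>Root subgroups under conjugation\<close>

lemma root_homD:
  assumes "root_hom m (group_of D) T \<chi> u"
  shows root_hom_GL: "u x \<in> carrier (GL m)"
    and root_hom_add: "u (x + y) = u x * u y"
    and root_hom_conj_T: "t \<in> T \<Longrightarrow> t * u x * iv t = u (\<chi> t * x)"
    and root_hom_inj: "u x = u y \<Longrightarrow> x = y"
    and root_hom_zero: "u 0 = 1\<^sub>m m"
    and root_hom_uminus: "u (- x) = iv (u x)"
proof -
  have u: "range u \<subseteq> group_of D" "\<And>x y. u (x + y) = u x * u y" "\<exists>f. \<forall>x. f (u x) = x"
    using assms unfolding root_hom_def by blast+
  show GL: "u x \<in> carrier (GL m)" for x
    using u(1) subgroup.subset[OF subgroup_G] by blast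
  show "u (x + y) = u x * u y" by fact
  show "t \<in> T \<Longrightarrow> t * u x * iv t = u (\<chi> t * x)" using assms by (simp add: root_hom_def)
  show "u x = u y \<Longrightarrow> x = y" using u(3) by metis
  have "u 0 * u 0 = u 0" using u(2)[of 0 0] by simp
  thus 0: "u 0 = 1\<^sub>m m" using GL[of 0] GL.l_cancel_one by blast
  have "u (- x) * u x = 1\<^sub>m m" using u(2)[of "- x" x] 0 by simp
  thus "u (- x) = iv (u x)" using GL.inv_equality GL by metis
qed

lemma regular_conj_GL:
  assumes "g \<in> carrier (GL m)" "f \<in> regular m"
  obtains f' where "f' \<in> regular m" "\<And>A. A \<in> carrier (GL m) \<Longrightarrow> f' A = f (iv g * A * g)"
proof -
  have "\<exists>f'\<in>regular m. \<forall>A\<in>carrier_mat m m. f' A = f (iv g * A * g)"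
    using assms by (intro regular_conj) (auto intro: GL_carrier_mat)
  thus thesis using that GL_carrier_mat by blast
qed

lemma root_hom_conj:
  assumes g: "g \<in> N" and u: "root_hom m (group_of D) T \<chi> u"
    and \<chi>: "\<And>t. t \<in> T \<Longrightarrow> \<chi>' t = \<chi> (iv g * t * g)"
  shows "root_hom m (group_of D) T \<chi>' (\<lambda>x. g * u x * iv g)"
proof -
  note GL = root_hom_GL[OF u]
  have gG: "g \<in> group_of D" "iv g \<in> group_of D" using g N_subset_G N_inv by blast+
  have uG: "u x \<in> group_of D" for x using u by (auto simp: root_hom_def)
  have "\<exists>p. \<forall>x. (g * u x * iv g) $$ (i, j) = poly p x" if "i < m" "j < m" for i j
    using that u g by (intro polynomial_conj) (auto simp: root_hom_def GL intro!: GL_carrier_mat)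
  moreover have "range (\<lambda>x. g * u x * iv g) \<subseteq> group_of D"
    using subgroup.m_closed[OF subgroup_G] gG uG by auto
  moreover have "g * u (x + y) * iv g = (g * u x * iv g) * (g * u y * iv g)" for x y
    using g GL by (simp add: root_hom_add[OF u] GL.m_assoc)
  moreover have "\<exists>f\<in>regular m. \<forall>x. f (g * u x * iv g) = x"
  proof -
    obtain f where f: "f \<in> regular m" "\<And>x. f (u x) = x" using u by (auto simp: root_hom_def)
    obtain f' where f': "f' \<in> regular m" "\<And>A. A \<in> carrier (GL m) \<Longrightarrow> f' A = f (iv g * A * g)"
      using regular_conj_GL[OF N_GL[OF g] f(1)] by blast
    have "f' (g * u x * iv g) = x" for x
      using f(2) f'(2)[of "g * u x * iv g"] g GL by (simp add: GL.m_assoc)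
    thus ?thesis using f'(1) by blast
  qed
  moreover have "t * (g * u x * iv g) * iv t = g * u (\<chi>' t * x) * iv g" if t: "t \<in> T" for t x
  proof -
    let ?s = "iv g * t * g"
    have s: "?s \<in> T" using g t by simp
    have "g * u (\<chi>' t * x) * iv g = g * (?s * u x * iv ?s) * iv g"
      using root_hom_conj_T[OF u s] \<chi>[OF t] by simp
    also have "\<dots> = t * (g * u x * iv g) * iv t"
      using g t GL by (simp add: GL.inv_mult_group GL.m_assoc)
    finally show ?thesis by simp
  qed
  ultimately show ?thesis unfolding root_hom_def by blast
qed

lemma character_conj:
  assumes g: "g \<in> N" and \<chi>: "is_character m T \<chi>"
  shows "is_character m T (\<lambda>t. \<chi> (iv g * t * g))"
proof -
  obtain f where f: "f \<in> regular m" "\<And>t. t \<in> T \<Longrightarrow> \<chi> t = f t"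
    using \<chi> by (auto simp: is_character_def)
  obtain f' where f': "f' \<in> regular m" "\<And>A. A \<in> carrier (GL m) \<Longrightarrow> f' A = f (iv g * A * g)"
    using regular_conj_GL[OF N_GL[OF g] f(1)] by blast
  have "\<forall>t\<in>T. \<chi> (iv g * t * g) = f' t" using f f' g by simp
  moreover have "iv g * (s * t) * g = (iv g * s * g) * (iv g * t * g)" if "s \<in> T" "t \<in> T" for s t
    using that g by (simp add: GL.m_assoc)
  moreover have "\<forall>s\<in>T. \<forall>t\<in>T. \<chi> (s * t) = \<chi> s * \<chi> t" "\<forall>t\<in>T. \<chi> t \<noteq> 0"
    using \<chi> by (simp_all add: is_character_def)
  ultimately show ?thesis using f'(1) g unfolding is_character_def by auto
qed

lemma conj_root:
  assumes g: "g \<in> N" and v: "v \<in> B_roots n"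
  obtains w where "w \<in> B_roots n" "\<And>t. t \<in> T \<Longrightarrow> chi D v (iv g * t * g) = chi D w t"
proof -
  have "is_root m (group_of D) T (chi D v)" using adj v by blast
  then obtain u s where u: "root_hom m (group_of D) T (chi D v) u" "is_character m T (chi D v)"
      "s \<in> T" "chi D v s \<noteq> 1"
    by (auto simp: is_root_def)
  have "iv g * (g * s * iv g) * g = s" using g u(3) by (simp add: GL.m_assoc)
  hence "\<exists>t\<in>T. chi D v (iv g * t * g) \<noteq> 1"
    using u(3,4) g by (intro bexI[of _ "g * s * iv g"]) simp_all
  hence "is_root m (group_of D) T (\<lambda>t. chi D v (iv g * t * g))"
    using character_conj[OF g u(2)] root_hom_conj[OF g u(1) refl] unfolding is_root_def by blast
  thus thesis using adj that by blast
qed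

lemma rootmap_hom: "v \<in> B_roots n \<Longrightarrow> root_hom m (group_of D) T (chi D v) (rootmap D v)"
  using realization by (simp add: realization_def rank)

text \<open>Uniqueness of the root subgroup yields a map of parameters. It commutes with scaling, as
  T acts on both sides through a character that takes every nonzero value, so it is multiplication
  by its value at 1.\<close>

lemma conj_rootmap:
  assumes g: "g \<in> N" and v: "v \<in> B_roots n" and w: "w \<in> B_roots n"
    and vw: "\<And>t. t \<in> T \<Longrightarrow> chi D v (iv g * t * g) = chi D w t"
  obtains c where "c \<noteq> 0" "\<And>x. g * rootmap D v x * iv g = rootmap D w (c * x)"
proof -
  note u = rootmap_hom[OF v] and u' = rootmap_hom[OF w]
  note GL = root_hom_GL[OF u] root_hom_GL[OF u']
  have conj: "root_hom m (group_of D) T (chi D w) (\<lambda>x. g * rootmap D v x * iv g)"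
    using root_hom_conj[OF g u] vw by simp
  moreover have "root_subgroup m (group_of D) T (chi D w) (range (rootmap D w))"
    using realization w by (simp add: realization_def rank)
  ultimately have "range (\<lambda>x. g * rootmap D v x * iv g) = range (rootmap D w)"
    unfolding root_subgroup_def by blast
  hence "\<forall>x. \<exists>y. g * rootmap D v x * iv g = rootmap D w y" by blast
  then obtain \<phi> where \<phi>: "\<And>x. g * rootmap D v x * iv g = rootmap D w (\<phi> x)" by metis
  have scale: "\<phi> (a * x) = a * \<phi> x" if a: "a \<noteq> 0" for a x
  proof -
    obtain t where t: "t \<in> T" "chi D w t = a" using chi_surj[OF w a] .
    have "rootmap D w (\<phi> (a * x)) = t * (g * rootmap D v x * iv g) * iv t"
      using root_hom_conj_T[OF conj t(1)] t(2) \<phi> by simp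
    also have "\<dots> = rootmap D w (a * \<phi> x)"
      using root_hom_conj_T[OF u' t(1)] t(2) \<phi> by simp
    finally show ?thesis using root_hom_inj[OF u'] by blast
  qed
  have "g * rootmap D v 0 * iv g = 1\<^sub>m m" using g by (simp add: root_hom_zero[OF u])
  hence 0: "\<phi> 0 = 0" using \<phi>[of 0] root_hom_zero[OF u'] root_hom_inj[OF u'] by metis
  have "g * rootmap D v x * iv g = rootmap D w (\<phi> 1 * x)" for x
    using scale[of x 1] \<phi>[of x] 0 by (cases "x = 0") (simp_all add: mult.commute)
  moreover have "\<phi> 1 \<noteq> 0"
  proof
    assume "\<phi> 1 = 0"
    hence "\<phi> 1 = \<phi> 0" using 0 by simp
    hence "g * rootmap D v 1 * iv g = g * rootmap D v 0 * iv g" using \<phi> by metis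
    thus False using root_hom_inj[OF conj, of 1 0] by simp
  qed
  ultimately show thesis using that by blast
qed


subsection \<open>The elements sigma\<close>

lemma sigma_N: "v \<in> B_roots n \<Longrightarrow> sigma D v \<in> N"
  and rootmap_coroot: "v \<in> B_roots n \<Longrightarrow> x \<noteq> 0 \<Longrightarrow>
    rootmap D v x * rootmap D (\<lambda>k. - v k) (- inverse x) * rootmap D v x = coroot D v x * sigma D v"
  and proj_sigma: "v \<in> B_roots n \<Longrightarrow> proj D (sigma D v) = refl D v"
  using realization by (simp_all add: realization_def rank)

lemma \<sigma>_simple_refl: "i \<in> {1..n} \<Longrightarrow> \<sigma> i \<in> simple_refl D i"
proof -
  assume i: "i \<in> {1..n}"
  have "\<sigma> i \<in> proj D (\<sigma> i)"
    using sigma_N[OF simple_root_in_roots[OF i]]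
    by (auto simp: proj_eq sigma_simple_def rank image_iff intro!: bexI[of _ "1\<^sub>m m"])
  thus ?thesis
    using proj_sigma[OF simple_root_in_roots[OF i]] by (simp add: sigma_simple_def simple_refl_def rank)
qed

lemma simple_refl_eq: "i \<in> {1..n} \<Longrightarrow> simple_refl D i = proj D (\<sigma> i)"
  using proj_sigma[OF simple_root_in_roots] by (simp add: sigma_simple_def simple_refl_def rank)

lemma \<sigma>_N [simp]: "i \<in> {1..n} \<Longrightarrow> \<sigma> i \<in> N"
  using simple_refl_N \<sigma>_simple_refl by blast

lemma coroot_in_T: "x \<noteq> 0 \<Longrightarrow> coroot D v x \<in> T"
  unfolding coroot_def by (rule torus_pt_T) simp

text \<open>Inverting the three factors negates their arguments, which gives the product in
  \<open>rootmap_coroot\<close> at \<open>x = -1\<close>.\<close>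

lemma sigma_inverse:
  assumes v: "v \<in> B_roots n"
  shows "iv (sigma D v) = coroot D v (- 1) * sigma D v"
proof -
  note u = rootmap_hom[OF v] and u' = rootmap_hom[OF uminus_roots[OF v]]
  note GL = root_hom_GL[OF u] root_hom_GL[OF u']
  have "iv (sigma D v) = iv (rootmap D v 1) * iv (rootmap D (\<lambda>k. - v k) (- 1)) * iv (rootmap D v 1)"
    using GL by (simp add: sigma_def GL.inv_mult_group GL.m_assoc)
  thus ?thesis
    using rootmap_coroot[OF v, of "- 1"] by (simp add: root_hom_uminus[OF u] root_hom_uminus[OF u'] GL)
qed

text \<open>By \<open>sigma_inverse\<close> the square is the inverse of the coroot at -1. The
  coroot of the short root has even exponents, so there the square is trivial.\<close>

lemma \<sigma>_square:
  assumes i: "i \<in> {1..n}"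
  shows "\<sigma> i * \<sigma> i \<in> T"
    and "coords (\<sigma> i * \<sigma> i) = (\<lambda>k. if i < n \<and> (k = i \<or> k = Suc i) then - 1 else 1)"
proof -
  let ?c = "coroot D (sr i) (- 1)"
  have c: "?c \<in> T" by (rule coroot_in_T) simp
  have "iv (\<sigma> i) = ?c * \<sigma> i"
    using sigma_inverse[OF simple_root_in_roots[OF i]] by (simp add: sigma_simple_def rank)
  hence "?c * (\<sigma> i * \<sigma> i) = iv (\<sigma> i) * \<sigma> i" using i c by (simp add: GL.m_assoc)
  hence "?c * (\<sigma> i * \<sigma> i) = 1\<^sub>m m" using i by simp
  moreover have "\<sigma> i * \<sigma> i = iv ?c * (?c * (\<sigma> i * \<sigma> i))" using c i by simp
  ultimately have eq: "\<sigma> i * \<sigma> i = iv ?c" using c by simp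
  thus "\<sigma> i * \<sigma> i \<in> T" using c by simp
  show "coords (\<sigma> i * \<sigma> i) = (\<lambda>k. if i < n \<and> (k = i \<or> k = Suc i) then - 1 else 1)"
    using coords_coroot(2)[OF i, of "- 1"] c
    by (auto simp: eq coords_inv fun_eq_iff simple_root_def power_int_minus)
qed

text \<open>A piece of the uniqueness in the open cell, drawn from the torus action alone:
  conjugation by T scales the two root parameters in inverse ways, and comparing several such
  scalings forces first the parameter on the right and then \<open>d\<close> to vanish.\<close>

lemma torus_times_root_opposite:
  assumes v: "v \<in> B_roots n" and t: "t \<in> T"
    and eq: "rootmap D (\<lambda>k. - v k) d = t * rootmap D v e"
  shows "d = 0"
proof -
  let ?u = "rootmap D v" and ?w = "rootmap D (\<lambda>k. - v k)"
  note u = rootmap_hom[OF v] and w = rootmap_hom[OF uminus_roots[OF v]]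
  note GL = root_hom_GL[OF u] root_hom_GL[OF w]
  have scale: "?w (d / z) = t * ?u (z * e)" if z: "z \<noteq> 0" for z
  proof -
    obtain s where s: "s \<in> T" "chi D v s = z" using chi_surj[OF v z] .
    have "?w (d / z) = s * (t * ?u e) * iv s"
      using root_hom_conj_T[OF w s(1), of d] s eq by (simp add: chi_uminus divide_inverse mult.commute)
    also have "\<dots> = t * (s * ?u e * iv s)"
      using s(1) t GL T_comm[OF s(1) t] by (simp add: GL.m_assoc[symmetric])
    finally show ?thesis using root_hom_conj_T[OF u s(1)] s(2) by simp
  qed
  let ?e = "chi D v t * e"
  have diff: "?w (d / z - d) = ?u (?e * (z - 1))" if z: "z \<noteq> 0" for z
  proof -
    have "?w (d / z - d) = t * ?u (z * e) * iv (t * ?u e)"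
      using root_hom_add[OF w, of "d / z" "- d"] scale[OF z] eq by (simp add: root_hom_uminus[OF w])
    also have "\<dots> = t * (?u (z * e) * ?u (- e)) * iv t"
      using t GL by (simp add: root_hom_uminus[OF u] GL.inv_mult_group GL.m_assoc)
    also have "\<dots> = ?u (chi D v t * (z * e + - e))"
      unfolding root_hom_add[OF u, symmetric] by (rule root_hom_conj_T[OF u t])
    also have "chi D v t * (z * e + - e) = ?e * (z - 1)" by (simp add: algebra_simps)
    finally show ?thesis .
  qed
  \<comment> \<open>Up to the factor 2, the comparison below says that \<open>?e\<close> times (z -
    1)^2 is 0, and it needs \<open>z\<close> different from 0, 1 and 2. A root of z^2 = z + 1 is
    none of these in any characteristic, even when they exhaust the prime field.\<close>
  have "degree [:- 1, - 1, 1 :: 'a:] > 0" by simp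
  then obtain z where "poly [:- 1, - 1, 1 :: 'a:] z = 0" using alg_closed_imp_poly_has_root by blast
  hence z: "z * z = z + 1" by (simp add: algebra_simps)
  have nz: "z \<noteq> 0" using z by auto
  have n2: "z \<noteq> 2"
  proof
    assume "z = 2"
    hence "(3::'a) + 1 = 3 + 0" using z by simp
    thus False by (subst (asm) add_left_cancel) simp
  qed
  text \<open>Compare the cases \<open>-1\<close> and \<open>z / (z - 2)\<close> of \<open>diff\<close>, the former conjugated into the latter.\<close>
  obtain s where s: "s \<in> T" "chi D v s = z" using chi_surj[OF v nz] .
  have "?w ((- d - d) / z) = ?u (?e * (- 2) * z)"
  proof -
    have "s * ?w (- d - d) * iv s = s * ?u (?e * (- 2)) * iv s" using diff[of "- 1"] by simp
    thus ?thesis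
      using root_hom_conj_T[OF w s(1)] root_hom_conj_T[OF u s(1)] s
      by (simp add: chi_uminus divide_inverse mult.commute)
  qed
  moreover have "?w ((- d - d) / z) = ?u (?e * (z / (z - 2) - 1))"
  proof -
    have "d / (z / (z - 2)) - d = (- d - d) / z" using nz by (simp add: field_simps)
    thus ?thesis using diff[of "z / (z - 2)"] nz n2 by simp
  qed
  ultimately have "?e * (- 2) * z = ?e * (z / (z - 2) - 1)" using root_hom_inj[OF u] by metis
  hence "?e * ((- 2) * z * (z - 2)) = ?e * 2" using n2 by (simp add: field_simps)
  moreover have "(- 2) * z * (z - 2) = 2 * z - 2"
  proof -
    have "(- 2) * z * (z - 2) = 4 * z - 2 * (z * z)" by (simp add: algebra_simps)
    also have "\<dots> = 2 * z - 2" unfolding z by (simp add: algebra_simps)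
    finally show ?thesis .
  qed
  ultimately have "?e * (2 * z - 2) = ?e * 2" by metis
  hence "?e * (2 * z - 2) - ?e * 2 = 0" by simp
  moreover have "?e * (2 * z - 2) - ?e * 2 = ?e * (2 * (z - 2))" by (simp add: algebra_simps)
  ultimately have "?e * (2 * (z - 2)) = 0" by simp
  hence e: "?e = 0" using n2 two_nonzero by (simp only: mult_eq_0_iff) simp
  have "?w (- d - d) = ?w 0" using diff[of "- 1"] root_hom_zero[OF u] root_hom_zero[OF w] e by simp
  hence "- d - d = 0" by (rule root_hom_inj[OF w])
  hence "2 * d = 0" by (simp add: algebra_simps)
  thus "d = 0" using two_nonzero by simp
qed

text \<open>The conjugate of \<open>sigma D v\<close> is a product of three root elements with
  parameters \<open>c\<close>, \<open>- c'\<close>, \<open>c\<close>, and by \<open>act\<close> a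
  torus multiple of the product with \<open>inverse c\<close> for \<open>c'\<close>. Cancellation
  leaves an opposite root element inside T times the root subgroup, so
  \<open>c' = inverse c\<close>, and the product is the one that involves the coroot.\<close>

lemma conj_sigma:
  assumes g: "g \<in> N" and v: "v \<in> B_roots n" and w: "w \<in> B_roots n"
    and vw: "\<And>t. t \<in> T \<Longrightarrow> chi D v (iv g * t * g) = chi D w t"
    and act: "s \<in> T" "g * sigma D v = s * (sigma D w * g)"
  obtains c where "c \<noteq> 0" "g * sigma D v = coroot D w c * (sigma D w * g)"
proof -
  let ?u = "rootmap D w" and ?w = "rootmap D (\<lambda>k. - w k)"
  note u = rootmap_hom[OF w] and u' = rootmap_hom[OF uminus_roots[OF w]]
  note u0 = rootmap_hom[OF v] and u0' = rootmap_hom[OF uminus_roots[OF v]]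
  note GL = root_hom_GL[OF u] root_hom_GL[OF u'] root_hom_GL[OF u0] root_hom_GL[OF u0']
  obtain c where c: "c \<noteq> 0" "\<And>x. g * rootmap D v x * iv g = ?u (c * x)"
    by (rule conj_rootmap[OF g v w vw]) blast+
  have "chi D (\<lambda>k. - v k) (iv g * t * g) = chi D (\<lambda>k. - w k) t" if "t \<in> T" for t
    using vw that g by (simp add: chi_uminus)
  then obtain c' where c': "\<And>x. g * rootmap D (\<lambda>k. - v k) x * iv g = ?w (c' * x)"
    using conj_rootmap[OF g uminus_roots[OF v] uminus_roots[OF w]] by blast
  let ?h = "coroot D w c"
  have h: "?h \<in> T" by (rule coroot_in_T[OF c(1)])
  note \<sigma>N = sigma_N[OF v] sigma_N[OF w]
  have "g * sigma D v * iv g = (g * rootmap D v 1 * iv g) *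
      (g * rootmap D (\<lambda>k. - v k) (- 1) * iv g) * (g * rootmap D v 1 * iv g)"
    unfolding sigma_def using GL g by (simp add: GL.m_assoc)
  hence lhs: "g * sigma D v * iv g = ?u c * ?w (- c') * ?u c" using c(2)[of 1] c'[of "- 1"] c(2) by simp
  have "g * sigma D v * iv g = s * sigma D w"
    using act g \<sigma>N by (simp add: GL.m_assoc)
  also have "\<dots> = s * iv ?h * (?h * sigma D w)"
    using act(1) h \<sigma>N by (simp add: GL.m_assoc)
  finally have rhs: "g * sigma D v * iv g = s * iv ?h * (?u c * ?w (- inverse c) * ?u c)"
    using rootmap_coroot[OF w c(1)] by simp
  let ?t = "s * iv ?h"
  have t: "?t \<in> T" using act(1) h by simp
  have "?w (- c') = iv (?u c) * (g * sigma D v * iv g) * iv (?u c)"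
    unfolding lhs using GL by (simp add: GL.m_assoc)
  also have "\<dots> = ?u (- c) * (?t * (?u c * ?w (- inverse c)))"
    unfolding rhs using GL t by (simp add: GL.m_assoc root_hom_uminus[OF u])
  finally have "?w (- c') = ?u (- c) * (?t * (?u c * ?w (- inverse c)))" .
  hence "?w (- c') * ?w (inverse c) = ?u (- c) * (?t * ?u c)"
    using GL t root_hom_uminus[OF u', of "inverse c"] by (simp add: GL.m_assoc)
  hence "?w (- c' + inverse c) = ?u (- c) * (?t * ?u c)"
    using root_hom_add[OF u', of "- c'" "inverse c"] by simp
  also have "\<dots> = ?t * ((iv ?t * ?u (- c) * iv (iv ?t)) * ?u c)"
    using GL t by (simp add: GL.m_assoc)
  also have "\<dots> = ?t * ?u (chi D w (iv ?t) * (- c) + c)"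
    using root_hom_conj_T[OF u T_inv[OF t]] by (simp only: root_hom_add[OF u])
  finally have "- c' + inverse c = 0" by (rule torus_times_root_opposite[OF w t])
  hence "c' = inverse c" by simp
  hence "g * sigma D v * iv g = ?h * sigma D w"
    unfolding lhs using rootmap_coroot[OF w c(1)] by simp
  hence "g * sigma D v = ?h * sigma D w * g"
    using g \<sigma>N h by (metis GL.inv_solve_right' GL.m_closed N_GL T_N)
  thus thesis using that[OF c(1)] g \<sigma>N h by (simp add: GL.m_assoc)
qed


subsection \<open>Braid relations\<close>

text \<open>Tits' argument: the two sides differ by an element of \<open>\<alpha>\<^sub>i\<^sup>\<or>(F\<^sup>\<times>)\<close>, and by symmetry of
  \<open>\<alpha>\<^sub>j\<^sup>\<or>(F\<^sup>\<times>)\<close>. For the adjoint group of type \<open>B\<^sub>n\<close> these two meet trivially.\<close>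

lemma half_braid:
  assumes ik: "i \<in> {1..n}" "k \<in> {1..n}" and Q: "set Q \<subseteq> {1..n}"
    and act: "\<And>y::nat \<Rightarrow> 'a. reflects inverse n (Q @ [k]) y = reflects inverse n (i # Q) y"
    and root: "reflects uminus n Q (sr k) = sr i"
  obtains c where "c \<noteq> 0" "wd \<sigma> (Q @ [k]) = coroot D (sr i) c * wd \<sigma> (i # Q)"
proof -
  let ?g = "wd \<sigma> Q"
  have g: "?g \<in> N" by (rule wd_N[OF Q \<sigma>_N])
  have gk: "wd \<sigma> (Q @ [k]) = ?g * \<sigma> k" using wd_append[OF Q, of "[k]" \<sigma>] ik by simp
  have "\<exists>s\<in>T. ?g * \<sigma> k = s * (\<sigma> i * ?g)"
  proof (rule same_action)
    fix t assume t: "t \<in> T"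
    let ?W = "wd \<sigma> (Q @ [k])" and ?V = "wd \<sigma> (i # Q)"
    have N: "?W \<in> N" "?V \<in> N" using g gk ik by simp_all
    have "coords (?W * t * iv ?W) = coords (?V * t * iv ?V)"
      using act ik Q t by (simp only: coords_conj_wd[OF _ \<sigma>_simple_refl] set_append list.set Un_subset_iff
          insert_subset empty_subsetI)
    hence "?W * t * iv ?W = ?V * t * iv ?V"
      by (rule coords_inject[rotated 2]) (use N t in simp_all)
    thus "?g * \<sigma> k * t * iv (?g * \<sigma> k) = \<sigma> i * ?g * t * iv (\<sigma> i * ?g)" using gk by simp
  qed (use g ik in simp_all)
  then obtain s where s: "s \<in> T" "?g * \<sigma> k = s * (\<sigma> i * ?g)" by blast
  \<comment> \<open>Conjugation by \<open>?g\<close> carries the root of \<open>k\<close> to that of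
    \<open>i\<close>, hence one \<sigma> to the other up to a value of the coroot of
    \<open>i\<close>.\<close>
  have "chi D (sr k) (iv ?g * t * ?g) = chi D (sr i) t" if "t \<in> T" for t
    using chi_conj_wd[OF Q \<sigma>_simple_refl that] root by simp
  then obtain c where "c \<noteq> 0" "?g * sigma D (sr k) = coroot D (sr i) c * (sigma D (sr i) * ?g)"
    using conj_sigma[OF g simple_root_in_roots[OF ik(2)] simple_root_in_roots[OF ik(1)] _ s(1)] s(2)
    by (auto simp: sigma_simple_def rank)
  thus thesis using that gk by (simp add: sigma_simple_def rank)
qed

lemma braid_of_halves:
  assumes "i \<in> {1..n}" "j \<in> {1..n}" "i < j" "a \<noteq> 0" "b \<noteq> 0" "C \<in> N" "C' \<in> N"
    and C': "C' = coroot D (sr i) a * C" and C: "C = coroot D (sr j) b * C'"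
  shows "C = C'"
proof -
  let ?A = "coroot D (sr i) a" and ?B = "coroot D (sr j) b"
  have T: "?A \<in> T" "?B \<in> T" using assms(4,5) coroot_in_T by simp_all
  have "?B * (?A * C) = C" unfolding C'[symmetric] by (rule C[symmetric])
  hence "?B * ?A * C = 1\<^sub>m m * C" using T assms(6) by (simp add: GL.m_assoc)
  hence "?B * ?A = 1\<^sub>m m" using GL.right_cancel[of C "?B * ?A" "1\<^sub>m m"] T assms(6) by simp
  \<comment> \<open>As \<open>i < j\<close>, position \<open>i\<close> lies outside the support of
    the root of \<open>j\<close>: \<open>?B\<close> has coordinate 1 there, and \<open>?A\<close>
    has \<open>a\<close>.\<close>
  hence "coords ?B i * coords ?A i = 1" using coords_mult[OF T(2,1), of i] by simp
  hence a: "a = 1"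
    using assms(1-5) by (simp add: coords_coroot) (simp add: simple_root_def)
  have "coords ?A k = coords (1\<^sub>m m) k" for k
    using assms(1) by (simp add: coords_coroot a)
  hence "?A = 1\<^sub>m m" using coords_inject[OF T(1) T_one] by blast
  thus ?thesis using C' assms(6) by simp
qed

text \<open>In each half, \<open>Q\<close> is one side of the relation without its last letter, and
  it carries the simple root of that letter to the one of the first letter of the other side.
  Exchanging the sides gives the second half and with it the second coroot.\<close>

lemma braid_\<sigma>:
  assumes "braid n c c'"
  shows "wd \<sigma> c = wd \<sigma> c'"
  using assms
proof cases
  case (far i j)
  obtain a where a: "a \<noteq> 0" "wd \<sigma> ([j] @ [i]) = coroot D (sr i) a * wd \<sigma> (i # [j])"
    by (rule half_braid[of i i "[j]"])
      (use far in \<open>auto simp: reflect_def transpose_def simple_root_def fun_eq_iff\<close>)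
  obtain b where b: "b \<noteq> 0" "wd \<sigma> ([i] @ [j]) = coroot D (sr j) b * wd \<sigma> (j # [i])"
    by (rule half_braid[of j j "[i]"])
      (use far in \<open>auto simp: reflect_def transpose_def simple_root_def fun_eq_iff\<close>)
  have "wd \<sigma> [i, j] = wd \<sigma> [j, i]"
    by (rule braid_of_halves[OF _ _ _ a(1) b(1) wd_N[where f = \<sigma>, OF _ \<sigma>_N] wd_N[where f = \<sigma>, OF _ \<sigma>_N]
          a(2)[unfolded append.simps] b(2)[unfolded append.simps]])
      (use far in simp_all)
  thus ?thesis using far by simp
next
  case (long i)
  let ?j = "Suc i"
  obtain a where a: "a \<noteq> 0" "wd \<sigma> ([?j, i] @ [?j]) = coroot D (sr i) a * wd \<sigma> (i # [?j, i])"
    by (rule half_braid[of i ?j "[?j, i]"])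
      (use long in \<open>auto simp: reflect_def transpose_def simple_root_def fun_eq_iff\<close>)
  obtain b where b: "b \<noteq> 0" "wd \<sigma> ([i, ?j] @ [i]) = coroot D (sr ?j) b * wd \<sigma> (?j # [i, ?j])"
    by (rule half_braid[of ?j i "[i, ?j]"])
      (use long in \<open>auto simp: reflect_def transpose_def simple_root_def fun_eq_iff\<close>)
  have "wd \<sigma> [i, ?j, i] = wd \<sigma> [?j, i, ?j]"
    by (rule braid_of_halves[OF _ _ _ a(1) b(1) wd_N[where f = \<sigma>, OF _ \<sigma>_N] wd_N[where f = \<sigma>, OF _ \<sigma>_N]
          a(2)[unfolded append.simps] b(2)[unfolded append.simps]])
      (use long in simp_all)
  thus ?thesis using long by simp
next
  case (short i)
  obtain a where a: "a \<noteq> 0" "wd \<sigma> ([n, i, n] @ [i]) = coroot D (sr i) a * wd \<sigma> (i # [n, i, n])"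
    by (rule half_braid[of i i "[n, i, n]"])
      (use short in \<open>auto simp: reflect_def transpose_def simple_root_def fun_eq_iff\<close>)
  obtain b where b: "b \<noteq> 0" "wd \<sigma> ([i, n, i] @ [n]) = coroot D (sr n) b * wd \<sigma> (n # [i, n, i])"
    by (rule half_braid[of n n "[i, n, i]"])
      (use short in \<open>auto simp: reflect_def transpose_def simple_root_def fun_eq_iff\<close>)
  have "wd \<sigma> [i, n, i, n] = wd \<sigma> [n, i, n, i]"
    by (rule braid_of_halves[OF _ _ _ a(1) b(1) wd_N[where f = \<sigma>, OF _ \<sigma>_N] wd_N[where f = \<sigma>, OF _ \<sigma>_N]
          a(2)[unfolded append.simps] b(2)[unfolded append.simps]])
      (use short in simp_all)
  thus ?thesis using short by simp
qed


subsection \<open>The Weyl group as the group of signed permutations\<close>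

definition unit :: "nat \<Rightarrow> nat \<Rightarrow> int" where
  "unit i = (\<lambda>k. if k = i then 1 else 0)"

lemma dotp_unit: "i \<in> {1..n} \<Longrightarrow> dotp n v (unit i) = v i"
  by (simp add: dotp_def unit_def if_distrib cong: if_cong)

lemma unit_lattice: "i \<in> {1..n} \<Longrightarrow> unit i \<in> lattice_vecs n"
  by (auto simp: unit_def lattice_vecs_def)

lemma chi_unit: "i \<in> {1..n} \<Longrightarrow> chi D (unit i) t = coords t i"
  by (simp add: chi_coords unit_def if_distrib cong: if_cong)

text \<open>Conjugation preserves the additive relations between roots. As \<open>e\<^sub>i + e\<^sub>j\<close> and \<open>e\<^sub>i - e\<^sub>j\<close>
  are roots, so are the sum and the difference of the images of \<open>e\<^sub>i\<close> and \<open>e\<^sub>j\<close>; by the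
  parallelogram law, these images are short and orthogonal.\<close>

lemma conj_unit_roots:
  assumes g: "g \<in> N"
  obtains w where "\<And>i. i \<in> {1..n} \<Longrightarrow> w i \<in> B_roots n"
    "\<And>i t. i \<in> {1..n} \<Longrightarrow> t \<in> T \<Longrightarrow> coords (iv g * t * g) i = chi D (w i) t"
    "\<And>i. i \<in> {1..n} \<Longrightarrow> dotp n (w i) (w i) = 1"
    "\<And>i j. i \<in> {1..n} \<Longrightarrow> j \<in> {1..n} \<Longrightarrow> i \<noteq> j \<Longrightarrow> dotp n (w i) (w j) = 0"
proof -
  have "\<exists>w. i \<in> {1..n} \<longrightarrow> w \<in> B_roots n \<and> (\<forall>t\<in>T. chi D (unit i) (iv g * t * g) = chi D w t)" for i
  proof (cases "i \<in> {1..n}")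
    case True
    hence "unit i \<in> B_roots n"
      by (simp add: B_roots_def unit_lattice dotp_unit) (simp add: unit_def)
    thus ?thesis using conj_root[OF g] by metis
  qed blast
  then obtain w where w: "\<And>i. i \<in> {1..n} \<Longrightarrow> w i \<in> B_roots n"
      "\<And>i t. i \<in> {1..n} \<Longrightarrow> t \<in> T \<Longrightarrow> chi D (unit i) (iv g * t * g) = chi D (w i) t"
    by metis
  have ij: "dotp n (w i) (w i) = 1 \<and> dotp n (w i) (w j) = 0"
    if "i \<in> {1..n}" "j \<in> {1..n}" "i \<noteq> j" for i j
  proof -
    have wij: "w i \<in> lattice_vecs n" "w j \<in> lattice_vecs n"
      using w(1) that by (simp_all add: B_roots_def)
    have "dotp n (\<lambda>k. unit i k + unit j k) x = x i + x j" for x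
      unfolding dotp_add dotp_uminus using dotp_unit dotp_commute that by simp
    hence "(\<lambda>k. unit i k + unit j k) \<in> B_roots n"
      using that unit_lattice[OF that(1)] unit_lattice[OF that(2)]
      by (simp add: B_roots_def lattice_vecs_def unit_def)
    then obtain p where p: "p \<in> B_roots n"
        "\<And>t. t \<in> T \<Longrightarrow> chi D (\<lambda>k. unit i k + unit j k) (iv g * t * g) = chi D p t"
      using conj_root[OF g] by blast
    have "chi D p t = chi D (\<lambda>k. w i k + w j k) t" if "t \<in> T" for t
      unfolding p(2)[OF that, symmetric] chi_add[OF conj_T'[OF g that]] chi_add[OF that]
      using w(2) that \<open>i \<in> {1..n}\<close> \<open>j \<in> {1..n}\<close> by simp
    hence p': "p = (\<lambda>k. w i k + w j k)"
      by (intro chi_faithful) (use p(1) wij in \<open>auto simp: B_roots_def lattice_vecs_def\<close>)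
    have "dotp n (\<lambda>k. unit i k + - unit j k) x = x i - x j" for x
      unfolding dotp_add dotp_uminus using dotp_unit dotp_commute that by simp
    hence "(\<lambda>k. unit i k + - unit j k) \<in> B_roots n"
      using that unit_lattice[OF that(1)] unit_lattice[OF that(2)]
      by (simp add: B_roots_def lattice_vecs_def unit_def)
    then obtain q where q: "q \<in> B_roots n"
        "\<And>t. t \<in> T \<Longrightarrow> chi D (\<lambda>k. unit i k + - unit j k) (iv g * t * g) = chi D q t"
      using conj_root[OF g] by blast
    have "chi D q t = chi D (\<lambda>k. w i k + - w j k) t" if "t \<in> T" for t
      unfolding q(2)[OF that, symmetric] chi_add[OF conj_T'[OF g that]] chi_add[OF that]
        chi_uminus[OF conj_T'[OF g that]] chi_uminus[OF that]
      using w(2) that \<open>i \<in> {1..n}\<close> \<open>j \<in> {1..n}\<close> by simp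
    hence q': "q = (\<lambda>k. w i k + - w j k)"
      by (intro chi_faithful) (use q(1) wij in \<open>auto simp: B_roots_def lattice_vecs_def\<close>)
    have "dotp n p p = dotp n (w i) (w i) + dotp n (w j) (w j) + 2 * dotp n (w i) (w j)"
      unfolding p' by (simp add: dotp_def algebra_simps sum.distrib sum_distrib_left)
    moreover have "dotp n q q = dotp n (w i) (w i) + dotp n (w j) (w j) - 2 * dotp n (w i) (w j)"
      unfolding q' by (simp add: dotp_def algebra_simps sum.distrib sum_subtractf sum_distrib_left sum_negf)
    moreover have "dotp n v v = 1 \<or> dotp n v v = 2" if "v \<in> {p, q, w i, w j}" for v
      using that p(1) q(1) w(1) \<open>i \<in> {1..n}\<close> \<open>j \<in> {1..n}\<close> by (auto simp: B_roots_def)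
    hence "dotp n p p = 1 \<or> dotp n p p = 2" "dotp n q q = 1 \<or> dotp n q q = 2"
      "dotp n (w i) (w i) = 1 \<or> dotp n (w i) (w i) = 2" "dotp n (w j) (w j) = 1 \<or> dotp n (w j) (w j) = 2"
      by blast+
    \<comment> \<open>The squared lengths of \<open>p\<close> and \<open>q\<close> add up to twice
      those of \<open>w i\<close> and \<open>w j\<close>. The one total is at most 4 and the other
      at least 4, so \<open>w i\<close> and \<open>w j\<close> have length 1, \<open>p\<close> and
      \<open>q\<close> have squared length 2, and the inner product vanishes.\<close>
    ultimately show ?thesis by presburger
  qed
  moreover have "dotp n (w i) (w i) = 1" if "i \<in> {1..n}" for i
    using ij[OF that, of "if i = 1 then 2 else 1"] rank by auto
  ultimately show thesis using that[of w] w by (simp add: chi_unit)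
qed

text \<open>Orthogonal short roots are signed unit vectors at distinct positions, so
  \<open>g\<close> acts as a signed permutation, and \<open>x\<close> is the image of rho. The
  entries of rho are positive and distinct; if \<open>x = rho n\<close>, the permutation is the
  identity and \<open>g\<close> centralizes T.\<close>

lemma N_state:
  assumes g: "g \<in> N"
  obtains x where "x \<in> states n" "\<And>t. t \<in> T \<Longrightarrow> chi D (rho n) (iv g * t * g) = chi D x t"
    "x = rho n \<Longrightarrow> g \<in> T"
proof -
  obtain w where w: "\<And>i. i \<in> {1..n} \<Longrightarrow> w i \<in> B_roots n"
    "\<And>i t. i \<in> {1..n} \<Longrightarrow> t \<in> T \<Longrightarrow> coords (iv g * t * g) i = chi D (w i) t"
    "\<And>i. i \<in> {1..n} \<Longrightarrow> dotp n (w i) (w i) = 1"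
    "\<And>i j. i \<in> {1..n} \<Longrightarrow> j \<in> {1..n} \<Longrightarrow> i \<noteq> j \<Longrightarrow> dotp n (w i) (w j) = 0"
    using conj_unit_roots[OF g] by blast
  have "\<exists>p. i \<in> {1..n} \<longrightarrow> p \<in> {1..n} \<and> w i p \<in> {-1, 1} \<and> (\<forall>k. k \<noteq> p \<longrightarrow> w i k = 0) \<and>
      (\<forall>x. dotp n x (w i) = x p * w i p)" for i
  proof (cases "i \<in> {1..n}")
    case True
    show ?thesis using w(1)[OF True]
    proof (cases rule: root_cases)
      case (one p)
      thus ?thesis by (intro exI[of _ p]) blast
    next
      case (two j k)
      thus ?thesis using w(3)[OF True] by simp
    qed
  qed blast
  then obtain p where p: "\<And>i. i \<in> {1..n} \<Longrightarrow> p i \<in> {1..n}"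
      "\<And>i. i \<in> {1..n} \<Longrightarrow> w i (p i) \<in> {-1, 1}"
      "\<And>i k. i \<in> {1..n} \<Longrightarrow> k \<noteq> p i \<Longrightarrow> w i k = 0"
      "\<And>i x. i \<in> {1..n} \<Longrightarrow> dotp n x (w i) = x (p i) * w i (p i)"
    by metis
  have inj: "inj_on p {1..n}"
  proof (rule inj_onI, rule ccontr)
    fix i j assume ij: "i \<in> {1..n}" "j \<in> {1..n}" "p i = p j" "i \<noteq> j"
    hence "w i (p i) * w j (p j) = 0" using w(4)[of i j] p(4)[OF ij(2), of "w i"] by simp
    thus False using p(2)[OF ij(1)] p(2)[OF ij(2)] by auto
  qed
  have bij: "bij_betw p {1..n} {1..n}"
  proof -
    have "p ` {1..n} = {1..n}" by (rule endo_inj_surj) (use inj p(1) in auto)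
    thus ?thesis using inj by (simp add: bij_betw_def)
  qed
  have surj: "\<exists>i\<in>{1..n}. k = p i" if "k \<in> {1..n}" for k
  proof -
    have "k \<in> p ` {1..n}" using that bij_betw_imp_surj_on[OF bij] by simp
    thus ?thesis unfolding image_iff .
  qed
  define x where "x k = (if k \<in> {1..n} then rho n (inv_into {1..n} p k) * w (inv_into {1..n} p k) k else 0)" for k
  have xp: "x (p i) = rho n i * w i (p i)" if "i \<in> {1..n}" for i
    using that p(1) inj by (simp add: x_def)
  have cp: "coords (iv g * t * g) i = coords t (p i) powi w i (p i)" if "i \<in> {1..n}" "t \<in> T" for i t
  proof -
    have "chi D (w i) t = (\<Prod>k=1..n. if k = p i then coords t (p i) powi w i (p i) else 1)"
      unfolding chi_coords using p(3)[OF that(1)] by (intro prod.cong) auto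
    thus ?thesis using w(2)[OF that] p(1)[OF that(1)] by simp
  qed
  show thesis
  proof (rule that[of x])
    have abs: "\<bar>x (p i)\<bar> = rho n i" if "i \<in> {1..n}" for i
      using p(2)[OF that] that by (auto simp: xp rho_def abs_mult)
    have "\<bar>x k\<bar> \<in> {1..int n}" if k: "k \<in> {1..n}" for k
    proof -
      obtain i where "i \<in> {1..n}" "k = p i" using surj[OF k] by blast
      moreover have "rho n i \<in> {1..int n}" using \<open>i \<in> {1..n}\<close> by (simp add: rho_def)
      ultimately show ?thesis using abs[of i] by simp
    qed
    moreover have "inj_on (\<lambda>k. \<bar>x k\<bar>) {1..n}"
    proof (rule inj_onI)
      fix k l assume kl: "k \<in> {1..n}" "l \<in> {1..n}" "\<bar>x k\<bar> = \<bar>x l\<bar>"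
      obtain i j where ij: "i \<in> {1..n}" "k = p i" "j \<in> {1..n}" "l = p j"
        using surj[OF kl(1)] surj[OF kl(2)] by blast
      hence "rho n i = rho n j" using kl(3) abs[OF ij(1)] abs[OF ij(3)] by simp
      thus "k = l" using ij by (simp add: rho_def)
    qed
    moreover have "x \<in> lattice_vecs n" by (simp add: lattice_vecs_def x_def)
    ultimately show "x \<in> states n" unfolding states_def by blast
  next
    fix t assume t: "t \<in> T"
    have "chi D (rho n) (iv g * t * g) = (\<Prod>i=1..n. coords t (p i) powi x (p i))"
      unfolding chi_coords
    proof (intro prod.cong refl)
      fix i assume i: "i \<in> {1..n}"
      show "coords (iv g * t * g) i powi rho n i = coords t (p i) powi x (p i)"
        unfolding cp[OF i t] xp[OF i] mult.commute[of "rho n i"] power_int_mult ..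
    qed
    thus "chi D (rho n) (iv g * t * g) = chi D x t"
      unfolding chi_coords using prod.reindex_bij_betw[OF bij, of "\<lambda>k. coords t k powi x k"] by simp
  next
    assume x: "x = rho n"
    have fixed: "p i = i \<and> w i (p i) = 1" if i: "i \<in> {1..n}" for i
    proof -
      have "rho n (p i) = rho n i * w i (p i)" using xp[OF i] x by simp
      moreover have "rho n (p i) > 0" "rho n i > 0" using i p(1)[OF i] by (auto simp: rho_def)
      moreover have "w i (p i) = 1 \<or> w i (p i) = - 1" using p(2)[OF i] by auto
      ultimately have "w i (p i) = 1" "rho n (p i) = rho n i" by auto
      thus ?thesis using i p(1)[OF i] by (auto simp: rho_def)
    qed
    show "g \<in> T"
    proof (rule T_of_centralizing[OF g])
      fix t assume t: "t \<in> T"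
      have "coords (iv g * t * g) k = coords t k" for k
        using cp[OF _ t, of k] fixed[of k] coords_outside by (cases "k \<in> {1..n}") auto
      hence "iv g * t * g = t" using coords_inject[of "iv g * t * g" t] g t by auto
      hence "g * (iv g * t * g) * iv g = g * t * iv g" by simp
      thus "g * t * iv g = t" using g t by (simp add: GL.m_assoc)
    qed
  qed
qed

abbreviation st :: "nat list \<Rightarrow> nat \<Rightarrow> int" where
  "st ws \<equiv> reflects uminus n ws (rho n)"

lemma st_states: "set ws \<subseteq> {1..n} \<Longrightarrow> st ws \<in> states n"
  using moves_state rho_state by blast

text \<open>Dividing \<open>g\<close> by the word gives an element that fixes rho and so lies in T;
  normality of T moves it to the left.\<close>

lemma in_T_if_same_state:
  assumes g: "g \<in> N" and ws: "set ws \<subseteq> {1..n}" and f: "\<And>i. i \<in> {1..n} \<Longrightarrow> f i \<in> simple_refl D i"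
    and eq: "\<And>t. t \<in> T \<Longrightarrow> chi D (rho n) (iv g * t * g) = chi D (st ws) t"
  shows "\<exists>s\<in>T. g = s * wd f ws"
proof -
  let ?W = "wd f ws"
  have fN: "f i \<in> N" if "i \<in> {1..n}" for i using simple_refl_N f that by blast
  have W: "?W \<in> N" by (rule wd_N[where f = f, OF ws fN])
  let ?h = "iv ?W * g"
  have h: "?h \<in> N" using W g by simp
  obtain x where x: "x \<in> states n" "\<And>t. t \<in> T \<Longrightarrow> chi D (rho n) (iv ?h * t * ?h) = chi D x t"
      "x = rho n \<Longrightarrow> ?h \<in> T"
    using N_state[OF h] by blast
  have "chi D x t = chi D (rho n) t" if t: "t \<in> T" for t
  proof -
    let ?s = "?W * t * iv ?W"
    have s: "?s \<in> T" using W t by simp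
    have "iv ?h * t * ?h = iv g * ?s * g"
      using W g t by (simp add: GL.inv_mult_group GL.m_assoc)
    hence "chi D x t = chi D (st ws) ?s" using x(2)[OF t] eq[OF s] by simp
    also have "\<dots> = chi D (rho n) (iv ?W * ?s * ?W)" using chi_conj_wd[OF ws f s] by simp
    also have "iv ?W * ?s * ?W = t" using W t by (simp add: GL.m_assoc)
    finally show ?thesis .
  qed
  hence "x = rho n"
    using x(1) rho_state by (intro chi_faithful) (auto simp: states_def)
  hence hT: "?h \<in> T" by (rule x(3))
  have "g = (?W * ?h * iv ?W) * ?W" using W g by (simp add: GL.m_assoc)
  thus ?thesis using conj_T[OF W hT] by blast
qed

lemma N_generated:
  assumes g: "g \<in> N" and f: "\<And>i. i \<in> {1..n} \<Longrightarrow> f i \<in> simple_refl D i"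
  obtains ws s where "set ws \<subseteq> {1..n}" "length ws = len n (st ws)" "s \<in> T" "g = s * wd f ws"
proof -
  obtain x where x: "x \<in> states n" "\<And>t. t \<in> T \<Longrightarrow> chi D (rho n) (iv g * t * g) = chi D x t"
    using N_state[OF g] by blast
  obtain ws where ws: "set ws \<subseteq> {1..n}" "st ws = x" "length ws = len n x"
    using state_word[OF x(1)] by blast
  have "\<exists>s\<in>T. g = s * wd f ws"
    by (rule in_T_if_same_state[OF g ws(1) f]) (use x(2) ws(2) in auto)
  thus thesis using that ws by blast
qed

lemma proj_wd_eq_iff:
  assumes us: "set us \<subseteq> {1..n}" and vs: "set vs \<subseteq> {1..n}"
    and f: "\<And>i. i \<in> {1..n} \<Longrightarrow> f i \<in> simple_refl D i"
  shows "proj D (wd f us) = proj D (wd f vs) \<longleftrightarrow> st us = st vs"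
proof -
  have fN: "f i \<in> N" if "i \<in> {1..n}" for i using simple_refl_N f that by blast
  have N: "wd f us \<in> N" "wd f vs \<in> N" by (rule wd_N[where f = f, OF us fN] wd_N[where f = f, OF vs fN], assumption)+
  have "(\<exists>s\<in>T. wd f us = s * wd f vs) \<longleftrightarrow> st us = st vs"
  proof
    assume "\<exists>s\<in>T. wd f us = s * wd f vs"
    then obtain s where s: "s \<in> T" "wd f us = s * wd f vs" by blast
    show "st us = st vs"
    proof (rule chi_faithful)
      fix t assume t: "t \<in> T"
      have "iv s * t * s = t" using s(1) t T_comm[OF t s(1)] by (simp add: GL.m_assoc)
      moreover have "iv (s * wd f vs) * t * (s * wd f vs) = iv (wd f vs) * (iv s * t * s) * wd f vs"
        using s(1) N t by (simp add: GL.inv_mult_group GL.m_assoc)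
      ultimately show "chi D (st us) t = chi D (st vs) t"
        using chi_conj_wd[OF us f t, of "rho n"] chi_conj_wd[OF vs f t, of "rho n"] s(2) by simp
    qed (use st_states[OF us] st_states[OF vs] in \<open>auto simp: states_def\<close>)
  next
    assume "st us = st vs"
    thus "\<exists>s\<in>T. wd f us = s * wd f vs"
      by (intro in_T_if_same_state[OF N(1) vs f]) (use chi_conj_wd[OF us f] in auto)
  qed
  thus ?thesis using proj_eq_iff[OF N] by simp
qed

lemma carrier_weyl: "carrier (weyl D) = proj D ` N"
  by (simp add: weyl_def carrier_FactGroup proj_def)

lemma mult_weyl: "g \<in> N \<Longrightarrow> h \<in> N \<Longrightarrow> proj D g \<otimes>\<^bsub>weyl D\<^esub> proj D h = proj D (g * h)"
  using TN.rcos_sum[of g h] by (simp add: weyl_def proj_def)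

lemma one_weyl: "one (weyl D) = proj D (1\<^sub>m m)"
  by (auto simp: weyl_def proj_eq image_iff)

lemma proj_simple_refl: "i \<in> {1..n} \<Longrightarrow> g \<in> simple_refl D i \<Longrightarrow> proj D g = simple_refl D i"
  using simple_refl_N[of i g] \<sigma>_N[of i] by (auto simp: simple_refl_eq proj_eq_iff) (auto simp: proj_eq)

lemma weyl_word_wd:
  assumes "set ws \<subseteq> {1..n}" "\<And>i. i \<in> {1..n} \<Longrightarrow> f i \<in> simple_refl D i"
  shows "weyl_word D ws = proj D (wd f ws)"
  using assms(1)
proof (induction ws)
  case Nil
  thus ?case by (simp add: weyl_word_def one_weyl)
next
  case (Cons i ws)
  have fN: "f i \<in> N" if "i \<in> {1..n}" for i using simple_refl_N assms(2) that by blast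
  have "wd f ws \<in> N" using Cons.prems wd_N[of ws f] fN by auto
  thus ?case
    using Cons fN[of i] mult_weyl[of "f i" "wd f ws"] proj_simple_refl[OF _ assms(2)]
    by (simp add: weyl_word_def)
qed

lemma weyl_word_eq_iff:
  assumes "set us \<subseteq> {1..n}" "set vs \<subseteq> {1..n}"
  shows "weyl_word D us = weyl_word D vs \<longleftrightarrow> st us = st vs"
  using proj_wd_eq_iff[OF assms \<sigma>_simple_refl] weyl_word_wd[OF assms(1) \<sigma>_simple_refl]
    weyl_word_wd[OF assms(2) \<sigma>_simple_refl] by simp

text \<open>No word is shorter than the length of its state and some word attains it, so minimality
  among all words for the same Weyl element is equality with \<open>len\<close>.\<close>

lemma reduced_word_iff:
  "reduced_word D ws \<longleftrightarrow> set ws \<subseteq> {1..n} \<and> length ws = len n (st ws)"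
proof (cases "set ws \<subseteq> {1..n}")
  case True
  obtain vs where vs: "set vs \<subseteq> {1..n}" "st vs = st ws" "length vs = len n (st ws)"
    using state_word[OF st_states[OF True]] by blast
  have le: "len n (st us) \<le> length us" if "set us \<subseteq> {1..n}" for us
    using len_moves_le[OF that rho_state] by simp
  show ?thesis
  proof
    assume "reduced_word D ws"
    hence "length ws \<le> length vs"
      using vs(1,2) weyl_word_eq_iff[OF vs(1) True] unfolding reduced_word_def rank by blast
    thus "set ws \<subseteq> {1..n} \<and> length ws = len n (st ws)" using vs(3) le[OF True] True by simp
  next
    assume "set ws \<subseteq> {1..n} \<and> length ws = len n (st ws)"
    thus "reduced_word D ws"
      unfolding reduced_word_def rank
    proof (intro conjI allI impI True)
      fix js
      assume a: "set ws \<subseteq> {1..n} \<and> length ws = len n (st ws)"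
        and js: "set js \<subseteq> {1..n}" "weyl_word D js = weyl_word D ws"
      hence "st js = st ws" using weyl_word_eq_iff[OF js(1) True] by simp
      thus "length ws \<le> length js" using le[OF js(1)] a by simp
    qed
  qed
qed (simp add: reduced_word_def rank)

lemma weyl_reduced:
  assumes "w \<in> carrier (weyl D)"
  obtains ws where "reduced_word D ws" "weyl_word D ws = w"
proof -
  obtain g where g: "g \<in> N" "w = proj D g" using assms by (auto simp: carrier_weyl)
  obtain ws s where ws: "set ws \<subseteq> {1..n}" "length ws = len n (st ws)" "s \<in> T" "g = s * wd \<sigma> ws"
    using N_generated[OF g(1) \<sigma>_simple_refl] by blast
  have "proj D g = proj D (wd \<sigma> ws)"
    using proj_eq_iff[OF g(1) wd_N[where f = \<sigma>, OF ws(1) \<sigma>_N]] ws by blast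
  thus thesis using that ws g weyl_word_wd[OF ws(1) \<sigma>_simple_refl] reduced_word_iff by simp
qed

end


section \<open>Solving the braid relations\<close>

text \<open>If \<open>Y i\<close> are the coordinates of \<open>t\<^sub>i\<close>, then \<open>twist n Y ws\<close> are those of the torus part of
  the product of the elements \<open>t\<^sub>i \<sigma>\<^sub>i\<close> along \<open>ws\<close>.\<close>

definition twist :: "nat \<Rightarrow> (nat \<Rightarrow> nat \<Rightarrow> 'b::field) \<Rightarrow> nat list \<Rightarrow> nat \<Rightarrow> 'b" where
  "twist n Y ws = foldr (\<lambda>i y k. Y i k * reflect inverse n i y k) ws (\<lambda>k. 1)"

lemma twist_simps [simp]:
  "twist n Y [] k = 1"
  "twist n Y (i # ws) k = Y i k * reflect inverse n i (twist n Y ws) k"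
  by (simp_all add: twist_def)

definition section_shape :: "nat \<Rightarrow> (nat \<Rightarrow> nat \<Rightarrow> 'b::field) \<Rightarrow> 'b \<Rightarrow> 'b \<Rightarrow> 'b \<Rightarrow> bool" where
  "section_shape n Y \<epsilon> \<mu> p \<longleftrightarrow> \<epsilon> * \<epsilon> = 1 \<and> \<mu> * \<mu> = 1 \<and> p * p = 1 \<and>
     (\<forall>i k. 1 \<le> i \<longrightarrow> i < n \<longrightarrow> 1 \<le> k \<longrightarrow> k \<le> n \<longrightarrow> k \<noteq> i \<longrightarrow> k \<noteq> Suc i \<longrightarrow> Y i k = \<epsilon>) \<and>
     (\<forall>i. 1 \<le> i \<longrightarrow> i < n \<longrightarrow> Y i i * Y i (Suc i) = \<mu>) \<and>
     (\<forall>k. 1 \<le> k \<longrightarrow> k < n \<longrightarrow> Y n k = p)"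

text \<open>For commuting letters, the torus part of each divided by its reflection under the other
  gives two equal vectors with disjoint supports. Hence each torus part is fixed by the other
  reflection, which yields constancy to the right and left of the free pair (\<open>a\<close>,
  \<open>b\<close>) and a sign at \<open>n\<close> (\<open>c\<close>). The long relations link
  neighbouring nodes (\<open>d1\<close>, \<open>d2\<close>, \<open>d3\<close>), and the short one
  gives the remaining signs (\<open>e1\<close>, \<open>e2\<close>).\<close>

lemma section_shape_of_braid:
  fixes Y :: "nat \<Rightarrow> nat \<Rightarrow> 'b::field"
  assumes n: "n \<ge> 4" and nz: "\<And>i k. Y i k \<noteq> 0"
    and braid: "\<And>c c' k. braid n c c' \<Longrightarrow> twist n Y c k = twist n Y c' k"
  shows "section_shape n Y (Y 1 n) (Y 1 1 * Y 1 2) (Y n (n - 1))"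
proof -
  let ?\<epsilon> = "Y 1 n" and ?p = "Y n (n - 1)"
  have a: "Y i j = Y i (Suc j)" if "1 \<le> i" "Suc i < j" "j < n" for i j
    using braid[OF braid.far[of i j n], of j] that nz by (simp add: reflect_apply transpose_def)
  have b: "Y j (Suc i) = Y j i" if "1 \<le> i" "Suc i < j" "j \<le> n" for i j
    using braid[OF braid.far[of i j n], of i] that nz
    by (cases "j < n") (simp_all add: reflect_apply transpose_def)
  have c: "Y i n * Y i n = 1" if "1 \<le> i" "Suc i < n" for i
    using braid[OF braid.far[of i n n], of n] that nz[of i n] nz[of n n]
    by (simp add: reflect_apply transpose_def field_simps)
  have d1: "Y i k = Y (Suc i) k" if "1 \<le> i" "Suc i < n" "k \<noteq> i" "k \<noteq> Suc i" "k \<noteq> Suc (Suc i)" for i k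
    using braid[OF braid.long[of i n], of k] that nz by (simp add: reflect_apply transpose_def)
  have d2: "Y i (Suc (Suc i)) = Y (Suc i) i" if "1 \<le> i" "Suc i < n" for i
    using braid[OF braid.long[of i n], of i] that nz by (simp add: reflect_apply transpose_def)
  have d3: "Y i (Suc i) * Y (Suc i) i * Y i i =
      Y (Suc i) (Suc i) * Y (Suc i) (Suc (Suc i)) * Y i (Suc (Suc i))" if "1 \<le> i" "Suc i < n" for i
    using braid[OF braid.long[of i n], of "Suc i"] that nz
    by (simp add: reflect_apply transpose_def algebra_simps)
  obtain l where l: "n = Suc l" "1 \<le> l" using n by (cases n) auto
  have e1: "Y n l * Y n l = 1"
    using braid[OF braid.short[of l n], of l] l nz[of l l] nz[of l n] nz[of n l] nz[of n n]
    by (simp add: reflect_apply transpose_def field_simps)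
  have e2: "(Y l l * Y l n) * (Y l l * Y l n) = 1"
  proof -
    have "(Y l l * Y l n) * (Y l l * Y l n) * (Y n l * Y n l) = 1"
      using braid[OF braid.short[of l n], of n] l nz[of l l] nz[of l n] nz[of n l] nz[of n n]
      by (simp add: reflect_apply transpose_def field_simps)
    thus ?thesis using e1 by simp
  qed
  have \<epsilon>\<epsilon>: "?\<epsilon> * ?\<epsilon> = 1" using c[of 1] n by simp
  have last: "Y i n = ?\<epsilon>" if "1 \<le> i" "Suc i < n" for i
    using that
  proof (induction i rule: dec_induct)
    case (step i)
    thus ?case using d1[of i n] by simp
  qed simp
  have right: "Y i k = ?\<epsilon>" if "1 \<le> i" "Suc i < k" "k \<le> n" for i k
    using that(3,2)
  proof (induction k rule: inc_induct)
    case base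
    thus ?case using last[OF that(1)] by simp
  next
    case (step k)
    thus ?case using a[of i k] that(1) by simp
  qed
  have left': "Y (Suc i) i = ?\<epsilon>" if "1 \<le> i" "Suc i < n" for i
    using d2[of i] right[of i "Suc (Suc i)"] that by simp
  have left: "Y (Suc j) k = Y (Suc j) j" if "1 \<le> k" "k \<le> j" "Suc j \<le> n" for k j
    using that(2,1)
  proof (induction k rule: inc_induct)
    case (step k)
    thus ?case using b[of k "Suc j"] that(3) by simp
  qed simp
  have \<mu>: "Y i i * Y i (Suc i) = Y 1 1 * Y 1 2" if "1 \<le> i" "i < n" for i
    using that
  proof (induction i rule: dec_induct)
    case base
    show ?case by (simp add: numeral_2_eq_2)
  next
    case (step i)
    \<comment> \<open>Both outer factors in \<open>d3\<close> equal \<epsilon>, so they cancel and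
      the product of the free pair passes on to the next node.\<close>
    have "Y i (Suc i) * ?\<epsilon> * Y i i = Y (Suc i) (Suc i) * Y (Suc i) (Suc (Suc i)) * ?\<epsilon>"
      using d3[of i] left'[of i] right[of i "Suc (Suc i)"] step by simp
    hence "Y i i * Y i (Suc i) = Y (Suc i) (Suc i) * Y (Suc i) (Suc (Suc i))"
      using nz[of 1 n] by (simp add: algebra_simps)
    thus ?case using step by simp
  qed
  have off: "Y i k = ?\<epsilon>" if ik: "1 \<le> i" "i < n" "1 \<le> k" "k \<le> n" "k \<noteq> i" "k \<noteq> Suc i" for i k
  proof (cases "k < i")
    case True
    then obtain j where j: "i = Suc j" "k \<le> j" by (cases i) auto
    thus ?thesis using left[of k j] left'[of j] ik by simp
  next
    case False
    thus ?thesis using right[of i k] ik by simp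
  qed
  have "Y n k = ?p" if "1 \<le> k" "k < n" for k
    using left[of k l] that l by simp
  moreover have "(Y 1 1 * Y 1 2) * (Y 1 1 * Y 1 2) = 1" using \<mu>[of l] e2 l by simp
  moreover have "?p * ?p = 1" using e1 l by simp
  ultimately show ?thesis using \<epsilon>\<epsilon> off \<mu> unfolding section_shape_def by blast
qed

text \<open>The witness for \<mu> = -1, with the other two signs equal to 1: the minus sign sits at
  the first of the two free positions.\<close>

lemma twist_optimal:
  assumes "braid n c c'"
  shows "twist n (\<lambda>i k. if k = i \<and> i < n then - 1 else 1 :: 'b::field) c k =
    twist n (\<lambda>i k. if k = i \<and> i < n then - 1 else 1) c' k"
  using assms by cases (auto simp: reflect_apply transpose_def)


section \<open>Sections\<close>

context realized_B begin

lemma self_proj: "g \<in> N \<Longrightarrow> g \<in> proj D g"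
  by (auto simp: proj_eq image_iff intro!: bexI[of _ "1\<^sub>m m"])

lemma simple_refl_weyl: "i \<in> {1..n} \<Longrightarrow> simple_refl D i \<in> carrier (weyl D)"
  by (simp add: simple_refl_eq carrier_weyl)

lemma section_simple_refl:
  assumes "is_section D S" "i \<in> {1..n}"
  shows "S (simple_refl D i) \<in> simple_refl D i"
proof -
  have "proj D (S (simple_refl D i)) = simple_refl D i" "S (simple_refl D i) \<in> N"
    using assms simple_refl_weyl[OF assms(2)] unfolding is_section_def by blast+
  thus ?thesis using self_proj by blast
qed

abbreviation vals :: "('a mat set \<Rightarrow> 'a mat) \<Rightarrow> nat \<Rightarrow> 'a mat" where
  "vals S i \<equiv> S (simple_refl D i)"

lemma section_word: "is_section D S \<Longrightarrow> reduced_word D ws \<Longrightarrow> S (weyl_word D ws) = wd (vals S) ws"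
  by (simp add: is_section_def)

lemma section_eqI:
  assumes "is_section D S" "is_section D S'" "\<And>i. i \<in> {1..n} \<Longrightarrow> vals S i = vals S' i"
  shows "S = S'"
proof (rule PiE_ext)
  show "S \<in> carrier (weyl D) \<rightarrow>\<^sub>E N" "S' \<in> carrier (weyl D) \<rightarrow>\<^sub>E N"
    using assms by (simp_all add: is_section_def)
  fix w assume "w \<in> carrier (weyl D)"
  then obtain ws where ws: "reduced_word D ws" "weyl_word D ws = w" using weyl_reduced by blast
  have "wd (vals S) ws = wd (vals S') ws"
    using ws(1) assms(3) by (intro foldr_cong) (auto simp: reduced_word_def rank)
  thus "S w = S' w" using section_word[OF assms(1) ws(1)] section_word[OF assms(2) ws(1)] ws(2) by simp
qed

lemma reduced_braid:
  assumes "braid n c c'"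
  shows "reduced_word D c" "reduced_word D c'" "weyl_word D c = weyl_word D c'"
proof -
  have s: "set c \<subseteq> {1..n}" "set c' \<subseteq> {1..n}" using braid_set assms by blast+
  have eq: "st c = st c'" by (rule braid_reflects[OF _ assms]) simp
  have "dotp n (rho n) (sr i) > 0" if "i \<in> set c" for i
    using rho_simple_root[of i n] s(1) that by (simp add: subset_iff)
  hence "len n (st c) = length c" using len_braid[OF assms rho_state] by simp
  thus "reduced_word D c" "reduced_word D c'"
    using s eq braid_length[OF assms] by (simp_all add: reduced_word_iff)
  show "weyl_word D c = weyl_word D c'" using weyl_word_eq_iff[OF s] eq by simp
qed

lemma section_braid: "is_section D S \<Longrightarrow> braid n c c' \<Longrightarrow> wd (vals S) c = wd (vals S) c'"
  using reduced_braid section_word by metis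

text \<open>Matsumoto's theorem makes the value independent of the reduced word picked by
  \<open>SOME\<close>; words of length one return \<open>f\<close>.\<close>

lemma section_exists:
  assumes f: "\<And>i. i \<in> {1..n} \<Longrightarrow> f i \<in> simple_refl D i"
    and braid: "\<And>c c'. braid n c c' \<Longrightarrow> wd f c = wd f c'"
  obtains S where "is_section D S" "\<And>i. i \<in> {1..n} \<Longrightarrow> vals S i = f i"
proof -
  define S where "S = (\<lambda>w\<in>carrier (weyl D). wd f (SOME ws. reduced_word D ws \<and> weyl_word D ws = w))"
  have fN: "f i \<in> N" if "i \<in> {1..n}" for i using simple_refl_N f that by blast
  have S: "S (weyl_word D ws) = wd f ws" if ws: "reduced_word D ws" for ws
  proof -
    have s: "set ws \<subseteq> {1..n}" "length ws = len n (st ws)" using ws reduced_word_iff by blast+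
    define vs where "vs = (SOME vs. reduced_word D vs \<and> weyl_word D vs = weyl_word D ws)"
    have vs: "reduced_word D vs \<and> weyl_word D vs = weyl_word D ws"
      unfolding vs_def by (rule someI[of _ ws]) (use ws in simp)
    hence v: "set vs \<subseteq> {1..n}" "length vs = len n (st vs)" using reduced_word_iff by blast+
    have "weyl_word D ws \<in> carrier (weyl D)"
      using weyl_word_wd[OF s(1) f] wd_N[where f = f, OF s(1) fN] by (simp add: carrier_weyl)
    hence "S (weyl_word D ws) = wd f vs" by (simp add: S_def vs_def)
    also have "\<dots> = wd f ws"
      by (rule GL.matsumoto[where n = n, OF N_GL[OF fN] braid v(1) s(1) _ v(2) s(2)])
        (use vs weyl_word_eq_iff[OF v(1) s(1)] in auto)
    finally show ?thesis .
  qed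
  have single: "reduced_word D [i]" "weyl_word D [i] = simple_refl D i" if i: "i \<in> {1..n}" for i
  proof -
    have "len n (st [i]) = 1"
      using len_move_up[OF i rho_state] rho_simple_root[OF i] by simp
    thus "reduced_word D [i]" using i by (simp add: reduced_word_iff)
    show "weyl_word D [i] = simple_refl D i"
      using weyl_word_wd[of "[i]" f] f i fN proj_simple_refl[OF i f[OF i]] by simp
  qed
  have Sf: "vals S i = f i" if i: "i \<in> {1..n}" for i
    using S[OF single(1)[OF i]] single(2)[OF i] fN[OF i] by simp
  have "is_section D S"
    unfolding is_section_def
  proof (intro conjI ballI allI impI)
    have *: "S w \<in> N \<and> proj D (S w) = w" if w: "w \<in> carrier (weyl D)" for w
    proof -
      obtain ws where ws: "reduced_word D ws" "weyl_word D ws = w" using weyl_reduced[OF w] .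
      have s: "set ws \<subseteq> {1..n}" using ws(1) reduced_word_iff by blast
      show ?thesis
        using S[OF ws(1)] ws(2) weyl_word_wd[OF s f] wd_N[where f = f, OF s fN] by simp
    qed
    thus "S \<in> carrier (weyl D) \<rightarrow>\<^sub>E N" by (auto simp: S_def)
    show "proj D (S w) = w" if "w \<in> carrier (weyl D)" for w using * that by blast
    show "S (weyl_word D ws) = wd (vals S) ws" if ws: "reduced_word D ws" for ws
    proof -
      have "wd (vals S) ws = wd f ws"
        using ws Sf by (intro foldr_cong) (auto simp: reduced_word_def rank)
      thus ?thesis using S[OF ws] by simp
    qed
  qed
  thus thesis using that Sf by blast
qed

text \<open>A letter that adds length extends a reduced word. One that lowers it cancels against the
  first letter of a reduced word, because its lift squares to 1. So the section is multiplicative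
  along all words, reduced or not.\<close>

lemma involutive_section_homomorphic:
  assumes S: "is_section D S" and inv: "\<And>i. i \<in> {1..n} \<Longrightarrow> vals S i * vals S i = 1\<^sub>m m"
  shows "homomorphic D S"
proof -
  let ?f = "vals S"
  have f: "?f i \<in> simple_refl D i" if "i \<in> {1..n}" for i using section_simple_refl[OF S that] .
  have fN: "?f i \<in> N" if "i \<in> {1..n}" for i using simple_refl_N f that by blast
  have word: "S (weyl_word D ws) = wd ?f ws" if "set ws \<subseteq> {1..n}" for ws
    using that
  proof (induction ws)
    case Nil
    have "reduced_word D []" by (simp add: reduced_word_iff)
    thus ?case using section_word[OF S] by blast
  next
    case (Cons i ws)
    hence i: "i \<in> {1..n}" and ws: "set ws \<subseteq> {1..n}" and IH: "S (weyl_word D ws) = wd ?f ws" by auto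
    have reduced: "\<exists>vs. set vs \<subseteq> {1..n} \<and> st vs = x \<and> length vs = len n x" if "x \<in> states n" for x
      using state_word[OF that] .
    have x: "st ws \<in> states n" using st_states[OF ws] .
    consider "len n (st (i # ws)) = Suc (len n (st ws))" | "len n (st ws) = Suc (len n (st (i # ws)))"
      using len_move_cases[OF i x] by auto
    thus ?case
    proof cases
      case 1
      obtain vs where vs: "set vs \<subseteq> {1..n}" "st vs = st ws" "length vs = len n (st ws)"
        using reduced[OF x] by blast
      have r: "reduced_word D vs" "reduced_word D (i # vs)"
        using vs i 1 by (simp_all add: reduced_word_iff)
      have "weyl_word D vs = weyl_word D ws" "weyl_word D (i # vs) = weyl_word D (i # ws)"
        using vs(1,2) ws i by (simp_all add: weyl_word_eq_iff)
      thus ?thesis using section_word[OF S r(1)] section_word[OF S r(2)] IH by simp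
    next
      case 2
      obtain vs where vs: "set vs \<subseteq> {1..n}" "st vs = st (i # ws)" "length vs = len n (st (i # ws))"
        using reduced[OF st_states[of "i # ws"]] i ws by auto
      have st: "st (i # vs) = st ws" using vs(2) by simp
      have r: "reduced_word D vs" "reduced_word D (i # vs)"
        using vs i 2 st by (simp_all add: reduced_word_iff del: foldr.simps)
      have "weyl_word D vs = weyl_word D (i # ws)" "weyl_word D (i # vs) = weyl_word D ws"
        using vs(1,2) ws i st by (simp_all add: weyl_word_eq_iff)
      hence "S (weyl_word D (i # ws)) = wd ?f vs" "wd ?f ws = ?f i * wd ?f vs"
        using section_word[OF S r(1)] section_word[OF S r(2)] IH by simp_all
      moreover have "?f i * (?f i * wd ?f vs) = wd ?f vs"
      proof -
        have "wd ?f vs \<in> N" by (rule wd_N[where f = ?f, OF vs(1) fN])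
        thus ?thesis using inv[OF i] fN[OF i] by (simp add: GL.m_assoc[symmetric])
      qed
      ultimately show ?thesis by simp
    qed
  qed
  have "S \<in> hom (weyl D) (normalizer_grp D)"
  proof (rule homI)
    fix w assume "w \<in> carrier (weyl D)"
    thus "S w \<in> carrier (normalizer_grp D)" using S by (auto simp: is_section_def)
  next
    fix w w' assume "w \<in> carrier (weyl D)" "w' \<in> carrier (weyl D)"
    then obtain us vs where us: "reduced_word D us" "weyl_word D us = w"
        and vs: "reduced_word D vs" "weyl_word D vs = w'"
      using weyl_reduced by metis
    have s: "set us \<subseteq> {1..n}" "set vs \<subseteq> {1..n}" using us vs reduced_word_iff by blast+
    note W = weyl_word_wd[of _ ?f, OF _ f]
    have N: "wd ?f us \<in> N" "wd ?f vs \<in> N"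
      by (rule wd_N[where f = ?f, OF s(1) fN] wd_N[where f = ?f, OF s(2) fN], assumption)+
    have app: "wd ?f (us @ vs) = wd ?f us * wd ?f vs" by (rule wd_append[OF s fN])
    have "w \<otimes>\<^bsub>weyl D\<^esub> w' = weyl_word D (us @ vs)"
      using us(2) vs(2) W[OF s(1)] W[OF s(2)] W[of "us @ vs"] s mult_weyl[OF N] app by simp
    thus "S (w \<otimes>\<^bsub>weyl D\<^esub> w') = S w \<otimes>\<^bsub>normalizer_grp D\<^esub> S w'"
      using word[of "us @ vs"] word[OF s(1)] word[OF s(2)] us(2) vs(2) s app by simp
  qed
  thus ?thesis using S by (simp add: homomorphic_def)
qed


section \<open>Torus parts of a section and their three signs\<close>

lemma wd_twist:
  assumes ws: "set ws \<subseteq> {1..n}" and t: "\<And>i. i \<in> {1..n} \<Longrightarrow> t i \<in> T"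
    and f: "\<And>i. i \<in> {1..n} \<Longrightarrow> f i = t i * \<sigma> i"
  shows "\<exists>s\<in>T. wd f ws = s * wd \<sigma> ws \<and> coords s = twist n (\<lambda>i. coords (t i)) ws"
  using ws
proof (induction ws)
  case Nil
  show ?case by (intro bexI[of _ "1\<^sub>m m"]) (auto simp: fun_eq_iff)
next
  case (Cons i ws)
  then obtain s where s: "s \<in> T" "wd f ws = s * wd \<sigma> ws" "coords s = twist n (\<lambda>i. coords (t i)) ws"
    by auto
  have i: "i \<in> {1..n}" and W: "wd \<sigma> ws \<in> N" using Cons.prems wd_N[of ws \<sigma>, OF _ \<sigma>_N] by auto
  let ?s = "t i * (\<sigma> i * s * iv (\<sigma> i))"
  have "wd f (i # ws) = ?s * wd \<sigma> (i # ws)"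
    using s(1,2) f[OF i] t[OF i] i W by (simp add: GL.m_assoc)
  moreover have "coords ?s = twist n (\<lambda>i. coords (t i)) (i # ws)"
    using coords_mult[OF t[OF i] conj_T[OF \<sigma>_N[OF i] s(1)]] coords_conj[OF i \<sigma>_simple_refl[OF i] s(1)]
    by (auto simp: fun_eq_iff s(3))
  moreover have "?s \<in> T" using t[OF i] s(1) i by simp
  ultimately show ?case by blast
qed

text \<open>Both sides have the same \<sigma> part by \<open>braid_\<sigma>\<close>, so the relation
  concerns the torus parts alone.\<close>

lemma braid_iff_twist:
  assumes t: "\<And>i. i \<in> {1..n} \<Longrightarrow> t i \<in> T" and f: "\<And>i. i \<in> {1..n} \<Longrightarrow> f i = t i * \<sigma> i"
    and b: "braid n c c'"
  shows "wd f c = wd f c' \<longleftrightarrow> twist n (\<lambda>i. coords (t i)) c = twist n (\<lambda>i. coords (t i)) c'"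
proof -
  have W: "wd \<sigma> c \<in> N" by (rule wd_N[where f = \<sigma>, OF braid_set(1)[OF b] \<sigma>_N])
  obtain s s' where s: "s \<in> T" "wd f c = s * wd \<sigma> c" "coords s = twist n (\<lambda>i. coords (t i)) c"
    and s': "s' \<in> T" "wd f c' = s' * wd \<sigma> c'" "coords s' = twist n (\<lambda>i. coords (t i)) c'"
    using wd_twist[OF braid_set(1)[OF b] t f] wd_twist[OF braid_set(2)[OF b] t f] by metis
  have "wd f c = wd f c' \<longleftrightarrow> s = s'"
    using s(1,2) s'(1,2) W braid_\<sigma>[OF b] by simp
  also have "\<dots> \<longleftrightarrow> coords s = coords s'" using coords_inject[OF s(1) s'(1)] by metis
  finally show ?thesis by (simp only: s(3) s'(3))
qed

definition shaped_section ::
  "('a mat set \<Rightarrow> 'a mat) \<Rightarrow> (nat \<Rightarrow> 'a mat) \<Rightarrow> 'a \<Rightarrow> 'a \<Rightarrow> 'a \<Rightarrow> bool" where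
  "shaped_section S t \<epsilon> \<mu> p \<longleftrightarrow> is_section D S \<and>
     (\<forall>i\<in>{1..n}. t i \<in> T \<and> vals S i = t i * \<sigma> i) \<and> section_shape n (\<lambda>i. coords (t i)) \<epsilon> \<mu> p"

lemma section_shaped:
  assumes "is_section D S"
  obtains t where "shaped_section S t (coords (t 1) n) (coords (t 1) 1 * coords (t 1) 2) (coords (t n) (n - 1))"
proof -
  have "\<exists>t. i \<in> {1..n} \<longrightarrow> t \<in> T \<and> vals S i = t * \<sigma> i" for i
    using section_simple_refl[OF assms, of i] by (auto simp: simple_refl_eq proj_eq)
  then obtain t0 where t0: "\<And>i. i \<in> {1..n} \<Longrightarrow> t0 i \<in> T \<and> vals S i = t0 i * \<sigma> i" by metis
  \<comment> \<open>The identity outside the range keeps all coordinates nonzero, as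
    \<open>section_shape_of_braid\<close> asks for every index.\<close>
  define t where "t i = (if i \<in> {1..n} then t0 i else 1\<^sub>m m)" for i
  have t: "t i \<in> T" for i using t0 by (simp add: t_def)
  have f: "vals S i = t i * \<sigma> i" if "i \<in> {1..n}" for i using t0 that by (simp add: t_def)
  have "section_shape n (\<lambda>i. coords (t i)) (coords (t 1) n) (coords (t 1) 1 * coords (t 1) 2)
      (coords (t n) (n - 1))"
  proof (rule section_shape_of_braid)
    show "twist n (\<lambda>i. coords (t i)) c k = twist n (\<lambda>i. coords (t i)) c' k" if "braid n c c'" for c c' k
      using section_braid[OF assms that] braid_iff_twist[of t "vals S", OF t f that] by simp
  qed (use rank t in simp_all)
  thus thesis using that assms t f unfolding shaped_section_def by blast
qed

lemma shaped_sectionD: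
  assumes "shaped_section S t \<epsilon> \<mu> p"
  shows "is_section D S" "i \<in> {1..n} \<Longrightarrow> t i \<in> T" "i \<in> {1..n} \<Longrightarrow> vals S i = t i * \<sigma> i"
    and "\<epsilon> * \<epsilon> = 1" "\<mu> * \<mu> = 1" "p * p = 1"
    and "1 \<le> i \<Longrightarrow> i < n \<Longrightarrow> 1 \<le> k \<Longrightarrow> k \<le> n \<Longrightarrow> k \<noteq> i \<Longrightarrow> k \<noteq> Suc i \<Longrightarrow> coords (t i) k = \<epsilon>"
    and "1 \<le> i \<Longrightarrow> i < n \<Longrightarrow> coords (t i) i * coords (t i) (Suc i) = \<mu>"
    and "1 \<le> k \<Longrightarrow> k < n \<Longrightarrow> coords (t n) k = p"
  using assms unfolding shaped_section_def section_shape_def by auto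

text \<open>The square is \<open>t i\<close> times its reflection times the square of \<sigma>. On a
  swapped pair the first two contribute \<mu> and the last -1; elsewhere a sign is squared, and at
  the inverted position the inverses cancel.\<close>

lemma square_coords:
  assumes S: "shaped_section S t \<epsilon> \<mu> p" and i: "i \<in> {1..n}"
  shows "vals S i * vals S i \<in> T"
    and "coords (vals S i * vals S i) = (\<lambda>k. if i < n \<and> (k = i \<or> k = Suc i) then - \<mu> else 1)"
proof -
  note D = shaped_sectionD[OF S]
  have t: "t i \<in> T" using D(2)[OF i] .
  let ?s = "\<sigma> i * t i * iv (\<sigma> i)"
  have s: "?s \<in> T" using t i by simp
  have eq: "vals S i * vals S i = t i * ?s * (\<sigma> i * \<sigma> i)"
    using D(3)[OF i] t i by (simp add: GL.m_assoc)
  show "vals S i * vals S i \<in> T" using eq t s \<sigma>_square(1)[OF i] by simp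
  show "coords (vals S i * vals S i) = (\<lambda>k. if i < n \<and> (k = i \<or> k = Suc i) then - \<mu> else 1)"
  proof
    fix k
    have c: "coords (vals S i * vals S i) k = coords (t i) k * reflect inverse n i (coords (t i)) k *
        (if i < n \<and> (k = i \<or> k = Suc i) then - 1 else 1)"
      unfolding eq using t s \<sigma>_square[OF i] coords_conj[OF i \<sigma>_simple_refl[OF i] t]
      by (simp add: coords_mult)
    show "coords (vals S i * vals S i) k = (if i < n \<and> (k = i \<or> k = Suc i) then - \<mu> else 1)"
    proof (cases "k \<in> {1..n}")
      case False
      thus ?thesis using coords_outside i by auto
    next
      case k: True
      consider "i < n" "k = i" | "i < n" "k = Suc i" | "i < n" "k \<noteq> i" "k \<noteq> Suc i"
        | "i = n" "k < n" | "i = n" "k = n"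
        using i k by fastforce
      thus ?thesis
      proof cases
        case 1
        thus ?thesis using c i D(8)[of i] by (simp add: reflect_apply transpose_def)
      next
        case 2
        thus ?thesis using c i D(8)[of i] by (simp add: reflect_apply transpose_def mult.commute)
      next
        case 3
        thus ?thesis using c i k D(7)[of i k] D(4) by (simp add: reflect_apply transpose_def)
      next
        case 4
        thus ?thesis using c i k D(9)[of k] D(6) by (simp add: reflect_apply)
      next
        case 5
        thus ?thesis using c t by (simp add: reflect_apply)
      qed
    qed
  qed
qed

section \<open>Orders and order profiles\<close>

lemma one_ne_minus_one: "(1::'a) \<noteq> - 1"
proof
  assume "(1::'a) = - 1"
  hence "(1::'a) + 1 = - 1 + 1" by simp
  thus False using two_nonzero by simp
qed

lemma square_eq_one_iff:
  assumes S: "shaped_section S t \<epsilon> \<mu> p" and i: "i \<in> {1..n}"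
  shows "vals S i * vals S i = 1\<^sub>m m \<longleftrightarrow> i = n \<or> \<mu> = - 1"
proof -
  have "vals S i * vals S i = 1\<^sub>m m \<longleftrightarrow> coords (vals S i * vals S i) = coords (1\<^sub>m m)"
    using coords_inject[OF square_coords(1)[OF S i] T_one] by metis
  also have "\<dots> \<longleftrightarrow> i = n \<or> \<mu> = - 1"
    unfolding square_coords(2)[OF S i]
  proof
    assume eq: "(\<lambda>k. if i < n \<and> (k = i \<or> k = Suc i) then - \<mu> else 1) = coords (1\<^sub>m m)"
    show "i = n \<or> \<mu> = - 1"
    proof (cases "i = n")
      case False
      hence "- \<mu> = 1" using fun_cong[OF eq, of i] i by simp
      hence "- (- \<mu>) = - 1" by (rule arg_cong)
      thus ?thesis by simp
    qed simp
  qed auto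
  finally show ?thesis .
qed

lemma vals_ne_one:
  assumes S: "is_section D S" and i: "i \<in> {1..n}"
  shows "vals S i \<noteq> 1\<^sub>m m"
proof
  assume 1: "vals S i = 1\<^sub>m m"
  have "proj D (wd (vals S) [i]) = proj D (wd (vals S) [])" using 1 by simp
  hence "st [i] = st []"
    using proj_wd_eq_iff[of "[i]" "[]" "vals S"] i section_simple_refl[OF S] by simp
  moreover have "len n (st [i]) = 1"
    using len_move_up[OF i rho_state] rho_simple_root[OF i] by simp
  ultimately show False by simp
qed

text \<open>The square has signs as coordinates, so the order divides 4, and it is not 1 because
  simple reflections are nontrivial in W. Whether the square is trivial decides between 2 and
  4.\<close>

lemma elt_order_vals:
  assumes S: "shaped_section S t \<epsilon> \<mu> p" and i: "i \<in> {1..n}"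
  shows "elt_order D (vals S i) = (if i = n \<or> \<mu> = - 1 then 2 else 4)"
proof -
  let ?g = "vals S i"
  have g: "?g \<in> carrier (GL m)"
    using simple_refl_N[OF i section_simple_refl[OF shaped_sectionD(1)[OF S] i]] by simp
  have p2: "?g [^]\<^bsub>GL m\<^esub> (2::nat) = ?g * ?g"
    using GL.nat_pow_Suc[of ?g 1] g by (simp add: numeral_2_eq_2)
  have sq: "(?g * ?g) * (?g * ?g) = 1\<^sub>m m"
  proof (rule coords_inject)
    have c: "coords (?g * ?g) k * coords (?g * ?g) k = 1" for k
      using square_coords(2)[OF S i] shaped_sectionD(5)[OF S] by simp
    show "coords (?g * ?g * (?g * ?g)) = coords (1\<^sub>m m)"
      using coords_mult[OF square_coords(1)[OF S i] square_coords(1)[OF S i]] c by (simp add: fun_eq_iff)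
  qed (use square_coords(1)[OF S i] in simp_all)
  have "?g [^]\<^bsub>GL m\<^esub> (2 + 2::nat) = 1\<^sub>m m"
    using GL.nat_pow_mult[OF g, of 2 2] p2 sq by simp
  hence p4: "?g [^]\<^bsub>GL m\<^esub> (4::nat) = 1\<^sub>m m" by simp
  have ne1: "GL.ord ?g \<noteq> 1"
    using GL.ord_eq_1[OF g] vals_ne_one[OF shaped_sectionD(1)[OF S] i] by simp
  have iff: "GL.ord ?g dvd 2 \<longleftrightarrow> i = n \<or> \<mu> = - 1"
    using GL.pow_eq_id[OF g, of 2] p2 square_eq_one_iff[OF S i] by simp
  have "GL.ord ?g dvd 4" using GL.pow_eq_id[OF g, of 4] p4 by simp
  moreover have "d = 1 \<or> d = 2 \<or> d = 4" if "d dvd 4" for d :: nat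
  proof -
    have "d \<le> 4" using dvd_imp_le[OF that] by simp
    moreover have "d \<noteq> 0" "d \<noteq> 3" using that by (intro notI; simp)+
    ultimately show ?thesis by arith
  qed
  ultimately have "GL.ord ?g = 2 \<or> GL.ord ?g = 4" using ne1 by blast
  hence "GL.ord ?g = (if i = n \<or> \<mu> = - 1 then 2 else 4)"
    using iff by (elim disjE) simp_all
  thus ?thesis by (simp add: elt_order_def numeral_eq_enat)
qed

lemma mu_cases: "shaped_section S t \<epsilon> \<mu> p \<Longrightarrow> \<mu> = 1 \<or> \<mu> = - 1"
  using shaped_sectionD(5) square_eq_1_iff by blast

definition profile :: "'a \<Rightarrow> nat \<Rightarrow> enat" where
  "profile \<mu> = (\<lambda>i\<in>{1..n}. if i = n \<or> \<mu> = - 1 then 2 else 4)"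

lemma order_profile_shaped:
  "shaped_section S t \<epsilon> \<mu> p \<Longrightarrow> order_profile D S = profile \<mu>"
  unfolding order_profile_def profile_def rank by (intro restrict_ext elt_order_vals)

lemma profile_neq: "profile 1 \<noteq> profile (- 1)"
proof
  assume "profile 1 = profile (- 1)"
  hence "profile 1 1 = profile (- 1) 1" by simp
  thus False using rank one_ne_minus_one by (simp add: profile_def)
qed

lemma profile_less: "profile_less D (profile 1) (profile (- 1))"
  unfolding profile_less_def rank using profile_neq by (simp add: profile_def)

lemma tits_exists: "\<exists>!S. tits_section D S"
proof -
  obtain S where S: "is_section D S" "\<And>i. i \<in> {1..n} \<Longrightarrow> vals S i = \<sigma> i"
    by (rule section_exists[of \<sigma>]) (use \<sigma>_simple_refl braid_\<sigma> in blast)+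
  hence "tits_section D S" by (simp add: tits_section_def rank)
  moreover have "S' = S" if "tits_section D S'" for S'
    using that S by (intro section_eqI) (simp_all add: tits_section_def rank)
  ultimately show ?thesis by blast
qed

lemma shaped_unique:
  assumes S: "shaped_section S t \<epsilon> \<mu> p" and s: "\<And>i. i \<in> {1..n} \<Longrightarrow> s i \<in> T"
    and "\<And>i. i \<in> {1..n} \<Longrightarrow> vals S i = s i * \<sigma> i" and i: "i \<in> {1..n}"
  shows "t i = s i"
proof -
  have "t i * \<sigma> i = s i * \<sigma> i" using shaped_sectionD(3)[OF S i] assms(3)[OF i] by simp
  thus ?thesis using shaped_sectionD(2)[OF S i] s[OF i] i by simp
qed

lemma shaped_mu:
  assumes S: "shaped_section S t \<epsilon> \<mu> p"
  shows "\<mu> = coords (t 1) 1 * coords (t 1) 2"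
  using shaped_sectionD(8)[OF S, of 1] rank by (simp add: numeral_2_eq_2)

lemma tits_shape:
  assumes N0: "tits_section D S"
  shows "\<exists>t \<epsilon> p. shaped_section S t \<epsilon> 1 p"
proof -
  obtain t \<epsilon> \<mu> p where S: "shaped_section S t \<epsilon> \<mu> p"
    using section_shaped N0 unfolding tits_section_def by metis
  have "t 1 = 1\<^sub>m m"
    by (rule shaped_unique[OF S, of "\<lambda>_. 1\<^sub>m m"]) (use N0 rank in \<open>auto simp: tits_section_def\<close>)
  hence "\<mu> = 1" using shaped_mu[OF S] by simp
  thus ?thesis using S by blast
qed

lemma optimal_shape_exists: "\<exists>S t \<epsilon> p. shaped_section S t \<epsilon> (- 1) p"
proof -
  let ?Y = "\<lambda>i k. if k = i \<and> i < n then - 1 else 1 :: 'a"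
  have "\<exists>t\<in>T. i \<in> {1..n} \<longrightarrow> coords t = ?Y i" for i
  proof (cases "i \<in> {1..n}")
    case True
    obtain t where "t \<in> T" "coords t = ?Y i" by (rule coords_surj[of "?Y i"]) (use True in auto)
    thus ?thesis by blast
  qed (use T_one in blast)
  then obtain t where t: "\<And>i. t i \<in> T" "\<And>i. i \<in> {1..n} \<Longrightarrow> coords (t i) = ?Y i" by metis
  let ?f = "\<lambda>i. t i * \<sigma> i"
  have "?f i \<in> simple_refl D i" if "i \<in> {1..n}" for i
    unfolding simple_refl_eq[OF that] proj_eq using t(1) by blast
  moreover have "wd ?f c = wd ?f c'" if b: "braid n c c'" for c c'
  proof -
    have tw: "twist n (\<lambda>i. coords (t i)) ws = twist n ?Y ws" if "set ws \<subseteq> {1..n}" for ws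
      using that by (induction ws) (auto simp: t(2) twist_def)
    have "twist n ?Y c = twist n ?Y c'" using twist_optimal[OF b] by blast
    thus ?thesis
      using braid_iff_twist[of t ?f, OF t(1) refl b] tw[OF braid_set(1)[OF b]] tw[OF braid_set(2)[OF b]]
      by simp
  qed
  ultimately obtain S where S: "is_section D S" "\<And>i. i \<in> {1..n} \<Longrightarrow> vals S i = ?f i"
    using section_exists[of ?f] by blast
  obtain s \<epsilon> \<mu> p where shape: "shaped_section S s \<epsilon> \<mu> p" using section_shaped[OF S(1)] by metis
  have "s 1 = t 1" by (rule shaped_unique[OF shape t(1) S(2)]) (use rank in auto)
  hence "\<mu> = - 1" using shaped_mu[OF shape] t(2)[of 1] rank by simp
  thus ?thesis using shape by blast
qed

section \<open>Fundamental coweight coordinates of a section\<close>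

lemma alpha_nonzero [simp]: "t \<in> T \<Longrightarrow> alpha D i t \<noteq> 0"
  by (simp add: alpha_def)

lemma torus_pt_alpha:
  assumes "t \<in> T"
  shows "torus_pt D (\<lambda>j. alpha D j t) = t"
proof -
  have nz: "alpha D j t \<noteq> 0" for j using assms by (simp add: alpha_def)
  have T: "torus_pt D (\<lambda>j. alpha D j t) \<in> T" using torus_pt_T[of "\<lambda>j. alpha D j t"] nz by blast
  have "coords (torus_pt D (\<lambda>j. alpha D j t)) = coords t"
    by (rule coords_from_alpha[OF T])
      (use alpha_torus_pt[of "\<lambda>j. alpha D j t"] nz assms coords_outside in \<open>simp_all add: alpha_coords\<close>)
  thus ?thesis using coords_inject[OF T assms] by blast
qed

lemma section_coords_exist:
  assumes "is_section D S"
  shows "\<exists>a. section_coords D S a"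
proof -
  obtain t \<epsilon> \<mu> p where S: "shaped_section S t \<epsilon> \<mu> p" using section_shaped[OF assms] by metis
  have "section_coords D S (\<lambda>i j. alpha D j (t i))"
    using shaped_sectionD(2,3)[OF S] by (simp add: section_coords_def rank torus_pt_alpha)
  thus ?thesis by blast
qed

lemma section_coords_values:
  assumes S: "shaped_section S t \<epsilon> \<mu> p" and a: "section_coords D S a" and i: "i \<in> {1..n}" "j \<in> {1..n}"
  shows "a i j = (if j < n then coords (t i) j / coords (t i) (Suc j) else coords (t i) n)"
proof -
  have nz: "a i j \<noteq> 0" if "i \<in> {1..n}" "j \<in> {1..n}" for i j
    using a that by (auto simp: section_coords_def rank)
  have v: "vals S i = torus_pt D (a i) * \<sigma> i" if "i \<in> {1..n}" for i
    using a that by (auto simp: section_coords_def rank)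
  have "t i = torus_pt D (a i)"
    by (rule shaped_unique[OF S torus_pt_T v i(1)]) (use nz in blast)+
  thus ?thesis
    using alpha_torus_pt[of "a i" j] nz[OF i(1)] i(2) alpha_coords[OF i(2) shaped_sectionD(2)[OF S i(1)]]
    by simp
qed

text \<open>Coordinate \<open>j\<close> is the value of a simple root, for \<open>j < n\<close> a
  ratio of neighbouring \<open>coords\<close>. With the sign \<epsilon> next to the free pair,
  \<open>a i i * a i (i + 1) ^ 2\<close> collapses to the product of that pair, and the last two
  coordinates at node \<open>n\<close> telescope to \<open>p\<close>.\<close>

lemma section_coords_invariants:
  assumes S: "shaped_section S t \<epsilon> \<mu> p" and a: "section_coords D S a"
  shows "a 1 n = \<epsilon>" "a 1 1 * a 1 2 ^ 2 = \<mu>" "a n (n - 1) * a n n = p"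
    and "optimal_coords n a \<longleftrightarrow> \<mu> = - 1"
proof -
  note D = shaped_sectionD[OF S] and v = section_coords_values[OF S a]
  have nz: "coords (t i) k \<noteq> 0" if "i \<in> {1..n}" for i k using D(2)[OF that] by simp
  have \<epsilon>: "\<epsilon> ^ 2 = 1" "\<epsilon> \<noteq> 0" using D(4) by (auto simp: power2_eq_square)
  show an: "a 1 n = \<epsilon>" using v[of 1 n] D(7)[of 1 n] rank by simp
  have ii: "a i i * a i (i + 1) ^ 2 = \<mu>" if i: "1 \<le> i" "i \<le> n - 2" for i
  proof -
    have i': "i \<in> {1..n}" "Suc i \<in> {1..n}" "i < n" "Suc i < n" using i rank by auto
    have "coords (t i) (Suc (Suc i)) = \<epsilon>" using i' by (intro D(7)) auto
    hence "a i i = coords (t i) i / coords (t i) (Suc i)" "a i (i + 1) = coords (t i) (Suc i) / \<epsilon>"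
      using v[OF i'(1,1)] v[OF i'(1,2)] i'(3,4) by simp_all
    hence "a i i * a i (i + 1) ^ 2 = coords (t i) i * coords (t i) (Suc i) / \<epsilon> ^ 2"
      using nz[OF i'(1)] by (simp add: power2_eq_square)
    thus ?thesis using D(8)[of i] i(1) i'(3) \<epsilon>(1) by simp
  qed
  show "a 1 1 * a 1 2 ^ 2 = \<mu>" using ii[of 1] rank by (simp add: numeral_2_eq_2)
  define l where "l = n - 2"
  have l: "n = Suc (Suc l)" "l \<ge> 4" using rank by (auto simp: l_def)
  show p: "a n (n - 1) * a n n = p"
    using v[of n "n - 1"] v[of n n] D(9)[of "n - 1"] rank nz[of n n] l by simp
  show "optimal_coords n a \<longleftrightarrow> \<mu> = - 1"
  proof
    assume "optimal_coords n a"
    hence "a 1 1 * a 1 (1 + 1) ^ 2 = - 1" using rank by (simp add: optimal_coords_def)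
    thus "\<mu> = - 1" using ii[of 1] rank by simp
  next
    assume \<mu>: "\<mu> = - 1"
    let ?c = "coords (t (Suc l))"
    have Sl: "Suc l \<in> {1..n}" "l \<in> {1..n}" "n \<in> {1..n}" using l by auto
    have c: "?c (Suc l) * ?c n = - 1" "?c l = \<epsilon>"
      using D(8)[of "Suc l"] D(7)[of "Suc l" l] l \<mu> by simp_all
    have cnz: "?c k \<noteq> 0" for k using nz[OF Sl(1)] .
    have a1: "a (Suc l) (Suc l) = ?c (Suc l) / ?c n" "a (Suc l) l = \<epsilon> / ?c (Suc l)" "a (Suc l) n = ?c n"
      using v[OF Sl(1,1)] v[OF Sl(1,2)] v[OF Sl(1,3)] c(2) l(1) by simp_all
    \<comment> \<open>At node n - 1 the neighbour with value \<epsilon> is on the left, so the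
      expression is the inverse of \<mu>; it is -1 as well.\<close>
    have "a (Suc l) (Suc l) * a (Suc l) l ^ 2 = \<epsilon> ^ 2 / (?c (Suc l) * ?c n)"
      unfolding a1 using cnz by (simp add: field_simps power2_eq_square)
    hence 2: "a (Suc l) (Suc l) * a (Suc l) l ^ 2 = - 1" unfolding c(1) \<epsilon>(1) by simp
    have "a (Suc l) n ^ 4 * a (Suc l) (Suc l) ^ 2 = (?c (Suc l) * ?c n) ^ 2"
      unfolding a1 using cnz[of n] by (simp add: power_mult_distrib power_divide eval_nat_numeral)
    hence 3: "a (Suc l) n ^ 4 * a (Suc l) (Suc l) ^ 2 = 1" unfolding c(1) by simp
    have 4: "a n (n - 1) ^ 2 * a n n ^ 2 = 1"
      unfolding power_mult_distrib[symmetric] p using D(6) by (simp add: power2_eq_square)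
    have 5: "a i n ^ 2 = 1" if "i \<in> {1..n-2}" for i
      using v[of i n] D(7)[of i n] that \<epsilon>(1) l(1) by simp
    have 1: "a i i * a i (i + 1) ^ 2 = - 1" if "i \<in> {1..n-2}" for i
      using ii[of i] that \<mu> by simp
    show "optimal_coords n a"
      unfolding optimal_coords_def using 1 2 3 4 5 l(1) by simp
  qed
qed


section \<open>Conjugation of sections by the torus\<close>

lemma conj_vals:
  assumes S: "shaped_section S t \<epsilon> \<mu> p" and z: "z \<in> T" and i: "i \<in> {1..n}"
  obtains s where "s \<in> T" "z * vals S i * iv z = s * \<sigma> i"
    "\<And>k. coords s k = coords (t i) k * coords z k / reflect inverse n i (coords z) k"
proof -
  note D = shaped_sectionD[OF S]
  have t: "t i \<in> T" using D(2)[OF i] .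
  let ?s = "t i * z * iv (\<sigma> i * z * iv (\<sigma> i))"
  have s: "?s \<in> T" using t z i by simp
  have "z * vals S i * iv z = ?s * \<sigma> i"
  proof -
    have "?s * \<sigma> i = (t i * z) * \<sigma> i * iv z"
      using t z i by (simp add: GL.inv_mult_group GL.m_assoc)
    also have "\<dots> = (z * t i) * \<sigma> i * iv z" using T_comm[OF t z] by simp
    finally show ?thesis using D(3)[OF i] t z i by (simp add: GL.m_assoc)
  qed
  moreover have "coords ?s k = coords (t i) k * coords z k / reflect inverse n i (coords z) k" for k
    using t z i coords_conj[OF i \<sigma>_simple_refl[OF i] z]
    by (simp add: coords_mult coords_inv divide_inverse)
  ultimately show thesis using that s by blast
qed

lemma T_conjugate_iff_vals:
  assumes S: "is_section D S" and S': "is_section D S'"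
  shows "T_conjugate D S S' \<longleftrightarrow> (\<exists>z\<in>T. \<forall>i\<in>{1..n}. z * vals S i * iv z = vals S' i)"
proof
  assume "T_conjugate D S S'"
  thus "\<exists>z\<in>T. \<forall>i\<in>{1..n}. z * vals S i * iv z = vals S' i"
    using simple_refl_weyl unfolding T_conjugate_def by blast
next
  assume "\<exists>z\<in>T. \<forall>i\<in>{1..n}. z * vals S i * iv z = vals S' i"
  then obtain z where z: "z \<in> T" "\<And>i. i \<in> {1..n} \<Longrightarrow> z * vals S i * iv z = vals S' i" by blast
  have N: "vals S i \<in> N" if "i \<in> {1..n}" for i
    using simple_refl_N[OF that section_simple_refl[OF S that]] .
  have word: "z * wd (vals S) ws * iv z = wd (vals S') ws" if "set ws \<subseteq> {1..n}" for ws
    using that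
  proof (induction ws)
    case Nil
    thus ?case using z(1) by simp
  next
    case (Cons i ws)
    hence i: "i \<in> {1..n}" and W: "wd (vals S) ws \<in> N" using wd_N[where f = "vals S", OF _ N] by auto
    have "z * wd (vals S) (i # ws) * iv z = (z * vals S i * iv z) * (z * wd (vals S) ws * iv z)"
      using z(1) N[OF i] W by (simp add: GL.m_assoc)
    thus ?case using Cons z(2)[OF i] by simp
  qed
  have "z * S w * iv z = S' w" if w: "w \<in> carrier (weyl D)" for w
  proof -
    obtain ws where ws: "reduced_word D ws" "weyl_word D ws = w" using weyl_reduced[OF w] .
    show ?thesis
      using word[of ws] section_word[OF S ws(1)] section_word[OF S' ws(1)] ws
      by (simp add: reduced_word_iff)
  qed
  thus "T_conjugate D S S'" using z(1) unfolding T_conjugate_def by blast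
qed

text \<open>Conjugation by \<open>z\<close> multiplies a torus part by \<open>z\<close> divided by
  its reflection. This factor is 1 away from the reflected positions and has product 1 over a
  swapped pair, so the signs persist. Conversely, the ratios of neighbouring coordinates of
  \<open>z\<close> and the square of its last one can be prescribed, which matches the free
  coordinates.\<close>

lemma T_conjugate_iff:
  assumes S: "shaped_section S t \<epsilon> \<mu> p" and S': "shaped_section S' t' \<epsilon>' \<mu>' p'"
  shows "T_conjugate D S S' \<longleftrightarrow> \<epsilon> = \<epsilon>' \<and> \<mu> = \<mu>' \<and> p = p'"
proof -
  note D = shaped_sectionD[OF S] and D' = shaped_sectionD[OF S']
  have nz: "coords (t i) k \<noteq> 0" "coords (t' i) k \<noteq> 0" if "i \<in> {1..n}" for i k
    using D(2)[OF that] D'(2)[OF that] by simp_all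
  have ends: "1 \<in> {1..n}" "n \<in> {1..n}" "1 < n" using rank by auto
  have "T_conjugate D S S' \<longleftrightarrow> (\<exists>z\<in>T. \<forall>i\<in>{1..n}. z * vals S i * iv z = vals S' i)"
    by (rule T_conjugate_iff_vals[OF D(1) D'(1)])
  also have "\<dots> \<longleftrightarrow> \<epsilon> = \<epsilon>' \<and> \<mu> = \<mu>' \<and> p = p'"
  proof
    assume "\<exists>z\<in>T. \<forall>i\<in>{1..n}. z * vals S i * iv z = vals S' i"
    then obtain z where z: "z \<in> T" "\<And>i. i \<in> {1..n} \<Longrightarrow> z * vals S i * iv z = vals S' i" by blast
    have c: "coords (t' i) k = coords (t i) k * coords z k / reflect inverse n i (coords z) k"
      if i: "i \<in> {1..n}" for i k
    proof -
      obtain s where s: "s \<in> T" "z * vals S i * iv z = s * \<sigma> i"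
        "\<And>k. coords s k = coords (t i) k * coords z k / reflect inverse n i (coords z) k"
        using conj_vals[OF S z(1) i] by blast
      have "t' i * \<sigma> i = s * \<sigma> i" using D'(3)[OF i] z(2)[OF i] s(2) by simp
      hence "t' i = s" using s(1) D'(2)[OF i] i by simp
      thus ?thesis using s(3) by simp
    qed
    have "\<epsilon>' = \<epsilon>"
      using c[OF ends(1), of n] D(7)[of 1 n] D'(7)[of 1 n] rank z(1)
      by (simp add: reflect_apply transpose_def)
    moreover have "\<mu>' = \<mu>"
      using c[OF ends(1), of 1] c[OF ends(1), of "Suc 1"] D(8)[of 1] D'(8)[of 1] ends z(1)
      by (simp add: reflect_apply transpose_def)
    moreover have "p' = p"
      using c[OF ends(2), of 1] D(9)[of 1] D'(9)[of 1] ends z(1)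
      by (simp add: reflect_apply)
    ultimately show "\<epsilon> = \<epsilon>' \<and> \<mu> = \<mu>' \<and> p = p'" by simp
  next
    assume eq: "\<epsilon> = \<epsilon>' \<and> \<mu> = \<mu>' \<and> p = p'"
    define r where "r k = coords (t' k) k / coords (t k) k" for k
    have r: "r k \<noteq> 0" if "k \<in> {1..n}" for k using nz[OF that] by (simp add: r_def)
    \<comment> \<open>At the short root the conjugation factor is the square of the last coordinate
      of \<open>z\<close>, so a square root is taken.\<close>
    obtain y where y: "y ^ 2 = r n" using nth_root_exists[of 2 "r n"] by auto
    hence y0: "y \<noteq> 0" using r[OF ends(2)] by auto
    \<comment> \<open>The product telescopes: entry \<open>k\<close> divided by the next one is
      \<open>r k\<close>.\<close>
    let ?z = "\<lambda>k. if k \<in> {1..n} then y * (\<Prod>l\<in>{k..<n}. r l) else 1"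
    have znz: "?z k \<noteq> 0" for k using y0 r by auto
    have zout: "?z k = 1" if "k \<notin> {1..n}" for k using that by (rule if_not_P)
    obtain z where z: "z \<in> T" "coords z = ?z"
      by (rule coords_surj[of ?z, OF znz zout]) (assumption, rule that)
    have zn: "coords z n = y" using ends unfolding z(2) by simp
    have zr: "coords z i = r i * coords z (Suc i)" if "1 \<le> i" "i < n" for i
      using that unfolding z(2) by (simp add: prod.atLeast_Suc_lessThan)
    have "z * vals S i * iv z = vals S' i" if i: "i \<in> {1..n}" for i
    proof -
      obtain s where s: "s \<in> T" "z * vals S i * iv z = s * \<sigma> i"
        "\<And>k. coords s k = coords (t i) k * coords z k / reflect inverse n i (coords z) k"
        using conj_vals[OF S z(1) i] by blast
      have cz: "coords z k \<noteq> 0" for k using z(1) by simp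
      have "coords s k = coords (t' i) k" for k
      proof (cases "k \<in> {1..n}")
        case False
        thus ?thesis using coords_outside by simp
      next
        case k: True
        consider "i < n" "k = i" | "i < n" "k = Suc i" | "i < n" "k \<noteq> i" "k \<noteq> Suc i"
          | "i = n" "k < n" | "i = n" "k = n"
          using i k by fastforce
        thus ?thesis
        proof cases
          case 1
          thus ?thesis
            using s(3)[of k] zr[of i] cz[of "Suc i"] i nz[OF i]
            by (simp add: reflect_apply transpose_def r_def)
        next
          case 2
          \<comment> \<open>The choice of \<open>z\<close> matches coordinate \<open>i\<close>; the
            next one follows from the common product \<mu>.\<close>
          have m: "coords (t i) i * coords (t i) (Suc i) = coords (t' i) i * coords (t' i) (Suc i)"
            using D(8)[of i] D'(8)[of i] i 2 eq by simp
          have "coords s (Suc i) = coords (t i) (Suc i) / r i"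
            using s(3)[of k] 2 zr[of i] cz[of "Suc i"] i
            by (simp add: reflect_apply transpose_def)
          also have "\<dots> = coords (t' i) (Suc i)"
            using m nz[OF i] by (simp add: r_def field_simps)
          finally show ?thesis using 2 by simp
        next
          case 3
          thus ?thesis
            using s(3)[of k] cz[of k] i k D(7)[of i k] D'(7)[of i k] eq
            by (simp add: reflect_apply transpose_def)
        next
          case 4
          thus ?thesis
            using s(3)[of k] cz[of k] i k D(9)[of k] D'(9)[of k] eq
            by (simp add: reflect_apply)
        next
          case 5
          have "coords s n = coords (t n) n * y ^ 2"
            using s(3)[of n] 5 zn by (simp add: reflect_apply power2_eq_square divide_inverse)
          thus ?thesis using 5 y nz[OF i] by (simp add: r_def)
        qed
      qed
      hence "s = t' i" using coords_inject[OF s(1) D'(2)[OF i]] by blast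
      thus ?thesis using s(2) D'(3)[OF i] by simp
    qed
    thus "\<exists>z\<in>T. \<forall>i\<in>{1..n}. z * vals S i * iv z = vals S' i" using z(1) by blast
  qed
  finally show ?thesis .
qed

section \<open>Optimal and homomorphic sections\<close>

lemma order_profiles_eq: "order_profiles D = {profile 1, profile (- 1)}"
proof (intro equalityI subsetI)
  fix q assume "q \<in> order_profiles D"
  then obtain S where S: "is_section D S" "q = order_profile D S" by (auto simp: order_profiles_def)
  obtain t \<epsilon> \<mu> p where sh: "shaped_section S t \<epsilon> \<mu> p" using section_shaped[OF S(1)] by metis
  show "q \<in> {profile 1, profile (- 1)}"
    using order_profile_shaped[OF sh] mu_cases[OF sh] S(2) by auto
next
  fix q assume q: "q \<in> {profile 1, profile (- 1)}"
  obtain N0 where N0: "tits_section D N0" using tits_exists by blast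
  obtain t \<epsilon> p where sh: "shaped_section N0 t \<epsilon> 1 p" using tits_shape[OF N0] by blast
  obtain S t' \<epsilon>' p' where sh': "shaped_section S t' \<epsilon>' (- 1) p'" using optimal_shape_exists by blast
  show "q \<in> order_profiles D"
    using q order_profile_shaped[OF sh] order_profile_shaped[OF sh']
      shaped_sectionD(1)[OF sh] shaped_sectionD(1)[OF sh']
    unfolding order_profiles_def by auto metis+
qed

lemma optimal_iff:
  assumes S: "shaped_section S t \<epsilon> \<mu> p"
  shows "optimal D S \<longleftrightarrow> \<mu> = - 1"
proof -
  have "\<not> profile_less D (profile (- 1)) (profile 1)"
  proof
    assume "profile_less D (profile (- 1)) (profile 1)"
    hence "profile 1 1 \<le> profile (- 1) 1" using rank by (simp add: profile_less_def)
    thus False using rank one_ne_minus_one by (simp add: profile_def)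
  qed
  hence "maximal_profile D q \<longleftrightarrow> q = profile (- 1)" for q
    using profile_less by (auto simp: maximal_profile_def order_profiles_eq profile_less_def)
  hence "optimal D S \<longleftrightarrow> (\<forall>q. q = profile (- 1) \<longleftrightarrow> q = profile \<mu>)"
    by (simp add: optimal_def order_profile_shaped[OF S] shaped_sectionD(1)[OF S])
  also have "\<dots> \<longleftrightarrow> profile (- 1) = profile \<mu>" by metis
  also have "\<dots> \<longleftrightarrow> \<mu> = - 1" using mu_cases[OF S] profile_neq by metis
  finally show ?thesis .
qed

text \<open>A homomorphism squares the lift of the first simple reflection to 1, which forces \<mu>
  = -1. Conversely, \<mu> = -1 makes the lifts of all simple reflections involutions.\<close>

lemma homomorphic_iff:
  assumes S: "shaped_section S t \<epsilon> \<mu> p"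
  shows "homomorphic D S \<longleftrightarrow> \<mu> = - 1"
proof
  assume "\<mu> = - 1"
  thus "homomorphic D S"
    using square_eq_one_iff[OF S] by (intro involutive_section_homomorphic[OF shaped_sectionD(1)[OF S]]) simp
next
  assume h: "homomorphic D S"
  have 1: "1 \<in> {1..n}" using rank by simp
  have N: "\<sigma> 1 \<in> N" using 1 by simp
  have "simple_refl D 1 \<otimes>\<^bsub>weyl D\<^esub> simple_refl D 1 = weyl_word D [1, 1]"
    using weyl_word_wd[of "[1, 1]" \<sigma>, OF _ \<sigma>_simple_refl] 1 N mult_weyl[OF N N] by (simp add: simple_refl_eq)
  also have "\<dots> = weyl_word D []" using weyl_word_eq_iff[of "[1, 1]" "[]"] 1 by simp
  finally have eq: "simple_refl D 1 \<otimes>\<^bsub>weyl D\<^esub> simple_refl D 1 = weyl_word D []" .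
  have "S (simple_refl D 1 \<otimes>\<^bsub>weyl D\<^esub> simple_refl D 1) = vals S 1 * vals S 1"
    using h hom_mult[OF _ simple_refl_weyl[OF 1] simple_refl_weyl[OF 1], of S "normalizer_grp D"]
    by (simp add: homomorphic_def)
  hence "vals S 1 * vals S 1 = S (weyl_word D [])" unfolding eq by simp
  moreover have "S (weyl_word D []) = 1\<^sub>m m"
    using section_word[OF shaped_sectionD(1)[OF S], of "[]"] by (simp add: reduced_word_iff)
  ultimately show "\<mu> = - 1" using square_eq_one_iff[OF S 1] rank by simp
qed

end

theorem proposition3p8:
  fixes D :: "'a::alg_closed_field realized_group" and n :: nat
  assumes char_not_2: "(2::'a) \<noteq> 0"
    and rank: "rnk D = n" "n \<ge> 6"
    and adjoint: "adjoint_type_B D"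
    and self_centralizing: "centralizer (group_of D) (torus_of D) = torus_of D"
    and coweights: "fundamental_coweights D"
    and realization: "realization D"
  shows
    "card (order_profiles D) = 2
     \<and> order_profiles D =
         {order_profile D S | S a. is_section D S \<and> section_coords D S a \<and> optimal_coords n a}
         \<union> {order_profile D S | S. tits_section D S}
     \<and> (\<forall>S a. is_section D S \<and> section_coords D S a \<and> optimal_coords n a
           \<longrightarrow> optimal D S \<and> homomorphic D S)
     \<and> (\<exists>!N0. tits_section D N0)
     \<and> (\<forall>N0. tits_section D N0 \<longrightarrow>
           \<not> optimal D N0 \<and> \<not> homomorphic D N0
           \<and> (\<forall>i\<in>{1..n-1}. N0 (simple_refl D i) * N0 (simple_refl D i) \<noteq> 1\<^sub>m (msize D))
           \<and> N0 (simple_refl D n) * N0 (simple_refl D n) = 1\<^sub>m (msize D))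
     \<and> (\<forall>S. is_section D S \<longrightarrow> elt_order D (S (simple_refl D n)) = 2)
     \<and> (\<forall>S S' a a'. is_section D S \<and> section_coords D S a
             \<and> is_section D S' \<and> section_coords D S' a' \<longrightarrow>
           (T_conjugate D S S' \<longleftrightarrow>
              a 1 n = a' 1 n
              \<and> a 1 1 * a 1 2 ^ 2 = a' 1 1 * a' 1 2 ^ 2
              \<and> a n (n-1) * a n n = a' n (n-1) * a' n n))"
proof -
  interpret realized_B D n by unfold_locales fact+
  have opt_shape: "\<exists>t \<epsilon> p. shaped_section S t \<epsilon> (- 1) p"
    if S: "is_section D S" "section_coords D S a" "optimal_coords n a" for S a
  proof -
    obtain t \<epsilon> \<mu> p where sh: "shaped_section S t \<epsilon> \<mu> p" using section_shaped[OF S(1)] by metis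
    hence "\<mu> = - 1" using section_coords_invariants(4)[OF sh S(2)] S(3) by simp
    thus ?thesis using sh by blast
  qed
  have profiles_opt: "{order_profile D S | S a. is_section D S \<and> section_coords D S a \<and> optimal_coords n a}
      = {profile (- 1)}"
  proof -
    obtain S t \<epsilon> p where sh: "shaped_section S t \<epsilon> (- 1) p" using optimal_shape_exists by blast
    obtain a where a: "section_coords D S a" using section_coords_exist[OF shaped_sectionD(1)[OF sh]] by blast
    have "profile (- 1) = order_profile D S \<and> is_section D S \<and> section_coords D S a \<and> optimal_coords n a"
      using order_profile_shaped[OF sh] shaped_sectionD(1)[OF sh] section_coords_invariants(4)[OF sh a] a by simp
    moreover have "order_profile D S' = profile (- 1)"
      if "is_section D S'" "section_coords D S' a'" "optimal_coords n a'" for S' a'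
      using opt_shape[OF that] order_profile_shaped by metis
    ultimately show ?thesis by blast
  qed
  have profiles_tits: "{order_profile D S | S. tits_section D S} = {profile 1}"
  proof -
    have eq: "order_profile D S = profile 1" if "tits_section D S" for S
      using tits_shape[OF that] order_profile_shaped by metis
    obtain N0 where N0: "tits_section D N0" using tits_exists by blast
    show ?thesis
    proof (intro equalityI subsetI)
      fix q assume "q \<in> {profile 1}"
      hence "q = order_profile D N0" using eq[OF N0] by simp
      thus "q \<in> {order_profile D S | S. tits_section D S}" using N0 by blast
    qed (use eq in auto)
  qed
  have opt: "optimal D S \<and> homomorphic D S"
    if "is_section D S" "section_coords D S a" "optimal_coords n a" for S a
    using opt_shape[OF that] optimal_iff homomorphic_iff by metis
  have tits: "\<not> optimal D N0 \<and> \<not> homomorphic D N0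
      \<and> (\<forall>i\<in>{1..n-1}. vals N0 i * vals N0 i \<noteq> 1\<^sub>m m) \<and> vals N0 n * vals N0 n = 1\<^sub>m m"
    if N0: "tits_section D N0" for N0
  proof -
    obtain t \<epsilon> p where sh: "shaped_section N0 t \<epsilon> 1 p" using tits_shape[OF N0] by blast
    have "vals N0 i * vals N0 i \<noteq> 1\<^sub>m m" if "i \<in> {1..n-1}" for i
    proof -
      have "i \<in> {1..n}" "i \<noteq> n" using that rank(2) by auto
      thus ?thesis using square_eq_one_iff[OF sh] one_ne_minus_one by blast
    qed
    moreover have "vals N0 n * vals N0 n = 1\<^sub>m m" using square_eq_one_iff[OF sh, of n] rank(2) by simp
    ultimately show ?thesis
      using optimal_iff[OF sh] homomorphic_iff[OF sh] one_ne_minus_one by blast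
  qed
  have short: "elt_order D (vals S n) = 2" if S: "is_section D S" for S
  proof -
    obtain t \<epsilon> \<mu> p where sh: "shaped_section S t \<epsilon> \<mu> p" using section_shaped[OF S] by metis
    show ?thesis using elt_order_vals[OF sh, of n] rank(2) by simp
  qed
  have conj: "T_conjugate D S S' \<longleftrightarrow> a 1 n = a' 1 n \<and> a 1 1 * a 1 2 ^ 2 = a' 1 1 * a' 1 2 ^ 2
      \<and> a n (n-1) * a n n = a' n (n-1) * a' n n"
    if S: "is_section D S" "section_coords D S a" and S': "is_section D S'" "section_coords D S' a'"
    for S S' a a'
  proof -
    obtain t \<epsilon> \<mu> p where sh: "shaped_section S t \<epsilon> \<mu> p" using section_shaped[OF S(1)] by metis
    obtain t' \<epsilon>' \<mu>' p' where sh': "shaped_section S' t' \<epsilon>' \<mu>' p'" using section_shaped[OF S'(1)] by metis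
    show ?thesis
      unfolding section_coords_invariants(1-3)[OF sh S(2)] section_coords_invariants(1-3)[OF sh' S'(2)]
      by (rule T_conjugate_iff[OF sh sh'])
  qed
  have "card (order_profiles D) = 2" using profile_neq by (simp add: order_profiles_eq)
  moreover have "order_profiles D =
      {order_profile D S | S a. is_section D S \<and> section_coords D S a \<and> optimal_coords n a}
      \<union> {order_profile D S | S. tits_section D S}"
    unfolding profiles_opt profiles_tits order_profiles_eq by auto
  ultimately show ?thesis
    using opt tits_exists tits short conj by (intro conjI allI impI) blast+
qed

end
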